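(* Let $n\ge1$. (i) The T-ideal of trace relations, that is the kernel of the evaluation map $\mathcal T\to\mathcal T_n$, is generated as a T-ideal by the trace relations $T_{e,f}$ with $e,f\ge0$, $e+f=n+1$, together with $t(1)=n$. (ii) The T-ideal of trace identities of $n\times n$ matrices, that is the kernel of the evaluation map $ev:\mathcal F_T\langle X,Y\rangle\to M_n(S)$, is generated as a T-ideal by the $n+1$ Cayley--Hamilton identities $CH_{e,f}$, $e+f=n+1$, and $t(1)=n$.
   Context: All algebras are over $\mathbb C$. A superalgebra is a $\mathbb Z/2$-graded associative algebra; it is supercommutative if $ab=(-1)^{d(a)d(b)}ba$ for homogeneous $a,b$ of degrees $d(a),d(b)$. A superalgebra with trace is a superalgebra $R$ with a linear degree-preserving map $t:R\to R$ such that for homogeneous $a,b$: $t(a)b=(-1)^{d(a)d(b)}b\,t(a)$, $t(ab)=(-1)^{d(a)d(b)}t(ba)$, $t(t(a)b)=t(a)t(b)$. $\mathcal F_T\langle X,Y\rangle$ is the free superalgebra with trace on infinitely many degree $1$ (fermionic) variables $X=\{x_1,x_2,\dots\}$ and infinitely many degree $0$ (bosonic) variables $Y=\{y_1,y_2,\dots\}$; $\mathcal T=t(\mathcal F_T\langle X,Y\rangle)$ is its trace algebra (the free supercommutative superalgebra generated by the traces $t(M)$ of monomials $M$, including $t(1)$, modulo signed cyclic equivalence $t(AB)=(-1)^{d(A)d(B)}t(BA)$). A substitution is an endomorphism of $\mathcal F_T\langle X,Y\rangle$ (as superalgebra with trace) given by replacing fermionic variables by degree $1$ elements and bosonic variables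 by degree $0$ elements. A T-ideal of $\mathcal F_T\langle X,Y\rangle$ is a graded two-sided ideal stable under $t$ and closed under all substitutions; a T-ideal of $\mathcal T$ is a graded ideal of $\mathcal T$ closed under all substitutions. "Generated by $t(1)=n$" means including $t(1)-n$ among the generators. $S$ is the free supercommutative superalgebra on the degree $0$ variables $\eta^{(i)}_{h,k}$ and degree $1$ variables $\xi^{(j)}_{h,k}$, $1\le h,k\le n$, $i,j=1,2,\dots$; $\eta_i=(\eta^{(i)}_{h,k})$, $\xi_j=(\xi^{(j)}_{h,k})\in M_n(S)$ are the generic matrices. $M_n(S)$ is a superalgebra with trace for the usual trace, and $ev$ is the trace-preserving homomorphism $y_i\mapsto\eta_i$, $x_j\mapsto\xi_j$. $\mathcal T_n$ is the algebra of invariants $S^G$, for the action of $G=GL(n,\mathbb C)$ by algebra automorphisms of $S$ such that the matrices with entries $g\cdot \eta^{(i)}_{h,k}$, $g\cdot\xi^{(j)}_{h,k}$ are $g^{-1}\eta_ig$, $g^{-1}\xi_jg$. The map $\mathcal T\to\mathcal T_n$ is the restriction of $ev$. Definition of $T_{e,f}$ and $CH_{e,f}$ for $e+f=m=n+1$. Put $z_i=y_i$ for $1\le i\le e$ and $z_{e+j}=x_j$ for $1\le j\le f$; indices $>e$ are called fermionic. Let $\sigma\in S_m$, written in cycle form $(w_1)(w_2)\cdots(w_r)$, each $w_k$ a word in the indices (a cycle $(i_1,i_2,\dots)$ means $i_1\mapsto i_2\mapsto\cdots$), including fixed points. For a word $w=i_1\cdots i_s$ write $z_w=z_{i_1}\cdots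 z_{i_s}$ ($z_\emptyset=1$). Let $\epsilon(w_1\cdots w_r)$ be the sign of the permutation that sorts into increasing order the subsequence of fermionic indices of the concatenated word. Then $\Phi_\sigma=\epsilon(w_1\cdots w_r)\,t(z_{w_1})\cdots t(z_{w_r})$, and, if the cycle form is chosen so that the last cycle is $w_r=u\,m$, ending with $m$, $\Psi_\sigma=\epsilon(w_1\cdots w_{r-1}u)\,t(z_{w_1})\cdots t(z_{w_{r-1}})\,z_u$. Both are independent of the display. With $\epsilon_\sigma$ the sign of $\sigma$, $$T_{e,f}(y_1,\dots,y_e,x_1,\dots,x_f)=\sum_{\sigma\in S_{n+1}}\epsilon_\sigma\Phi_\sigma,\qquad CH_{e,f}=\sum_{\sigma\in S_{n+1}}\epsilon_\sigma\Psi_\sigma .$$ For $f\ge1$, $CH_{e,f}$ is an expression in $y_1,\dots,y_e,x_1,\dots,x_{f-1}$; the $n+1$ pairs $(e,f)$ with $e+f=n+1$, $f\ge1$ give the $n+1$ Cayley--Hamilton identities ($CH_{n+1,0}$ coincides with $CH_{n,1}$). *)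

theory Defs
  imports "HOL-Analysis.Analysis" "HOL-Library.Z2" "HOL-Combinatorics.Combinatorics"
begin

section \<open>Superalgebras and superalgebras with trace\<close>

text \<open>
  All algebras are unital over \<open>\<complex>\<close>; the \<open>\<complex>\<close>-algebra structure is given by the central ring
  homomorphism \<open>const\<close>, i.e. \<open>c\<close> times \<open>a\<close> is \<open>const c \<star> a\<close>.  The multiplication is an explicit
  parameter so that matrices under \<open>**\<close> are an instance.  Degrees live in the field
  \<^typ>\<open>bit\<close> of integers mod 2, and \<open>koszul p q\<close> is the sign \<open>(-1) ^ (p q)\<close>.
\<close>

definition koszul :: "bit \<Rightarrow> bit \<Rightarrow> complex" where
  "koszul p q = (if p * q = 1 then -1 else 1)"

locale superalgebra =
  fixes mul :: "'a::ab_group_add \<Rightarrow> 'a \<Rightarrow> 'a"  (infixl \<open>\<star>\<close> 70)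
    and const :: "complex \<Rightarrow> 'a"
    and hom :: "bit \<Rightarrow> 'a set"
  assumes mult_assoc: "(a \<star> b) \<star> c = a \<star> (b \<star> c)"
    and distrib_right: "(a + b) \<star> c = a \<star> c + b \<star> c"
    and distrib_left: "a \<star> (b + c) = a \<star> b + a \<star> c"
    and one_left: "const 1 \<star> a = a"
    and one_right: "a \<star> const 1 = a"
    and const_add: "const (u + v) = const u + const v"
    and const_mult: "const (u * v) = const u \<star> const v"
    and const_central: "const u \<star> a = a \<star> const u"
    and hom_const: "const u \<in> hom 0"
    and hom_add: "a \<in> hom p \<Longrightarrow> b \<in> hom p \<Longrightarrow> a + b \<in> hom p"
    and hom_mult: "a \<in> hom p \<Longrightarrow> b \<in> hom q \<Longrightarrow> a \<star> b \<in> hom (p + q)"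
    and hom_zero: "0 \<in> hom p"
    and hom_sum: "\<exists>b\<in>hom 0. \<exists>c\<in>hom 1. a = b + c"
    and hom_disjoint: "a \<in> hom 0 \<Longrightarrow> a \<in> hom 1 \<Longrightarrow> a = 0"

locale supercommutative_superalgebra = superalgebra mul const hom
  for mul :: "'a::ab_group_add \<Rightarrow> 'a \<Rightarrow> 'a"  (infixl \<open>\<star>\<close> 70) and const hom +
  assumes supercomm: "a \<in> hom p \<Longrightarrow> b \<in> hom q \<Longrightarrow> a \<star> b = const (koszul p q) \<star> (b \<star> a)"

locale superalgebra_with_trace = superalgebra mul const hom
  for mul :: "'a::ab_group_add \<Rightarrow> 'a \<Rightarrow> 'a"  (infixl \<open>\<star>\<close> 70) and const hom +
  fixes tr :: "'a \<Rightarrow> 'a"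
  assumes tr_add: "tr (a + b) = tr a + tr b"
    and tr_scale: "tr (const u \<star> a) = const u \<star> tr a"
    and tr_hom: "a \<in> hom p \<Longrightarrow> tr a \<in> hom p"
    and tr_central: "a \<in> hom p \<Longrightarrow> b \<in> hom q \<Longrightarrow> tr a \<star> b = const (koszul p q) \<star> (b \<star> tr a)"
    and tr_cyclic: "a \<in> hom p \<Longrightarrow> b \<in> hom q \<Longrightarrow> tr (a \<star> b) = const (koszul p q) \<star> tr (b \<star> a)"
    and tr_tr: "a \<in> hom p \<Longrightarrow> b \<in> hom q \<Longrightarrow> tr (tr a \<star> b) = tr a \<star> tr b"

lemma (in superalgebra) const_0: "const 0 = 0"
  using const_add[of 0 0] by simp

lemma (in superalgebra) mult_0: "0 \<star> a = 0"
  using distrib_right[of 0 0 a] by simp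

lemma bit_add_self: "(p::bit) + p = 0"
  by (cases p) auto


section \<open>The free superalgebra with trace\<close>

text \<open>
  The free superalgebra with trace on the fermionic variables \<open>x\<^sub>1, x\<^sub>2, \<dots>\<close> and the bosonic
  variables \<open>y\<^sub>1, y\<^sub>2, \<dots>\<close> is built as the quotient of the term algebra by the congruence that
  the axioms generate; its universal property is \<open>free_trace_universal\<close> below.  Indices start
  at 0: \<open>FX i\<close> and \<open>FY i\<close> stand for \<open>x\<close> and \<open>y\<close> with index \<open>i + 1\<close>.
\<close>

datatype ftterm = FX nat | FY nat | FConst complex
  | FAdd ftterm ftterm | FMul ftterm ftterm | FTr ftterm

inductive ftdeg :: "bit \<Rightarrow> ftterm \<Rightarrow> bool" where
  "ftdeg 1 (FX i)"
| "ftdeg 0 (FY i)"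
| "ftdeg 0 (FConst u)"
| "ftdeg p a \<Longrightarrow> ftdeg p b \<Longrightarrow> ftdeg p (FAdd a b)"
| "ftdeg p a \<Longrightarrow> ftdeg q b \<Longrightarrow> ftdeg (p + q) (FMul a b)"
| "ftdeg p a \<Longrightarrow> ftdeg p (FTr a)"

inductive ftcong :: "ftterm \<Rightarrow> ftterm \<Rightarrow> bool"  (infix \<open>\<approx>\<^sub>t\<close> 50) where
  ft_refl: "a \<approx>\<^sub>t a"
| ft_sym: "a \<approx>\<^sub>t b \<Longrightarrow> b \<approx>\<^sub>t a"
| ft_trans: "a \<approx>\<^sub>t b \<Longrightarrow> b \<approx>\<^sub>t c \<Longrightarrow> a \<approx>\<^sub>t c"
| ft_Add: "a \<approx>\<^sub>t a' \<Longrightarrow> b \<approx>\<^sub>t b' \<Longrightarrow> FAdd a b \<approx>\<^sub>t FAdd a' b'"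
| ft_Mul: "a \<approx>\<^sub>t a' \<Longrightarrow> b \<approx>\<^sub>t b' \<Longrightarrow> FMul a b \<approx>\<^sub>t FMul a' b'"
| ft_Tr: "a \<approx>\<^sub>t a' \<Longrightarrow> FTr a \<approx>\<^sub>t FTr a'"
| ft_add_assoc: "FAdd (FAdd a b) c \<approx>\<^sub>t FAdd a (FAdd b c)"
| ft_add_comm: "FAdd a b \<approx>\<^sub>t FAdd b a"
| ft_add_0: "FAdd (FConst 0) a \<approx>\<^sub>t a"
| ft_mult_assoc: "FMul (FMul a b) c \<approx>\<^sub>t FMul a (FMul b c)"
| ft_distrib_right: "FMul (FAdd a b) c \<approx>\<^sub>t FAdd (FMul a c) (FMul b c)"
| ft_distrib_left: "FMul a (FAdd b c) \<approx>\<^sub>t FAdd (FMul a b) (FMul a c)"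
| ft_one: "FMul (FConst 1) a \<approx>\<^sub>t a"
| ft_zero: "FMul (FConst 0) a \<approx>\<^sub>t FConst 0"
| ft_const_add: "FConst (u + v) \<approx>\<^sub>t FAdd (FConst u) (FConst v)"
| ft_const_mult: "FConst (u * v) \<approx>\<^sub>t FMul (FConst u) (FConst v)"
| ft_const_central: "FMul (FConst u) a \<approx>\<^sub>t FMul a (FConst u)"
| ft_tr_add: "FTr (FAdd a b) \<approx>\<^sub>t FAdd (FTr a) (FTr b)"
| ft_tr_scale: "FTr (FMul (FConst u) a) \<approx>\<^sub>t FMul (FConst u) (FTr a)"
| ft_tr_central: "ftdeg p a \<Longrightarrow> ftdeg q b \<Longrightarrow>
    FMul (FTr a) b \<approx>\<^sub>t FMul (FConst (koszul p q)) (FMul b (FTr a))"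
| ft_tr_cyclic: "ftdeg p a \<Longrightarrow> ftdeg q b \<Longrightarrow>
    FTr (FMul a b) \<approx>\<^sub>t FMul (FConst (koszul p q)) (FTr (FMul b a))"
| ft_tr_tr: "ftdeg p a \<Longrightarrow> ftdeg q b \<Longrightarrow> FTr (FMul (FTr a) b) \<approx>\<^sub>t FMul (FTr a) (FTr b)"

quotient_type ft = ftterm / ftcong
  by (rule equivpI) (auto intro!: reflpI sympI transpI intro: ft_refl ft_sym ft_trans)

text \<open>Augmentation used to see that the quotient is not the zero ring.\<close>

primrec ft_aug :: "ftterm \<Rightarrow> complex" where
  "ft_aug (FX i) = 0"
| "ft_aug (FY i) = 0"
| "ft_aug (FConst u) = u"
| "ft_aug (FAdd a b) = ft_aug a + ft_aug b"
| "ft_aug (FMul a b) = ft_aug a * ft_aug b"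
| "ft_aug (FTr a) = 0"

lemma ftcong_aug: "a \<approx>\<^sub>t b \<Longrightarrow> ft_aug a = ft_aug b"
  by (induction rule: ftcong.induct) (auto simp: algebra_simps)

instantiation ft :: ring_1
begin

lift_definition zero_ft :: ft is "FConst 0" .
lift_definition one_ft :: ft is "FConst 1" .
lift_definition plus_ft :: "ft \<Rightarrow> ft \<Rightarrow> ft" is FAdd by (rule ft_Add)
lift_definition times_ft :: "ft \<Rightarrow> ft \<Rightarrow> ft" is FMul by (rule ft_Mul)
lift_definition uminus_ft :: "ft \<Rightarrow> ft" is "FMul (FConst (-1))" by (rule ft_Mul[OF ft_refl])
definition minus_ft :: "ft \<Rightarrow> ft \<Rightarrow> ft" where "minus_ft a b = a + - b"

instance
proof
  fix a b c :: ft
  show "a + b + c = a + (b + c)" by transfer (rule ft_add_assoc)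
  show "a + b = b + a" by transfer (rule ft_add_comm)
  show "0 + a = a" by transfer (rule ft_add_0)
  show "a * b * c = a * (b * c)" by transfer (rule ft_mult_assoc)
  show "(a + b) * c = a * c + b * c" by transfer (rule ft_distrib_right)
  show "a * (b + c) = a * b + a * c" by transfer (rule ft_distrib_left)
  show "1 * a = a" by transfer (rule ft_one)
  show "a * 1 = a" by transfer (rule ft_trans[OF ft_sym[OF ft_const_central] ft_one])
  show "a - b = a + - b" by (rule minus_ft_def)
  show "(0::ft) \<noteq> 1" by transfer (use ftcong_aug in force)
  show "- a + a = 0"
  proof transfer
    fix a
    note [trans] = ft_trans
    have "FAdd (FMul (FConst (-1)) a) a \<approx>\<^sub>t FAdd (FMul (FConst (-1)) a) (FMul (FConst 1) a)"
      by (intro ft_Add ft_refl ft_sym[OF ft_one])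
    also have "\<dots> \<approx>\<^sub>t FMul (FAdd (FConst (-1)) (FConst 1)) a"
      by (rule ft_sym[OF ft_distrib_right])
    also have "\<dots> \<approx>\<^sub>t FMul (FConst (-1 + 1)) a"
      by (intro ft_Mul ft_refl ft_sym[OF ft_const_add])
    also have "FMul (FConst (-1 + 1)) a \<approx>\<^sub>t FConst 0"
      by (simp add: ft_zero)
    finally show "FAdd (FMul (FConst (-1)) a) a \<approx>\<^sub>t FConst 0" .
  qed
qed

end

lift_definition ftx :: "nat \<Rightarrow> ft" is FX .
lift_definition fty :: "nat \<Rightarrow> ft" is FY .
lift_definition ftconst :: "complex \<Rightarrow> ft" is FConst .
lift_definition ftr :: "ft \<Rightarrow> ft" is FTr by (rule ft_Tr)

definition ftgrade :: "bit \<Rightarrow> ft set" where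
  "ftgrade p = abs_ft ` {a. ftdeg p a}"

lemma abs_rep_ft: "abs_ft (rep_ft a) = a"
  by (rule Quotient3_abs_rep[OF Quotient3_ft])

lemma abs_ft_simps:
  "abs_ft (FX i) = ftx i" "abs_ft (FY i) = fty i" "abs_ft (FConst u) = ftconst u"
  "abs_ft (FAdd a b) = abs_ft a + abs_ft b" "abs_ft (FMul a b) = abs_ft a * abs_ft b"
  "abs_ft (FTr a) = ftr (abs_ft a)"
  by (simp_all add: ftx.abs_eq fty.abs_eq ftconst.abs_eq plus_ft.abs_eq times_ft.abs_eq ftr.abs_eq)

lemma ftconst_simps [simp]: "ftconst 0 = 0" "ftconst 1 = 1"
  by (transfer, rule ft_refl)+

lemma ftconst_add: "ftconst (u + v) = ftconst u + ftconst v"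
  by transfer (rule ft_const_add)

lemma ftconst_mult: "ftconst (u * v) = ftconst u * ftconst v"
  by transfer (rule ft_const_mult)

lemma ftconst_central: "ftconst u * a = a * ftconst u"
  by transfer (rule ft_const_central)

lemma ftconst_minus: "ftconst (- u) = - ftconst u"
  using ftconst_add[of "- u" u] by (simp add: eq_neg_iff_add_eq_0)

text \<open>The parity involution, used to see that the sum of the two degrees is direct.\<close>

primrec ft_par :: "ftterm \<Rightarrow> ftterm" where
  "ft_par (FX i) = FMul (FConst (-1)) (FX i)"
| "ft_par (FY i) = FY i"
| "ft_par (FConst u) = FConst u"
| "ft_par (FAdd a b) = FAdd (ft_par a) (ft_par b)"
| "ft_par (FMul a b) = FMul (ft_par a) (ft_par b)"
| "ft_par (FTr a) = FTr (ft_par a)"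

lemma ftdeg_scale: "ftdeg p a \<Longrightarrow> ftdeg p (FMul (FConst u) a)"
  using ftdeg.intros(5)[OF ftdeg.intros(3), of p a u] by (simp del: add_bit_eq_xor)

lemma ftdeg_par: "ftdeg p a \<Longrightarrow> ftdeg p (ft_par a)"
  by (induction rule: ftdeg.induct) (simp_all add: ftdeg.intros ftdeg_scale del: add_bit_eq_xor)

lemma ftcong_par: "a \<approx>\<^sub>t b \<Longrightarrow> ft_par a \<approx>\<^sub>t ft_par b"
proof (induction rule: ftcong.induct)
  case (ft_trans a b c)
  then show ?case by (blast intro: ftcong.ft_trans)
next
  case (ft_sym a b)
  then show ?case by (blast intro: ftcong.ft_sym)
qed (auto intro: ftcong.intros ftdeg_par simp del: minus_add_distrib)

lift_definition ftpar :: "ft \<Rightarrow> ft" is ft_par by (rule ftcong_par)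

lemma ftpar_add: "ftpar (a + b) = ftpar a + ftpar b"
  by transfer (simp add: ft_refl)

lemma ftpar_mul: "ftpar (a * b) = ftpar a * ftpar b"
  by transfer (simp add: ft_refl)

lemma ftpar_gen: "ftpar (ftx i) = - ftx i" "ftpar (fty i) = fty i" "ftpar (ftconst u) = ftconst u"
  by (transfer, simp add: ft_refl)+

lemma ftpar_tr: "ftpar (ftr a) = ftr (ftpar a)"
  by transfer (simp add: ft_refl)

lemma ftpar_deg: "ftdeg p a \<Longrightarrow> ftpar (abs_ft a) = (if p = 1 then - abs_ft a else abs_ft a)"
proof (induction rule: ftdeg.induct)
  case (4 p a b)
  then show ?case by (auto simp: ftpar_add abs_ft_simps)
next
  case (5 p a q b)
  show ?case unfolding abs_ft_simps ftpar_mul "5.IH" by (cases p; cases q) simp_all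
next
  case (6 p a)
  have "ftr (- c) = - ftr c" for c
    by transfer (rule ft_tr_scale)
  with 6 show ?case by (auto simp: ftpar_tr abs_ft_simps)
qed (auto simp: ftpar_gen abs_ft_simps)

lemma ftgrade_add: "a \<in> ftgrade p \<Longrightarrow> b \<in> ftgrade p \<Longrightarrow> a + b \<in> ftgrade p"
  unfolding ftgrade_def by (auto simp flip: abs_ft_simps intro!: imageI ftdeg.intros)

lemma ftgrade_mult: "a \<in> ftgrade p \<Longrightarrow> b \<in> ftgrade q \<Longrightarrow> a * b \<in> ftgrade (p + q)"
  unfolding ftgrade_def by (elim imageE, simp only: mem_Collect_eq flip: abs_ft_simps) (intro imageI CollectI ftdeg.intros)

lemma ftgrade_tr: "a \<in> ftgrade p \<Longrightarrow> ftr a \<in> ftgrade p"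
  unfolding ftgrade_def by (auto simp flip: abs_ft_simps intro!: imageI ftdeg.intros)

lemma ftgrade_const: "ftconst u \<in> ftgrade 0"
  unfolding ftgrade_def by (auto simp flip: abs_ft_simps intro!: imageI ftdeg.intros)

lemma ftgrade_x: "ftx i \<in> ftgrade 1"
  unfolding ftgrade_def by (auto simp flip: abs_ft_simps intro!: imageI ftdeg.intros)

lemma ftgrade_y: "fty i \<in> ftgrade 0"
  unfolding ftgrade_def by (auto simp flip: abs_ft_simps intro!: imageI ftdeg.intros)

lemma ftgrade_zero: "0 \<in> ftgrade p"
proof (cases p)
  assume "p = 0"
  then show ?thesis using ftgrade_const[of 0] by simp
next
  assume "p = 1"
  then show ?thesis using ftgrade_mult[OF ftgrade_const[of 0] ftgrade_x] by simp
qed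

lemma ftr_add: "ftr (a + b) = ftr a + ftr b"
  by transfer (rule ft_tr_add)

lemma ft_sum_grade: "\<exists>b\<in>ftgrade 0. \<exists>c\<in>ftgrade 1. abs_ft a = b + c"
proof (induction a)
  case (FX i)
  show ?case using ftgrade_zero[of 0] ftgrade_x[of i] by (force simp: abs_ft_simps)
next
  case (FY i)
  show ?case using ftgrade_zero[of 1] ftgrade_y[of i] by (force simp: abs_ft_simps)
next
  case (FConst u)
  show ?case using ftgrade_zero[of 1] ftgrade_const[of u] by (force simp: abs_ft_simps)
next
  case (FAdd a b)
  then obtain a0 a1 b0 b1 where *: "a0 \<in> ftgrade 0" "a1 \<in> ftgrade 1" "abs_ft a = a0 + a1"
    "b0 \<in> ftgrade 0" "b1 \<in> ftgrade 1" "abs_ft b = b0 + b1" by auto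
  have "abs_ft (FAdd a b) = (a0 + b0) + (a1 + b1)"
    using * by (simp add: abs_ft_simps algebra_simps)
  then show ?case using * ftgrade_add by blast
next
  case (FMul a b)
  then obtain a0 a1 b0 b1 where *: "a0 \<in> ftgrade 0" "a1 \<in> ftgrade 1" "abs_ft a = a0 + a1"
    "b0 \<in> ftgrade 0" "b1 \<in> ftgrade 1" "abs_ft b = b0 + b1" by auto
  have "abs_ft (FMul a b) = (a0 * b0 + a1 * b1) + (a0 * b1 + a1 * b0)"
    using * by (simp add: abs_ft_simps algebra_simps)
  moreover have "a0 * b0 + a1 * b1 \<in> ftgrade 0" "a0 * b1 + a1 * b0 \<in> ftgrade 1"
    using ftgrade_mult[OF *(1) *(4)] ftgrade_mult[OF *(2) *(5)]
      ftgrade_mult[OF *(1) *(5)] ftgrade_mult[OF *(2) *(4)]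
    by (auto intro: ftgrade_add)
  ultimately show ?case by blast
next
  case (FTr a)
  then obtain a0 a1 where *: "a0 \<in> ftgrade 0" "a1 \<in> ftgrade 1" "abs_ft a = a0 + a1" by auto
  then show ?case using ftgrade_tr ftr_add by (metis abs_ft_simps(6))
qed

lemma ft_double_zero: "a = - a \<Longrightarrow> a = 0" for a :: ft
proof -
  assume "a = - a"
  then have "a + a = 0" by (simp add: eq_neg_iff_add_eq_0)
  then have "ftconst (1/2 + 1/2) * a = 0"
    unfolding ftconst_add by (metis distrib_left distrib_right mult_zero_right)
  then show ?thesis by simp
qed

interpretation ft: superalgebra_with_trace "(*)" ftconst ftgrade ftr
proof
  fix a b :: ft and u v p q
  show "\<exists>b\<in>ftgrade 0. \<exists>c\<in>ftgrade 1. a = b + c"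
    using ft_sum_grade[of "rep_ft a"] by (simp add: abs_rep_ft)
  show "a \<in> ftgrade 0 \<Longrightarrow> a \<in> ftgrade 1 \<Longrightarrow> a = 0"
    by (rule ft_double_zero) (auto simp: ftgrade_def dest!: ftpar_deg)
  show "ftr (ftconst u * a) = ftconst u * ftr a"
    by transfer (rule ft_tr_scale)
  assume "a \<in> ftgrade p" "b \<in> ftgrade q"
  then obtain s t where "ftdeg p s" "ftdeg q t" "a = abs_ft s" "b = abs_ft t"
    by (auto simp: ftgrade_def)
  then show "ftr a * b = ftconst (koszul p q) * (b * ftr a)"
    and "ftr (a * b) = ftconst (koszul p q) * ftr (b * a)"
    and "ftr (ftr a * b) = ftr a * ftr b"
    by (simp_all flip: abs_ft_simps add: ft.abs_eq_iff ft_tr_central ft_tr_cyclic ft_tr_tr)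
qed (rule ftconst_central | simp add: mult.assoc ring_distribs ftconst_add ftconst_mult ftgrade_const
      ftgrade_add ftgrade_mult ftgrade_zero ftr_add ftgrade_tr del: add_bit_eq_xor)+

subsection \<open>Homomorphisms out of the free superalgebra with trace\<close>

definition trace_hom ::
  "('a::ab_group_add \<Rightarrow> 'a \<Rightarrow> 'a) \<Rightarrow> (complex \<Rightarrow> 'a) \<Rightarrow> (bit \<Rightarrow> 'a set) \<Rightarrow> ('a \<Rightarrow> 'a) \<Rightarrow> (ft \<Rightarrow> 'a) \<Rightarrow> bool"
where
  "trace_hom mul const hom tr \<phi> \<longleftrightarrow>
     (\<forall>a b. \<phi> (a + b) = \<phi> a + \<phi> b) \<and> (\<forall>a b. \<phi> (a * b) = mul (\<phi> a) (\<phi> b)) \<and>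
     (\<forall>u. \<phi> (ftconst u) = const u) \<and> (\<forall>a. \<phi> (ftr a) = tr (\<phi> a)) \<and>
     (\<forall>p. \<phi> ` ftgrade p \<subseteq> hom p)"

primrec ft_interp ::
  "('a::ab_group_add \<Rightarrow> 'a \<Rightarrow> 'a) \<Rightarrow> (complex \<Rightarrow> 'a) \<Rightarrow> ('a \<Rightarrow> 'a) \<Rightarrow> (nat \<Rightarrow> 'a) \<Rightarrow> (nat \<Rightarrow> 'a) \<Rightarrow> ftterm \<Rightarrow> 'a"
where
  "ft_interp mul const tr x y (FX i) = x i"
| "ft_interp mul const tr x y (FY i) = y i"
| "ft_interp mul const tr x y (FConst u) = const u"
| "ft_interp mul const tr x y (FAdd a b) = ft_interp mul const tr x y a + ft_interp mul const tr x y b"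
| "ft_interp mul const tr x y (FMul a b) =
     mul (ft_interp mul const tr x y a) (ft_interp mul const tr x y b)"
| "ft_interp mul const tr x y (FTr a) = tr (ft_interp mul const tr x y a)"

definition ft_eval ::
  "('a::ab_group_add \<Rightarrow> 'a \<Rightarrow> 'a) \<Rightarrow> (complex \<Rightarrow> 'a) \<Rightarrow> ('a \<Rightarrow> 'a) \<Rightarrow> (nat \<Rightarrow> 'a) \<Rightarrow> (nat \<Rightarrow> 'a) \<Rightarrow> ft \<Rightarrow> 'a"
where
  "ft_eval mul const tr x y a = ft_interp mul const tr x y (rep_ft a)"

context superalgebra_with_trace
begin

context
  fixes x y :: "nat \<Rightarrow> 'a"
  assumes x: "\<And>i. x i \<in> hom 1" and y: "\<And>i. y i \<in> hom 0"
begin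

lemma ft_interp_hom: "ftdeg p a \<Longrightarrow> ft_interp mul const tr x y a \<in> hom p"
  by (induction rule: ftdeg.induct) (simp_all add: x y hom_add hom_mult hom_const tr_hom del: add_bit_eq_xor)

lemma ft_interp_cong: "a \<approx>\<^sub>t b \<Longrightarrow> ft_interp mul const tr x y a = ft_interp mul const tr x y b"
proof (induction rule: ftcong.induct)
  case (ft_tr_central p a q b)
  then show ?case unfolding ft_interp.simps by (intro tr_central ft_interp_hom)
next
  case (ft_tr_cyclic p a q b)
  then show ?case unfolding ft_interp.simps by (intro tr_cyclic ft_interp_hom)
next
  case (ft_tr_tr p a q b)
  then show ?case unfolding ft_interp.simps by (intro tr_tr ft_interp_hom)
next
  case (ft_const_central u a)
  show ?case unfolding ft_interp.simps by (rule const_central)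
qed (simp_all add: mult_assoc distrib_left distrib_right one_left const_add const_mult const_0 mult_0
       tr_add tr_scale add_ac)

lemma ft_eval_abs: "ft_eval mul const tr x y (abs_ft a) = ft_interp mul const tr x y a"
  unfolding ft_eval_def by (rule ft_interp_cong) (simp add: abs_rep_ft flip: ft.abs_eq_iff)

lemma ft_eval_simps:
  "ft_eval mul const tr x y (ftx i) = x i"
  "ft_eval mul const tr x y (fty i) = y i"
  "trace_hom mul const hom tr (ft_eval mul const tr x y)"
proof -
  show "ft_eval mul const tr x y (ftx i) = x i" "ft_eval mul const tr x y (fty i) = y i"
    by (simp_all flip: abs_ft_simps add: ft_eval_abs)
  show "trace_hom mul const hom tr (ft_eval mul const tr x y)"
    unfolding trace_hom_def
  proof (intro conjI allI subsetI)
    fix a b u p c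
    obtain s t where "a = abs_ft s" "b = abs_ft t" using abs_rep_ft by metis
    then show "ft_eval mul const tr x y (a + b) = ft_eval mul const tr x y a + ft_eval mul const tr x y b"
      "ft_eval mul const tr x y (a * b) = ft_eval mul const tr x y a \<star> ft_eval mul const tr x y b"
      "ft_eval mul const tr x y (ftr a) = tr (ft_eval mul const tr x y a)"
      "ft_eval mul const tr x y (ftconst u) = const u"
      by (simp_all flip: abs_ft_simps add: ft_eval_abs)
    show "c \<in> ft_eval mul const tr x y ` ftgrade p \<Longrightarrow> c \<in> hom p"
      by (auto simp: ftgrade_def ft_eval_abs ft_interp_hom)
  qed
qed

theorem free_trace_universal:
  "\<exists>!\<phi>. trace_hom mul const hom tr \<phi> \<and> (\<forall>i. \<phi> (ftx i) = x i) \<and> (\<forall>i. \<phi> (fty i) = y i)"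
proof (rule ex1I)
  show "trace_hom mul const hom tr (ft_eval mul const tr x y) \<and>
    (\<forall>i. ft_eval mul const tr x y (ftx i) = x i) \<and> (\<forall>i. ft_eval mul const tr x y (fty i) = y i)"
    using ft_eval_simps by blast
  fix \<phi> assume \<phi>: "trace_hom mul const hom tr \<phi> \<and> (\<forall>i. \<phi> (ftx i) = x i) \<and> (\<forall>i. \<phi> (fty i) = y i)"
  have "\<phi> (abs_ft a) = ft_interp mul const tr x y a" for a
    using \<phi> unfolding trace_hom_def by (induction a) (simp_all add: abs_ft_simps)
  then show "\<phi> = ft_eval mul const tr x y"
    by (metis ext abs_rep_ft ft_eval_abs)
qed

end

end


section \<open>T-ideals\<close>

definition substitution :: "(ft \<Rightarrow> ft) \<Rightarrow> bool" where
  "substitution \<phi> \<longleftrightarrow> trace_hom (*) ftconst ftgrade ftr \<phi>"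

text \<open>
  The trace algebra \<open>\<T>\<close> is the unital subalgebra generated by the traces: it has to contain the
  scalars, since \<open>t(1) - n\<close> is an element of it.
\<close>

inductive_set trace_algebra :: "ft set" where
  trace_algebra_const: "ftconst u \<in> trace_algebra"
| trace_algebra_tr: "ftr a \<in> trace_algebra"
| trace_algebra_add: "a \<in> trace_algebra \<Longrightarrow> b \<in> trace_algebra \<Longrightarrow> a + b \<in> trace_algebra"
| trace_algebra_mult: "a \<in> trace_algebra \<Longrightarrow> b \<in> trace_algebra \<Longrightarrow> a * b \<in> trace_algebra"

definition graded_ideal :: "ft set \<Rightarrow> ft set \<Rightarrow> bool" where
  "graded_ideal A I \<longleftrightarrow> I \<subseteq> A \<and> 0 \<in> I \<and> (\<forall>a\<in>I. \<forall>b\<in>I. a + b \<in> I) \<and>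
     (\<forall>r\<in>A. \<forall>a\<in>I. r * a \<in> I \<and> a * r \<in> I) \<and>
     (\<forall>a\<in>ftgrade 0. \<forall>b\<in>ftgrade 1. a + b \<in> I \<longrightarrow> a \<in> I \<and> b \<in> I)"

definition T_ideal :: "ft set \<Rightarrow> bool" where
  "T_ideal I \<longleftrightarrow> graded_ideal UNIV I \<and> ftr ` I \<subseteq> I \<and> (\<forall>\<phi>. substitution \<phi> \<longrightarrow> \<phi> ` I \<subseteq> I)"

definition T_ideal_trace_algebra :: "ft set \<Rightarrow> bool" where
  "T_ideal_trace_algebra I \<longleftrightarrow>
     graded_ideal trace_algebra I \<and> (\<forall>\<phi>. substitution \<phi> \<longrightarrow> \<phi> ` I \<subseteq> I)"


section \<open>The free supercommutative superalgebra\<close>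

text \<open>On degree 0 variables indexed by \<open>'e\<close> and degree 1 variables indexed by \<open>'o\<close>.\<close>

datatype ('e, 'o) scterm = SEven 'e | SOdd 'o | SConst complex
  | SAdd "('e, 'o) scterm" "('e, 'o) scterm" | SMul "('e, 'o) scterm" "('e, 'o) scterm"

inductive scdeg :: "bit \<Rightarrow> ('e, 'o) scterm \<Rightarrow> bool" where
  "scdeg 0 (SEven i)"
| "scdeg 1 (SOdd j)"
| "scdeg 0 (SConst u)"
| "scdeg p a \<Longrightarrow> scdeg p b \<Longrightarrow> scdeg p (SAdd a b)"
| "scdeg p a \<Longrightarrow> scdeg q b \<Longrightarrow> scdeg (p + q) (SMul a b)"

inductive sccong :: "('e, 'o) scterm \<Rightarrow> ('e, 'o) scterm \<Rightarrow> bool"  (infix \<open>\<approx>\<^sub>s\<close> 50) where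
  sc_refl: "a \<approx>\<^sub>s a"
| sc_sym: "a \<approx>\<^sub>s b \<Longrightarrow> b \<approx>\<^sub>s a"
| sc_trans: "a \<approx>\<^sub>s b \<Longrightarrow> b \<approx>\<^sub>s c \<Longrightarrow> a \<approx>\<^sub>s c"
| sc_Add: "a \<approx>\<^sub>s a' \<Longrightarrow> b \<approx>\<^sub>s b' \<Longrightarrow> SAdd a b \<approx>\<^sub>s SAdd a' b'"
| sc_Mul: "a \<approx>\<^sub>s a' \<Longrightarrow> b \<approx>\<^sub>s b' \<Longrightarrow> SMul a b \<approx>\<^sub>s SMul a' b'"
| sc_add_assoc: "SAdd (SAdd a b) c \<approx>\<^sub>s SAdd a (SAdd b c)"
| sc_add_comm: "SAdd a b \<approx>\<^sub>s SAdd b a"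
| sc_add_0: "SAdd (SConst 0) a \<approx>\<^sub>s a"
| sc_mult_assoc: "SMul (SMul a b) c \<approx>\<^sub>s SMul a (SMul b c)"
| sc_distrib_right: "SMul (SAdd a b) c \<approx>\<^sub>s SAdd (SMul a c) (SMul b c)"
| sc_distrib_left: "SMul a (SAdd b c) \<approx>\<^sub>s SAdd (SMul a b) (SMul a c)"
| sc_one: "SMul (SConst 1) a \<approx>\<^sub>s a"
| sc_zero: "SMul (SConst 0) a \<approx>\<^sub>s SConst 0"
| sc_const_add: "SConst (u + v) \<approx>\<^sub>s SAdd (SConst u) (SConst v)"
| sc_const_mult: "SConst (u * v) \<approx>\<^sub>s SMul (SConst u) (SConst v)"
| sc_const_central: "SMul (SConst u) a \<approx>\<^sub>s SMul a (SConst u)"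
| sc_supercomm: "scdeg p a \<Longrightarrow> scdeg q b \<Longrightarrow> SMul a b \<approx>\<^sub>s SMul (SConst (koszul p q)) (SMul b a)"

quotient_type ('e, 'o) sc = "('e, 'o) scterm" / sccong
  by (rule equivpI) (auto intro!: reflpI sympI transpI intro: sc_refl sc_sym sc_trans)

primrec sc_aug :: "('e, 'o) scterm \<Rightarrow> complex" where
  "sc_aug (SEven i) = 0"
| "sc_aug (SOdd i) = 0"
| "sc_aug (SConst u) = u"
| "sc_aug (SAdd a b) = sc_aug a + sc_aug b"
| "sc_aug (SMul a b) = sc_aug a * sc_aug b"

lemma scdeg_aug: "scdeg p a \<Longrightarrow> p = 1 \<Longrightarrow> sc_aug a = 0"
proof (induction rule: scdeg.induct)
  case (5 p a q b)
  then show ?case by (cases p; cases q) auto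
qed auto

lemma sccong_aug: "a \<approx>\<^sub>s b \<Longrightarrow> sc_aug a = sc_aug b"
proof (induction rule: sccong.induct)
  case (sc_supercomm p a q b)
  then show ?case
    by (cases p; cases q) (auto simp: koszul_def dest: scdeg_aug)
qed (auto simp: algebra_simps)

instantiation sc :: (type, type) ring_1
begin

lift_definition zero_sc :: "('a, 'b) sc" is "SConst 0" .
lift_definition one_sc :: "('a, 'b) sc" is "SConst 1" .
lift_definition plus_sc :: "('a, 'b) sc \<Rightarrow> ('a, 'b) sc \<Rightarrow> ('a, 'b) sc" is SAdd by (rule sc_Add)
lift_definition times_sc :: "('a, 'b) sc \<Rightarrow> ('a, 'b) sc \<Rightarrow> ('a, 'b) sc" is SMul by (rule sc_Mul)
lift_definition uminus_sc :: "('a, 'b) sc \<Rightarrow> ('a, 'b) sc" is "SMul (SConst (-1))"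
  by (rule sc_Mul[OF sc_refl])
definition minus_sc :: "('a, 'b) sc \<Rightarrow> ('a, 'b) sc \<Rightarrow> ('a, 'b) sc" where
  "minus_sc a b = a + - b"

instance
proof
  fix a b c :: "('a, 'b) sc"
  show "a + b + c = a + (b + c)" by transfer (rule sc_add_assoc)
  show "a + b = b + a" by transfer (rule sc_add_comm)
  show "0 + a = a" by transfer (rule sc_add_0)
  show "a * b * c = a * (b * c)" by transfer (rule sc_mult_assoc)
  show "(a + b) * c = a * c + b * c" by transfer (rule sc_distrib_right)
  show "a * (b + c) = a * b + a * c" by transfer (rule sc_distrib_left)
  show "1 * a = a" by transfer (rule sc_one)
  show "a * 1 = a" by transfer (rule sc_trans[OF sc_sym[OF sc_const_central] sc_one])
  show "a - b = a + - b" by (rule minus_sc_def)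
  show "(0::('a, 'b) sc) \<noteq> 1" by transfer (use sccong_aug in force)
  show "- a + a = 0"
  proof transfer
    fix a :: "('a, 'b) scterm"
    note [trans] = sc_trans
    have "SAdd (SMul (SConst (-1)) a) a \<approx>\<^sub>s SAdd (SMul (SConst (-1)) a) (SMul (SConst 1) a)"
      by (intro sc_Add sc_refl sc_sym[OF sc_one])
    also have "\<dots> \<approx>\<^sub>s SMul (SAdd (SConst (-1)) (SConst 1)) a"
      by (rule sc_sym[OF sc_distrib_right])
    also have "\<dots> \<approx>\<^sub>s SMul (SConst (-1 + 1)) a"
      by (intro sc_Mul sc_refl sc_sym[OF sc_const_add])
    also have "SMul (SConst (-1 + 1)) a \<approx>\<^sub>s SConst 0"
      by (simp add: sc_zero)
    finally show "SAdd (SMul (SConst (-1)) a) a \<approx>\<^sub>s SConst 0" .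
  qed
qed

end

lift_definition sceven :: "'e \<Rightarrow> ('e, 'o) sc" is SEven .
lift_definition scodd :: "'o \<Rightarrow> ('e, 'o) sc" is SOdd .
lift_definition scconst :: "complex \<Rightarrow> ('e, 'o) sc" is SConst .

definition scgrade :: "bit \<Rightarrow> ('e, 'o) sc set" where
  "scgrade p = abs_sc ` {a. scdeg p a}"

lemma abs_rep_sc: "abs_sc (rep_sc a) = a"
  by (rule Quotient3_abs_rep[OF Quotient3_sc])

lemma abs_sc_simps:
  "abs_sc (SEven i) = sceven i" "abs_sc (SOdd j) = scodd j" "abs_sc (SConst u) = scconst u"
  "abs_sc (SAdd a b) = abs_sc a + abs_sc b" "abs_sc (SMul a b) = abs_sc a * abs_sc b"
  by (simp_all add: sceven.abs_eq scodd.abs_eq scconst.abs_eq plus_sc.abs_eq times_sc.abs_eq)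

lemma scconst_simps [simp]: "scconst 0 = 0" "scconst 1 = 1"
  by (transfer, rule sc_refl)+

lemma scconst_add: "scconst (u + v) = scconst u + scconst v"
  by transfer (rule sc_const_add)

lemma scconst_mult: "scconst (u * v) = scconst u * scconst v"
  by transfer (rule sc_const_mult)

lemma scconst_central: "scconst u * a = a * scconst u"
  by transfer (rule sc_const_central)

lemma scconst_minus: "scconst (- u) = - scconst u"
  using scconst_add[of "- u" u] by (simp add: eq_neg_iff_add_eq_0)

lemma scconst_sum: "scconst (\<Sum>i\<in>A. f i) = (\<Sum>i\<in>A. scconst (f i))"
  by (induction A rule: infinite_finite_induct) (auto simp: scconst_add)

primrec sc_par :: "('e, 'o) scterm \<Rightarrow> ('e, 'o) scterm" where
  "sc_par (SEven i) = SEven i"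
| "sc_par (SOdd i) = SMul (SConst (-1)) (SOdd i)"
| "sc_par (SConst u) = SConst u"
| "sc_par (SAdd a b) = SAdd (sc_par a) (sc_par b)"
| "sc_par (SMul a b) = SMul (sc_par a) (sc_par b)"

lemma scdeg_scale: "scdeg p a \<Longrightarrow> scdeg p (SMul (SConst u) a)"
  using scdeg.intros(5)[OF scdeg.intros(3), of p a u] by (simp del: add_bit_eq_xor)

lemma scdeg_par: "scdeg p a \<Longrightarrow> scdeg p (sc_par a)"
  by (induction rule: scdeg.induct) (simp_all add: scdeg.intros scdeg_scale del: add_bit_eq_xor)

lemma sccong_par: "a \<approx>\<^sub>s b \<Longrightarrow> sc_par a \<approx>\<^sub>s sc_par b"
proof (induction rule: sccong.induct)
  case (sc_trans a b c)
  then show ?case by (blast intro: sccong.sc_trans)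
next
  case (sc_sym a b)
  then show ?case by (blast intro: sccong.sc_sym)
qed (auto intro: sccong.intros scdeg_par)

lift_definition scpar :: "('e, 'o) sc \<Rightarrow> ('e, 'o) sc" is sc_par by (rule sccong_par)

lemma scpar_gen:
  "scpar (sceven i) = sceven i" "scpar (scodd j) = - scodd j" "scpar (scconst u) = scconst u"
  by (transfer, simp add: sc_refl)+

lemma scpar_add: "scpar (a + b) = scpar a + scpar b"
  by transfer (simp add: sc_refl)

lemma scpar_mul: "scpar (a * b) = scpar a * scpar b"
  by transfer (simp add: sc_refl)

lemma scpar_deg: "scdeg p a \<Longrightarrow> scpar (abs_sc a) = (if p = 1 then - abs_sc a else abs_sc a)"
proof (induction rule: scdeg.induct)
  case (4 p a b)
  then show ?case by (auto simp: scpar_add abs_sc_simps)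
next
  case (5 p a q b)
  show ?case unfolding abs_sc_simps scpar_mul "5.IH" by (cases p; cases q) simp_all
qed (auto simp: scpar_gen abs_sc_simps)

lemma scgrade_add: "a \<in> scgrade p \<Longrightarrow> b \<in> scgrade p \<Longrightarrow> a + b \<in> scgrade p"
  unfolding scgrade_def by (auto simp flip: abs_sc_simps intro!: imageI scdeg.intros)

lemma scgrade_mult: "a \<in> scgrade p \<Longrightarrow> b \<in> scgrade q \<Longrightarrow> a * b \<in> scgrade (p + q)"
  unfolding scgrade_def by (elim imageE, simp only: mem_Collect_eq flip: abs_sc_simps) (intro imageI CollectI scdeg.intros)

lemma scgrade_const: "scconst u \<in> scgrade 0"
  unfolding scgrade_def by (auto simp flip: abs_sc_simps intro!: imageI scdeg.intros)

lemma scgrade_even: "sceven i \<in> scgrade 0"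
  unfolding scgrade_def by (auto simp flip: abs_sc_simps intro!: imageI scdeg.intros)

lemma scgrade_odd: "scodd i \<in> scgrade 1"
  unfolding scgrade_def by (auto simp flip: abs_sc_simps intro!: imageI scdeg.intros)

lemma scgrade_scale: "a \<in> scgrade p \<Longrightarrow> scconst u * a \<in> scgrade p"
  using scgrade_mult[OF scgrade_const, of a p u] by (simp del: add_bit_eq_xor)

lemma scgrade_zero: "0 \<in> scgrade p"
proof (cases p)
  assume "p = 0"
  then show ?thesis using scgrade_const[of 0] by simp
next
  assume "p = 1"
  then show ?thesis using scgrade_scale[OF scgrade_odd, of 0] by simp
qed

lemma scgrade_sum: "(\<And>i. i \<in> A \<Longrightarrow> f i \<in> scgrade p) \<Longrightarrow> (\<Sum>i\<in>A. f i) \<in> scgrade p"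
  by (induction A rule: infinite_finite_induct) (auto simp: scgrade_zero scgrade_add)

lemma sc_sum_grade: "\<exists>b\<in>scgrade 0. \<exists>c\<in>scgrade 1. abs_sc a = b + c"
proof (induction a)
  case (SOdd i)
  show ?case using scgrade_zero[of 0] scgrade_odd[of i] by (force simp: abs_sc_simps)
next
  case (SEven i)
  show ?case using scgrade_zero[of 1] scgrade_even[of i] by (force simp: abs_sc_simps)
next
  case (SConst u)
  show ?case using scgrade_zero[of 1] scgrade_const[of u] by (force simp: abs_sc_simps)
next
  case (SAdd a b)
  then obtain a0 a1 b0 b1 where *: "a0 \<in> scgrade 0" "a1 \<in> scgrade 1" "abs_sc a = a0 + a1"
    "b0 \<in> scgrade 0" "b1 \<in> scgrade 1" "abs_sc b = b0 + b1" by auto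
  have "abs_sc (SAdd a b) = (a0 + b0) + (a1 + b1)"
    using * by (simp add: abs_sc_simps algebra_simps)
  then show ?case using * scgrade_add by blast
next
  case (SMul a b)
  then obtain a0 a1 b0 b1 where *: "a0 \<in> scgrade 0" "a1 \<in> scgrade 1" "abs_sc a = a0 + a1"
    "b0 \<in> scgrade 0" "b1 \<in> scgrade 1" "abs_sc b = b0 + b1" by auto
  have "abs_sc (SMul a b) = (a0 * b0 + a1 * b1) + (a0 * b1 + a1 * b0)"
    using * by (simp add: abs_sc_simps algebra_simps)
  moreover have "a0 * b0 + a1 * b1 \<in> scgrade 0" "a0 * b1 + a1 * b0 \<in> scgrade 1"
    using scgrade_mult[OF *(1) *(4)] scgrade_mult[OF *(2) *(5)]
      scgrade_mult[OF *(1) *(5)] scgrade_mult[OF *(2) *(4)]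
    by (auto intro: scgrade_add)
  ultimately show ?case by blast
qed

lemma sc_double_zero: "a = - a \<Longrightarrow> a = 0" for a :: "('e, 'o) sc"
proof -
  assume "a = - a"
  then have "a + a = 0" by (simp add: eq_neg_iff_add_eq_0)
  then have "scconst (1/2 + 1/2) * a = 0"
    unfolding scconst_add by (metis distrib_left distrib_right mult_zero_right)
  then show ?thesis by simp
qed

interpretation sc: supercommutative_superalgebra "(*)" scconst scgrade
proof
  fix a b :: "('e, 'o) sc" and u v p q
  show "\<exists>b\<in>scgrade 0. \<exists>c\<in>scgrade 1. a = b + c"
    using sc_sum_grade[of "rep_sc a"] by (simp add: abs_rep_sc)
  show "a \<in> scgrade 0 \<Longrightarrow> a \<in> scgrade 1 \<Longrightarrow> a = 0"
    by (rule sc_double_zero) (auto simp: scgrade_def dest!: scpar_deg)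
  assume "a \<in> scgrade p" "b \<in> scgrade q"
  then obtain s t where "scdeg p s" "scdeg q t" "a = abs_sc s" "b = abs_sc t"
    by (auto simp: scgrade_def)
  then show "a * b = scconst (koszul p q) * (b * a)"
    by (simp flip: abs_sc_simps add: sc.abs_eq_iff sc_supercomm)
qed (rule scconst_central | simp add: mult.assoc ring_distribs scconst_add scconst_mult scgrade_const
      scgrade_add scgrade_mult scgrade_zero del: add_bit_eq_xor)+

definition super_hom ::
  "('a::ab_group_add \<Rightarrow> 'a \<Rightarrow> 'a) \<Rightarrow> (complex \<Rightarrow> 'a) \<Rightarrow> (bit \<Rightarrow> 'a set) \<Rightarrow> (('e, 'o) sc \<Rightarrow> 'a) \<Rightarrow> bool"
where
  "super_hom mul const hom \<phi> \<longleftrightarrow>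
     (\<forall>a b. \<phi> (a + b) = \<phi> a + \<phi> b) \<and> (\<forall>a b. \<phi> (a * b) = mul (\<phi> a) (\<phi> b)) \<and>
     (\<forall>u. \<phi> (scconst u) = const u) \<and> (\<forall>p. \<phi> ` scgrade p \<subseteq> hom p)"

primrec sc_interp ::
  "('a::ab_group_add \<Rightarrow> 'a \<Rightarrow> 'a) \<Rightarrow> (complex \<Rightarrow> 'a) \<Rightarrow> ('e \<Rightarrow> 'a) \<Rightarrow> ('o \<Rightarrow> 'a) \<Rightarrow> ('e, 'o) scterm \<Rightarrow> 'a"
where
  "sc_interp mul const x y (SEven i) = x i"
| "sc_interp mul const x y (SOdd i) = y i"
| "sc_interp mul const x y (SConst u) = const u"
| "sc_interp mul const x y (SAdd a b) = sc_interp mul const x y a + sc_interp mul const x y b"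
| "sc_interp mul const x y (SMul a b) = mul (sc_interp mul const x y a) (sc_interp mul const x y b)"

definition sc_eval ::
  "('a::ab_group_add \<Rightarrow> 'a \<Rightarrow> 'a) \<Rightarrow> (complex \<Rightarrow> 'a) \<Rightarrow> ('e \<Rightarrow> 'a) \<Rightarrow> ('o \<Rightarrow> 'a) \<Rightarrow> ('e, 'o) sc \<Rightarrow> 'a"
where
  "sc_eval mul const x y a = sc_interp mul const x y (rep_sc a)"

context supercommutative_superalgebra
begin

context
  fixes x :: "'e \<Rightarrow> 'a" and y :: "'o \<Rightarrow> 'a"
  assumes x: "\<And>i. x i \<in> hom 0" and y: "\<And>i. y i \<in> hom 1"
begin

lemma sc_interp_hom: "scdeg p a \<Longrightarrow> sc_interp mul const x y a \<in> hom p"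
  by (induction rule: scdeg.induct) (simp_all add: x y hom_add hom_mult hom_const del: add_bit_eq_xor)

lemma sc_interp_cong: "a \<approx>\<^sub>s b \<Longrightarrow> sc_interp mul const x y a = sc_interp mul const x y b"
proof (induction rule: sccong.induct)
  case (sc_supercomm p a q b)
  then show ?case unfolding sc_interp.simps by (intro supercomm sc_interp_hom)
next
  case (sc_const_central u a)
  show ?case unfolding sc_interp.simps by (rule const_central)
qed (simp_all add: mult_assoc distrib_left distrib_right one_left const_add const_mult const_0 mult_0
       add_ac)

lemma sc_eval_abs: "sc_eval mul const x y (abs_sc a) = sc_interp mul const x y a"
  unfolding sc_eval_def by (rule sc_interp_cong) (simp add: abs_rep_sc flip: sc.abs_eq_iff)

lemma sc_eval_simps:
  "sc_eval mul const x y (sceven i) = x i"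
  "sc_eval mul const x y (scodd j) = y j"
  "super_hom mul const hom (sc_eval mul const x y)"
proof -
  show "sc_eval mul const x y (sceven i) = x i" "sc_eval mul const x y (scodd j) = y j"
    by (simp_all flip: abs_sc_simps add: sc_eval_abs)
  show "super_hom mul const hom (sc_eval mul const x y)"
    unfolding super_hom_def
  proof (intro conjI allI subsetI)
    fix a b :: "('e, 'o) sc" and u p c
    obtain s t where "a = abs_sc s" "b = abs_sc t" using abs_rep_sc by metis
    then show "sc_eval mul const x y (a + b) = sc_eval mul const x y a + sc_eval mul const x y b"
      "sc_eval mul const x y (a * b) = sc_eval mul const x y a \<star> sc_eval mul const x y b"
      "sc_eval mul const x y (scconst u) = const u"
      by (simp_all flip: abs_sc_simps add: sc_eval_abs)
    show "c \<in> sc_eval mul const x y ` scgrade p \<Longrightarrow> c \<in> hom p"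
      by (auto simp: scgrade_def sc_eval_abs sc_interp_hom)
  qed
qed

theorem free_supercommutative_universal:
  "\<exists>!\<phi>. super_hom mul const hom \<phi> \<and> (\<forall>i. \<phi> (sceven i) = x i) \<and> (\<forall>j. \<phi> (scodd j) = y j)"
proof (rule ex1I)
  show "super_hom mul const hom (sc_eval mul const x y) \<and>
    (\<forall>i. sc_eval mul const x y (sceven i) = x i) \<and> (\<forall>j. sc_eval mul const x y (scodd j) = y j)"
    using sc_eval_simps by blast
  fix \<phi> assume \<phi>: "super_hom mul const hom \<phi> \<and> (\<forall>i. \<phi> (sceven i) = x i) \<and> (\<forall>j. \<phi> (scodd j) = y j)"
  have "\<phi> (abs_sc a) = sc_interp mul const x y a" for a
    using \<phi> unfolding super_hom_def by (induction a) (simp_all add: abs_sc_simps)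
  then show "\<phi> = sc_eval mul const x y"
    by (metis ext abs_rep_sc sc_eval_abs)
qed

end

end


section \<open>Generic matrices and evaluation\<close>

text \<open>
  The matrix size is the cardinality of the finite index type \<open>'n\<close>.  The variable with upper
  index \<open>i + 1\<close> and lower indices \<open>h, k\<close> is the generator with index \<open>(i, h, k)\<close>.
\<close>

type_synonym 'n gen = "(nat \<times> 'n \<times> 'n, nat \<times> 'n \<times> 'n) sc"

definition eta :: "nat \<Rightarrow> 'n gen ^ 'n ^ 'n::finite" where
  "eta i = (\<chi> h k. sceven (i, h, k))"

definition xi :: "nat \<Rightarrow> 'n gen ^ 'n ^ 'n::finite" where
  "xi i = (\<chi> h k. scodd (i, h, k))"

definition mconst :: "complex \<Rightarrow> 'n gen ^ 'n ^ 'n::finite" where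
  "mconst u = mat (scconst u)"

definition mgrade :: "bit \<Rightarrow> ('n gen ^ 'n ^ 'n::finite) set" where
  "mgrade p = {A. \<forall>h k. A $ h $ k \<in> scgrade p}"

definition mtr :: "'n gen ^ 'n ^ 'n \<Rightarrow> 'n gen ^ 'n ^ 'n::finite" where
  "mtr A = mat (trace A)"

lemma mat_mult_left: "(mat c ** A) $ h $ k = c * A $ h $ k" for A :: "'a::ring_1 ^ 'n ^ 'n::finite"
  by (simp add: matrix_matrix_mult_def mat_def if_distrib[of "\<lambda>x. x * _"] sum.delta cong: if_cong)

lemma mat_mult_right: "(A ** mat c) $ h $ k = A $ h $ k * c" for A :: "'a::ring_1 ^ 'n ^ 'n::finite"
  by (simp add: matrix_matrix_mult_def mat_def if_distrib[of "\<lambda>x. _ * x"] sum.delta' cong: if_cong)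

lemma mat_mult_mat: "mat c ** mat d = (mat (c * d) :: 'a::ring_1 ^ 'n ^ 'n::finite)"
  by (simp add: vec_eq_iff mat_mult_left) (simp add: mat_def)

lemma trace_mat_mult: "trace (mat c ** A) = c * trace A" for A :: "'a::ring_1 ^ 'n ^ 'n::finite"
  by (simp add: trace_def mat_mult_left sum_distrib_left)

lemma matrix_add_rdistrib: "(A + B) ** C = A ** C + B ** C" for A :: "'a::ring_1 ^ 'n ^ 'n::finite"
  by (simp add: vec_eq_iff matrix_matrix_mult_def distrib_right sum.distrib)

lemma mat_scconst_add: "mat (scconst (u + v)) = (mat (scconst u) + mat (scconst v) :: 'n gen ^ 'n ^ 'n::finite)"
  by (simp add: vec_eq_iff mat_def scconst_add)

lemma mat_scconst_mult: "mat (scconst (u * v)) = (mat (scconst u) ** mat (scconst v) :: 'n gen ^ 'n ^ 'n::finite)"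
  by (simp add: mat_mult_mat scconst_mult)

lemma mtr_add: "mtr (A + B) = mtr A + mtr B"
  by (simp add: mtr_def vec_eq_iff mat_def trace_def sum.distrib)

interpretation matr: superalgebra_with_trace "(**)" mconst mgrade mtr
proof
  fix A B :: "'n gen ^ 'n ^ 'n::finite" and u v p q
  show "\<exists>B\<in>mgrade 0. \<exists>C\<in>mgrade 1. A = B + C"
  proof -
    have "\<forall>h k. \<exists>b c. b \<in> scgrade 0 \<and> c \<in> scgrade 1 \<and> A $ h $ k = b + c"
      using sc.hom_sum by blast
    then obtain b c where "\<forall>h k. b h k \<in> scgrade 0 \<and> c h k \<in> scgrade 1 \<and> A $ h $ k = b h k + c h k"
      by metis
    then show ?thesis
      by (intro bexI[of _ "\<chi> h k. b h k"] bexI[of _ "\<chi> h k. c h k"]) (auto simp: mgrade_def vec_eq_iff)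
  qed
  show "A \<in> mgrade 0 \<Longrightarrow> A \<in> mgrade 1 \<Longrightarrow> A = 0"
    by (auto simp: mgrade_def vec_eq_iff intro: sc.hom_disjoint)
  show "mtr (mconst u ** A) = mconst u ** mtr A"
    by (simp add: mtr_def mconst_def mat_mult_mat trace_mat_mult)
  show "mtr A \<in> mgrade p" if "A \<in> mgrade p" for p
    using that by (auto simp: mtr_def mgrade_def mat_def trace_def scgrade_zero intro: scgrade_sum)
  show "mconst u ** A = A ** mconst u"
    by (auto simp: vec_eq_iff mconst_def mat_mult_left mat_mult_right scconst_central)
  show "mconst u \<in> mgrade 0"
    by (auto simp: mconst_def mgrade_def mat_def scgrade_zero scgrade_const)
  assume A: "A \<in> mgrade p" and B: "B \<in> mgrade q"
  show "A ** B \<in> mgrade (p + q)"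
    using A B by (auto simp: mgrade_def matrix_matrix_mult_def intro!: scgrade_sum scgrade_mult simp del: add_bit_eq_xor)
  have trA: "trace A \<in> scgrade p"
    using A by (auto simp: mgrade_def trace_def intro: scgrade_sum)
  show "mtr A ** B = mconst (koszul p q) ** (B ** mtr A)"
    using trA B by (auto simp: mtr_def mconst_def vec_eq_iff mat_mult_left mat_mult_right mgrade_def
        intro: sc.supercomm)
  have "trace (A ** B) = (\<Sum>i\<in>UNIV. \<Sum>k\<in>UNIV. scconst (koszul p q) * (B $ k $ i * A $ i $ k))"
    unfolding trace_def matrix_matrix_mult_def using A B
    by (auto simp: mgrade_def intro!: sum.cong sc.supercomm)
  also have "\<dots> = scconst (koszul p q) * trace (B ** A)"
    unfolding trace_def matrix_matrix_mult_def
    by (simp add: sum_distrib_left, rule sum.swap)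
  finally show "mtr (A ** B) = mconst (koszul p q) ** mtr (B ** A)"
    by (simp add: mtr_def mconst_def mat_mult_mat)
  show "mtr (mtr A ** B) = mtr A ** mtr B"
    by (simp add: mtr_def mat_mult_mat trace_mat_mult)
qed (auto simp: matrix_mul_assoc matrix_add_ldistrib matrix_add_rdistrib mconst_def mgrade_def
      scgrade_zero scgrade_add vec_eq_iff mat_mult_left mat_mult_right mat_scconst_add
      mat_scconst_mult mtr_add)

definition ev :: "ft \<Rightarrow> 'n gen ^ 'n ^ 'n::finite" where
  "ev = ft_eval (**) mconst mtr xi eta"

lemma xi_grade: "xi i \<in> mgrade 1" and eta_grade: "eta i \<in> mgrade 0"
  by (auto simp: mgrade_def xi_def eta_def scgrade_odd scgrade_even)

lemma ev_trace_hom: "trace_hom (**) mconst mgrade mtr ev"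
  and ev_x: "ev (ftx i) = xi i" and ev_y: "ev (fty i) = eta i"
  unfolding ev_def using matr.ft_eval_simps[of xi eta, OF xi_grade eta_grade] by auto


section \<open>The action of the linear group and its invariants\<close>

definition cmat :: "complex ^ 'n ^ 'n \<Rightarrow> 'n gen ^ 'n ^ 'n::finite" where
  "cmat g = (\<chi> h k. scconst (g $ h $ k))"

definition GL_act :: "complex ^ 'n ^ 'n \<Rightarrow> 'n gen \<Rightarrow> 'n::finite gen" where
  "GL_act g = sc_eval (*) scconst
     (\<lambda>(i, h, k). (cmat (matrix_inv g) ** eta i ** cmat g) $ h $ k)
     (\<lambda>(i, h, k). (cmat (matrix_inv g) ** xi i ** cmat g) $ h $ k)"

definition GL_invariants :: "'n::finite gen set" where
  "GL_invariants = {s. \<forall>g. invertible g \<longrightarrow> GL_act g s = s}"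

text \<open>
  On the trace algebra \<open>ev\<close> takes values in the scalar matrices with invariant entry;
  identifying these with their entry gives the evaluation map \<open>\<T> \<rightarrow> \<T>\<^sub>n\<close>.
\<close>

definition ev_trace :: "ft \<Rightarrow> 'n::finite gen" where
  "ev_trace a = (THE s. s \<in> GL_invariants \<and> ev a = mat s)"

lemma cmat_conj_grade:
  assumes "A \<in> mgrade p"
  shows "(cmat g ** A ** cmat g') $ h $ k \<in> scgrade p"
proof -
  have c: "cmat g \<in> mgrade 0" for g :: "complex ^ 'n ^ 'n"
    by (simp add: cmat_def mgrade_def scgrade_const)
  have "cmat g ** A ** cmat g' \<in> mgrade (0 + p + 0)"
    by (intro matr.hom_mult c assms)
  then show ?thesis by (simp add: mgrade_def del: add_bit_eq_xor)
qed

lemma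
  shows GL_act_super_hom: "super_hom (*) scconst scgrade (GL_act g)"
    and GL_act_even: "GL_act g (sceven (i, h, k)) = (cmat (matrix_inv g) ** eta i ** cmat g) $ h $ k"
    and GL_act_odd: "GL_act g (scodd (i, h, k)) = (cmat (matrix_inv g) ** xi i ** cmat g) $ h $ k"
proof -
  note * = sc.sc_eval_simps[where x = "\<lambda>(i, h, k). (cmat (matrix_inv g) ** eta i ** cmat g) $ h $ k"
      and y = "\<lambda>(i, h, k). (cmat (matrix_inv g) ** xi i ** cmat g) $ h $ k"]
  show "super_hom (*) scconst scgrade (GL_act g)"
    unfolding GL_act_def
    by (rule *(3)) (auto intro!: cmat_conj_grade eta_grade xi_grade)
  show "GL_act g (sceven (i, h, k)) = (cmat (matrix_inv g) ** eta i ** cmat g) $ h $ k"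
    unfolding GL_act_def
    by (subst *(1)) (auto intro!: cmat_conj_grade eta_grade xi_grade)
  show "GL_act g (scodd (i, h, k)) = (cmat (matrix_inv g) ** xi i ** cmat g) $ h $ k"
    unfolding GL_act_def
    by (subst *(2)) (auto intro!: cmat_conj_grade eta_grade xi_grade)
qed

lemma GL_act_simps:
  "GL_act g (a + b) = GL_act g a + GL_act g b" "GL_act g (a * b) = GL_act g a * GL_act g b"
  "GL_act g (scconst u) = scconst u" "GL_act g 0 = 0"
proof -
  have *: "GL_act g (scconst u) = scconst u" for u
    using GL_act_super_hom[of g] by (auto simp: super_hom_def)
  show "GL_act g (a + b) = GL_act g a + GL_act g b" "GL_act g (a * b) = GL_act g a * GL_act g b"
    using GL_act_super_hom[of g] by (auto simp: super_hom_def)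
  show "GL_act g (scconst u) = scconst u" "GL_act g 0 = 0"
    using *[of u] *[of 0] by simp_all
qed

lemma GL_act_sum: "GL_act g (\<Sum>i\<in>A. f i) = (\<Sum>i\<in>A. GL_act g (f i))"
  by (induction A rule: infinite_finite_induct) (auto simp: GL_act_simps)

lemma cmat_inverse:
  assumes "invertible g"
  shows "cmat g ** cmat (matrix_inv g) = mat 1" "cmat (matrix_inv g) ** cmat g = mat 1"
proof -
  have m: "cmat g ** cmat h = cmat (g ** h)" for g h :: "complex ^ 'n ^ 'n"
    by (simp add: cmat_def matrix_matrix_mult_def vec_eq_iff scconst_sum scconst_mult)
  have "cmat (mat 1 :: complex ^ 'n ^ 'n) = mat 1"
    by (simp add: cmat_def mat_def vec_eq_iff)
  then show "cmat g ** cmat (matrix_inv g) = mat 1" "cmat (matrix_inv g) ** cmat g = mat 1"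
    using someI_ex[OF assms[unfolded invertible_def]] by (simp_all add: m matrix_inv_def)
qed

lemma trace_cmat_commute: "trace (A ** cmat g) = trace (cmat g ** A)"
  unfolding trace_def matrix_matrix_mult_def cmat_def
  by (simp, subst sum.swap) (simp add: scconst_central)

lemma mat_cmat_commute: "cmat g ** mat t = mat t ** cmat g"
  by (simp add: vec_eq_iff mat_mult_left mat_mult_right cmat_def scconst_central)

lemma ev_simps:
  "ev (a + b) = ev a + ev b" "ev (a * b) = ev a ** ev b" "ev (ftconst u) = mat (scconst u)"
  "ev (ftr a) = mat (trace (ev a))"
  using ev_trace_hom by (auto simp: trace_hom_def mconst_def mtr_def)

lemma GL_act_ev:
  fixes g :: "complex ^ 'n ^ 'n::finite"
  assumes g: "invertible g"
  shows "(\<chi> h k. GL_act g (ev a $ h $ k)) = cmat (matrix_inv g) ** ev a ** cmat g"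
proof -
  let ?c = "cmat g" and ?d = "cmat (matrix_inv g)"
  have mat: "?d ** mat t ** ?c = mat t" for t
    using cmat_inverse(2)[OF g]
    by (simp add: mat_cmat_commute flip: matrix_mul_assoc)
  have "(\<chi> h k. GL_act g (ev (abs_ft s) $ h $ k)) = ?d ** ev (abs_ft s) ** ?c" for s
  proof (induction s)
    case (FX i)
    then show ?case by (simp add: abs_ft_simps ev_x vec_eq_iff) (simp add: xi_def GL_act_odd)
  next
    case (FY i)
    then show ?case by (simp add: abs_ft_simps ev_y vec_eq_iff) (simp add: eta_def GL_act_even)
  next
    case (FConst u)
    then show ?case by (simp add: abs_ft_simps ev_simps mat) (simp add: mat_def vec_eq_iff GL_act_simps)
  next
    case (FAdd a b)
    have "(\<chi> h k. GL_act g (ev (abs_ft (FAdd a b)) $ h $ k))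
        = (\<chi> h k. GL_act g (ev (abs_ft a) $ h $ k)) + (\<chi> h k. GL_act g (ev (abs_ft b) $ h $ k))"
      by (simp add: abs_ft_simps ev_simps vec_eq_iff GL_act_simps)
    then show ?case
      by (simp add: FAdd abs_ft_simps ev_simps matrix_add_ldistrib matrix_add_rdistrib)
  next
    case (FMul a b)
    have "(\<chi> h k. GL_act g (ev (abs_ft (FMul a b)) $ h $ k))
        = (\<chi> h k. GL_act g (ev (abs_ft a) $ h $ k)) ** (\<chi> h k. GL_act g (ev (abs_ft b) $ h $ k))"
      by (simp add: abs_ft_simps ev_simps vec_eq_iff GL_act_simps GL_act_sum matrix_matrix_mult_def)
    also have "\<dots> = ?d ** ev (abs_ft a) ** (?c ** ?d) ** ev (abs_ft b) ** ?c"
      by (simp add: FMul matrix_mul_assoc)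
    finally show ?case
      by (simp add: abs_ft_simps ev_simps cmat_inverse[OF g] matrix_mul_assoc)
  next
    case (FTr a)
    have "GL_act g (trace (ev (abs_ft a))) = trace (\<chi> h k. GL_act g (ev (abs_ft a) $ h $ k))"
      by (simp add: trace_def GL_act_sum)
    also have "\<dots> = trace (?c ** (?d ** ev (abs_ft a)))"
      by (simp add: FTr trace_cmat_commute)
    also have "\<dots> = trace (ev (abs_ft a))"
      by (simp add: matrix_mul_assoc cmat_inverse[OF g])
    finally show ?case
      by (simp add: abs_ft_simps ev_simps mat) (simp add: mat_def vec_eq_iff GL_act_simps)
  qed
  from this[of "rep_ft a"] show ?thesis by (simp add: abs_rep_ft)
qed

lemma ev_trace_exists:
  assumes "a \<in> trace_algebra"
  shows "\<exists>s\<in>(GL_invariants :: 'n::finite gen set). ev a = mat s"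
  using assms
proof induction
  case (trace_algebra_const u)
  show ?case
    by (rule bexI[of _ "scconst u"]) (auto simp: ev_simps GL_invariants_def GL_act_simps)
next
  case (trace_algebra_tr a)
  show ?case
  proof (rule bexI[of _ "trace (ev a)"])
    show "trace (ev a) \<in> (GL_invariants :: 'n gen set)"
      unfolding GL_invariants_def
    proof safe
      fix g :: "complex ^ 'n ^ 'n" assume g: "invertible g"
      have "GL_act g (trace (ev a)) = trace (\<chi> h k. GL_act g (ev a $ h $ k))"
        by (simp add: trace_def GL_act_sum)
      also have "\<dots> = trace (ev a)"
        by (simp add: GL_act_ev[OF g] trace_cmat_commute matrix_mul_assoc cmat_inverse[OF g])
      finally show "GL_act g (trace (ev a)) = trace (ev a)" .
    qed
  qed (simp add: ev_simps)
next
  case (trace_algebra_add a b)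
  then obtain s t :: "'n gen" where st: "s \<in> GL_invariants" "t \<in> GL_invariants" "ev a = mat s" "ev b = mat t"
    by blast
  then show ?case
    by (intro bexI[of _ "s + t"]) (auto simp: ev_simps GL_invariants_def GL_act_simps mat_def vec_eq_iff)
next
  case (trace_algebra_mult a b)
  then obtain s t :: "'n gen" where st: "s \<in> GL_invariants" "t \<in> GL_invariants" "ev a = mat s" "ev b = mat t"
    by blast
  then have "ev (a * b) = mat (s * t)"
    by (simp add: ev_simps mat_mult_mat)
  then show ?case
    using st by (intro bexI[of _ "s * t"]) (auto simp: GL_invariants_def GL_act_simps)
qed

lemma ev_trace:
  assumes "a \<in> trace_algebra"
  shows "ev_trace a \<in> (GL_invariants :: 'n::finite gen set)"
    and "ev a = mat (ev_trace a :: 'n gen)"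
proof -
  have "s = t" if "mat s = (mat t :: 'n gen ^ 'n ^ 'n)" for s t
    using that by (simp add: mat_def vec_eq_iff) metis
  then have "\<exists>!s. s \<in> (GL_invariants :: 'n gen set) \<and> ev a = mat s"
    using ev_trace_exists[OF assms, where 'n = 'n] by metis
  from theI'[OF this] show "ev_trace a \<in> (GL_invariants :: 'n gen set)"
    and "ev a = mat (ev_trace a :: 'n gen)"
    by (simp_all add: ev_trace_def)
qed


section \<open>The fundamental trace relations and the Cayley--Hamilton identities\<close>

text \<open>
  Permutations act on \<open>{..<m}\<close> with \<open>m = e + f\<close> rather than on \<open>{1..m}\<close>, so the indices
  \<open>i < e\<close> are bosonic, the indices \<open>i \<ge> e\<close> are fermionic and the last index is \<open>m - 1\<close>.
\<close>

definition cycle_form :: "nat \<Rightarrow> (nat \<Rightarrow> nat) \<Rightarrow> nat list list \<Rightarrow> bool" where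
  "cycle_form m \<sigma> ws \<longleftrightarrow> distinct (concat ws) \<and> set (concat ws) = {..<m} \<and> [] \<notin> set ws \<and>
     (\<forall>w\<in>set ws. map \<sigma> w = rotate1 w)"

definition sorting_sign :: "nat list \<Rightarrow> int" where
  "sorting_sign l = sign (THE p. p permutes {..<length l} \<and> sorted (permute_list p l))"

definition fermionic_sign :: "nat \<Rightarrow> nat list \<Rightarrow> int" where
  "fermionic_sign e w = sorting_sign (filter (\<lambda>i. e \<le> i) w)"

definition zvar :: "nat \<Rightarrow> nat \<Rightarrow> ft" where
  "zvar e i = (if i < e then fty i else ftx (i - e))"

definition zword :: "nat \<Rightarrow> nat list \<Rightarrow> ft" where
  "zword e w = prod_list (map (zvar e) w)"

text \<open>
  The display of \<open>\<sigma>\<close> in cycle form is an arbitrary one: the values of \<open>Phi\<close> and \<open>Psi\<close> do not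
  depend on it, because the sign \<open>fermionic_sign\<close> changes in the same way as the product when
  the cycles are rotated or permuted.
\<close>

definition Phi :: "nat \<Rightarrow> nat \<Rightarrow> (nat \<Rightarrow> nat) \<Rightarrow> ft" where
  "Phi e f \<sigma> = (let ws = (SOME ws. cycle_form (e + f) \<sigma> ws) in
     of_int (fermionic_sign e (concat ws)) * prod_list (map (\<lambda>w. ftr (zword e w)) ws))"

definition Psi :: "nat \<Rightarrow> nat \<Rightarrow> (nat \<Rightarrow> nat) \<Rightarrow> ft" where
  "Psi e f \<sigma> = (let (ws, u) = (SOME (ws, u). cycle_form (e + f) \<sigma> (ws @ [u @ [e + f - 1]])) in
     of_int (fermionic_sign e (concat ws @ u)) * prod_list (map (\<lambda>w. ftr (zword e w)) ws) * zword e u)"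

definition T_rel :: "nat \<Rightarrow> nat \<Rightarrow> ft" where
  "T_rel e f = (\<Sum>\<sigma> | \<sigma> permutes {..<e + f}. of_int (sign \<sigma>) * Phi e f \<sigma>)"

definition CH :: "nat \<Rightarrow> nat \<Rightarrow> ft" where
  "CH e f = (\<Sum>\<sigma> | \<sigma> permutes {..<e + f}. of_int (sign \<sigma>) * Psi e f \<sigma>)"

lemma sorting_permutation_unique:
  assumes "distinct l"
  shows "\<exists>!p. p permutes {..<length l} \<and> sorted (permute_list p l)"
proof -
  obtain p where p: "p permutes {..<length l}" "permute_list p l = sort l"
    using mset_eq_permutation[of "sort l" l] by auto
  show ?thesis
  proof (rule ex1I[of _ p])
    show "p permutes {..<length l} \<and> sorted (permute_list p l)" using p by simp
    fix q assume q: "q permutes {..<length l} \<and> sorted (permute_list q l)"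
    then have "permute_list q l = sort l"
      by (metis mset_permute_list properties_for_sort)
    with p have "\<forall>i<length l. l ! q i = l ! p i"
      using q by (metis permute_list_nth)
    then have "\<forall>i<length l. q i = p i"
      using assms p(1) q by (metis lessThan_iff nth_eq_iff_index_eq permutes_in_image)
    then show "q = p"
      using p(1) q by (metis ext lessThan_iff permutes_not_in)
  qed
qed

lemma cycle_form_exists:
  assumes "\<sigma> permutes {..<m}"
  shows "\<exists>ws. cycle_form m \<sigma> ws"
proof -
  have "cycle_decomp {..<m} \<sigma>"
    using assms by (simp add: cycle_decomposition)
  then have "(\<forall>x. x \<notin> {..<m} \<longrightarrow> \<sigma> x = x) \<and> (\<exists>ws. distinct (concat ws) \<and> set (concat ws) = {..<m} \<and> [] \<notin> set ws \<and>
     (\<forall>w\<in>set ws. map \<sigma> w = rotate1 w))"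
  proof (induction rule: cycle_decomp.induct)
    case empty
    show ?case by (intro conjI exI[of _ "[]"]) auto
  next
    case (comp I p cs)
    then obtain ws where ws: "distinct (concat ws)" "set (concat ws) = I" "[] \<notin> set ws"
      "\<forall>w\<in>set ws. map p w = rotate1 w" and out: "\<And>x. x \<notin> I \<Longrightarrow> p x = x" by blast
    let ?q = "cycle_of_list cs \<circ> p"
    have q1: "map ?q cs = rotate1 cs"
    proof -
      have "map ?q cs = map (cycle_of_list cs) cs"
        using comp.hyps(3) out by (intro map_cong) (auto simp: disjoint_iff)
      then show ?thesis
        using cyclic_rotation[OF comp.hyps(2), of 1] by (simp del: map_map map_eq_conv)
    qed
    have q2: "map ?q w = rotate1 w" if w: "w \<in> set ws" for w
    proof -
      have "set (map p w) \<subseteq> I" using ws(2,4) w by auto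
      then have "map (cycle_of_list cs) (map p w) = map p w"
        using comp.hyps(3) by (intro map_idI id_outside_supp) auto
      moreover have "map p w = rotate1 w" using ws(4) w by blast
      ultimately show ?thesis by (metis map_map)
    qed
    have "?q x = x" if "x \<notin> set cs \<union> I" for x
      using that out id_outside_supp by fastforce
    moreover have "\<exists>ws. distinct (concat ws) \<and> set (concat ws) = set cs \<union> I \<and> [] \<notin> set ws \<and>
       (\<forall>w\<in>set ws. map ?q w = rotate1 w)"
    proof (cases "cs = []")
      case True
      then show ?thesis using ws q2 by (intro exI[of _ ws]) auto
    next
      case False
      then show ?thesis using ws q1 q2 comp.hyps
        by (intro exI[of _ "cs # ws"]) auto
    qed
    ultimately show ?case by blast
  qed
  then show ?thesis by (auto simp: cycle_form_def)
qed

lemma cycle_form_last_exists: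
  assumes "\<sigma> permutes {..<m}" and "i < m"
  shows "\<exists>ws u. cycle_form m \<sigma> (ws @ [u @ [i]])"
proof -
  obtain vs where vs: "cycle_form m \<sigma> vs" using cycle_form_exists[OF assms(1)] by blast
  then obtain w where "w \<in> set vs" "i \<in> set w"
    using assms(2) unfolding cycle_form_def by (metis UN_E lessThan_iff set_concat)
  then obtain p q a b where split: "vs = p @ w # q" "w = a @ i # b"
    by (metis split_list)
  have "map \<sigma> w = rotate1 w" using vs split by (auto simp: cycle_form_def)
  then have "rotate (Suc (length a)) (map \<sigma> w) = rotate (Suc (length a)) (rotate1 w)" by simp
  moreover have "rotate (Suc (length a)) w = b @ a @ [i]"
    using rotate_append[of "a @ [i]" b] by (simp add: split)
  ultimately have "map \<sigma> (b @ a @ [i]) = rotate1 (b @ a @ [i])"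
    by (metis rotate1_rotate_swap rotate_map)
  then have "cycle_form m \<sigma> ((p @ q) @ [(b @ a) @ [i]])"
    using vs unfolding cycle_form_def split by auto
  then show ?thesis by blast
qed

end

theory Submission
  imports Defs
begin

text \<open>
  The identities of \<open>n \<times> n\<close> matrices in the super setting are controlled by permutations, as in the
  classical theorem of Procesi and Razmyslov.  A multilinear monomial in variables \<open>z\<^sub>i\<close>, one of its
  traces being cut open, is given by a permutation of the indices together with one extra index, the
  hole; the Koszul sign of the order in which the variables are written is included in the monomial
  (\<open>psi\<close>).  On matrices \<open>\<zeta>\<^sub>i E\<close>, with \<open>E\<close> the elementary matrix at row \<open>\<alpha> i\<close> and column \<open>\<beta> i\<close>, the
  monomial of \<open>\<sigma>\<close> closed up to a trace takes the value \<open>\<Prod>\<zeta>\<^sub>i\<close>, multiplied in increasing order, if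
  \<open>\<beta> = \<alpha> \<circ> \<sigma>\<close>, and 0 otherwise (\<open>eval_psi\<close>).  The sign cancels that of sorting the odd factors, so the super
  case does not differ from the classical one any more: a combination \<open>\<Sum>c\<^sub>\<sigma> \<sigma>\<close> is an identity if and only if
  all its matrix coefficients on the tensor power of \<open>\<complex>\<^sup>n\<close> vanish.

  Such combinations are handled by straightening.  Call a permutation good if it has no decreasing
  subsequence of length \<open>n + 1\<close>.  Antisymmetrizing over the \<open>n + 1\<close> positions of a decreasing subsequence expresses
  any other permutation by lexicographically smaller ones (\<open>good_span_mpsi\<close>), and the
  antisymmetrized monomials are consequences of the Cayley--Hamilton identities: all further indices
  can be deleted one by one, by substituting the product of two neighbours for one variable
  (\<open>antisymmetrized_in_T_ideal\<close>).  Good permutations, on the other hand, are linearly independent.  Their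
  positions can be coloured with \<open>n\<close> colours so that they increase on each colour class, and the matrix
  coefficient belonging to the colouring of \<open>\<sigma>\<close> involves only \<open>\<sigma>\<close> and lexicographically larger
  permutations (\<open>good_perms_independent\<close>).  So every multilinear identity lies in the T-ideal.

  Arbitrary identities are reduced to multilinear ones by polarization, written as an alternating sum of
  substitutions, so that it maps identities to identities, and restitution, which multiplies a
  monomial by a natural number (\<open>identities_in_T_ideal\<close>).  Conversely, an alternating sum over \<open>n + 1\<close>
  elementary matrices vanishes because two of them are in the same row (\<open>alternating_vanish\<close>).

  Part (i) follows from part (ii).  If \<open>J\<close> is a T-ideal of the trace algebra that contains the relations
  \<open>T_rel\<close> and \<open>t(1) - n\<close>, then the elements \<open>a\<close> with \<open>t(ab) \<in> J\<close> for all \<open>b\<close> form a T-ideal containing the Cayley--Hamilton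
  identities (\<open>trace_annihilator\<close>), hence all identities.  For \<open>a\<close> in the trace algebra \<open>t(a) = a t(1)\<close> is \<open>n a\<close>
  modulo \<open>J\<close>, so an identity in the trace algebra lies in \<open>J\<close>.
\<close>

section \<open>Koszul signs of lists of indices\<close>

text \<open>
  The integer form of \<open>koszul\<close>: integers act on the free superalgebra with trace and on the free
  supercommutative superalgebra alike, and commute with everything.
\<close>

definition swap_sign :: "bit \<Rightarrow> bit \<Rightarrow> int" where
  "swap_sign p q = (if p = 1 \<and> q = 1 then -1 else 1)"

lemma swap_sign_simps [simp]: "swap_sign 0 q = 1" "swap_sign p 0 = 1" "swap_sign 1 1 = -1"
  by (auto simp: swap_sign_def)

lemma swap_sign_commute: "swap_sign p q = swap_sign q p"
  by (auto simp: swap_sign_def)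

lemma swap_sign_sq: "swap_sign p q * swap_sign p q = 1"
  by (auto simp: swap_sign_def)

lemma swap_sign_add_left: "swap_sign (p + p') q = swap_sign p q * swap_sign p' q"
  by (cases p; cases p'; cases q) (simp_all add: swap_sign_def)

lemma swap_sign_add_right: "swap_sign q (p + p') = swap_sign q p * swap_sign q p'"
  by (metis swap_sign_add_left swap_sign_commute)

text \<open>
  The sign acquired by a symbol \<open>i\<close> on its way to the right, past those symbols of \<open>l\<close> that belong
  before it.
\<close>

definition cross_sign :: "(nat \<Rightarrow> bit) \<Rightarrow> nat \<Rightarrow> nat list \<Rightarrow> int" where
  "cross_sign d i l = (\<Prod>j\<leftarrow>l. if j < i then swap_sign (d i) (d j) else 1)"

text \<open>
  The sign of sorting a word \<open>l\<close> in supercommuting symbols of degrees \<open>d\<close> into increasing order.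
\<close>

primrec koszul_sign :: "(nat \<Rightarrow> bit) \<Rightarrow> nat list \<Rightarrow> int" where
  "koszul_sign d [] = 1"
| "koszul_sign d (i # l) = cross_sign d i l * koszul_sign d l"

lemma cross_sign_append: "cross_sign d i (u @ v) = cross_sign d i u * cross_sign d i v"
  by (simp add: cross_sign_def)

lemma cross_sign_Cons: "cross_sign d i (j # v) = (if j < i then swap_sign (d i) (d j) else 1) * cross_sign d i v"
  by (simp add: cross_sign_def)

lemma koszul_sign_swap:
  assumes "i \<noteq> j"
  shows "koszul_sign d (u @ i # j # v) = swap_sign (d i) (d j) * koszul_sign d (u @ j # i # v)"
proof (induction u)
  case Nil
  have "i < j \<or> j < i" using assms by auto
  moreover have "swap_sign (d i) (d j) * (swap_sign (d j) (d i) * x) = x" for x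
    using swap_sign_sq[of "d i" "d j"] by (simp add: swap_sign_commute[of "d j" "d i"] flip: mult.assoc)
  ultimately show ?case by (auto simp: cross_sign_Cons mult.assoc mult.left_commute)
next
  case (Cons k u)
  then show ?case by (simp add: cross_sign_append cross_sign_Cons mult.left_commute)
qed

lemma koszul_sign_sq: "koszul_sign d l * koszul_sign d l = 1"
proof (induction l)
  case (Cons i l)
  have "cross_sign d i l * cross_sign d i l = 1"
  proof (induction l)
    case (Cons j l)
    then show ?case
      using swap_sign_sq[of "d i" "d j"] by (simp add: cross_sign_Cons) algebra
  qed (simp add: cross_sign_def)
  with Cons show ?case by simp algebra
qed simp

lemma koszul_sign_sorted: "sorted l \<Longrightarrow> koszul_sign d l = 1"
proof (induction l)
  case (Cons i l)
  have "cross_sign d i l = (\<Prod>j\<leftarrow>l. 1)"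
    unfolding cross_sign_def using Cons.prems by (intro arg_cong[of _ _ prod_list] map_cong) (auto simp: not_less)
  also have "\<dots> = 1" by (induction l) auto
  finally show ?case using Cons by simp
qed simp

text \<open>
  Adjacent swaps connect any two orderings of \<open>S\<close>: they bring the head of \<open>l'\<close> to the front of
  \<open>l\<close>, and the tails are treated by induction.
\<close>

lemma adjacent_swap_invariant:
  assumes "\<And>u i j v. distinct (u @ i # j # v) \<Longrightarrow> set (u @ i # j # v) = S \<Longrightarrow> G (u @ i # j # v) = G (u @ j # i # v)"
    and "distinct l" "distinct l'" "set l = S" "set l' = S"
  shows "G l = G l'"
  using assms
proof (induction l' arbitrary: G l S)
  case Nil
  then show ?case by simp
next
  case (Cons x t)
  then obtain u v where l: "l = u @ x # v" by (metis list.set_intros(1) split_list)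
  have front: "G (u @ x # v) = G (x # u @ v)"
    if "distinct (u @ x # v)" "set (u @ x # v) = S" for u v
    using that
  proof (induction u arbitrary: v rule: rev_induct)
    case (snoc y u)
    then have "G (u @ y # x # v) = G (u @ x # y # v)"
      by (intro Cons.prems(1)) auto
    also have "\<dots> = G (x # u @ y # v)"
      using snoc.prems by (intro snoc.IH) auto
    finally show ?case by simp
  qed simp
  have "G l = G (x # u @ v)"
    using front[of u v] Cons.prems l by simp
  also have "\<dots> = G (x # t)"
  proof (rule Cons.IH[of "S - {x}" "\<lambda>l. G (x # l)"])
    fix u' i j v' assume "distinct (u' @ i # j # v')" "set (u' @ i # j # v') = S - {x}"
    then show "G (x # u' @ i # j # v') = G (x # u' @ j # i # v')"
      using Cons.prems(1)[of "x # u'" i j v'] Cons.prems(5) by (auto simp: insert_absorb)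
  qed (use Cons.prems l in auto)
  finally show ?case .
qed

text \<open>
  Multiplied by \<open>koszul_sign\<close>, a quantity that obeys the Koszul rule under adjacent swaps becomes
  invariant under them, so that its value at one ordering determines it.  All signs below are
  compared in this way: it is enough to look at adjacent swaps.
\<close>

lemma koszul_swap:
  fixes F :: "nat list \<Rightarrow> 'a::ring_1"
  assumes sw: "\<And>u i j v. distinct (u @ i # j # v) \<Longrightarrow> set (u @ i # j # v) = S \<Longrightarrow>
      F (u @ i # j # v) = of_int (swap_sign (d i) (d j)) * F (u @ j # i # v)"
    and "distinct l" "distinct l'" "set l = S" "set l' = S"
  shows "F l = of_int (koszul_sign d l * koszul_sign d l') * F l'"
proof -
  have cancel: "of_int c * (of_int c * x) = x" if "c * c = 1" for c :: int and x :: 'a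
    using that by (simp flip: mult.assoc of_int_mult)
  have "of_int (koszul_sign d l) * F l = of_int (koszul_sign d l') * F l'"
  proof (rule adjacent_swap_invariant[where G = "\<lambda>l. of_int (koszul_sign d l) * F l" and S = S])
    fix u i j v assume *: "distinct (u @ i # j # v)" "set (u @ i # j # v) = S"
    then have "koszul_sign d (u @ i # j # v) = swap_sign (d i) (d j) * koszul_sign d (u @ j # i # v)"
      by (intro koszul_sign_swap) auto
    then have "koszul_sign d (u @ i # j # v) * swap_sign (d i) (d j) = koszul_sign d (u @ j # i # v)"
      using swap_sign_sq[of "d i" "d j"] by algebra
    then show "of_int (koszul_sign d (u @ i # j # v)) * F (u @ i # j # v) = of_int (koszul_sign d (u @ j # i # v)) * F (u @ j # i # v)"
      unfolding sw[OF *] by (metis mult.assoc of_int_mult)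
  qed (use assms in auto)
  then have "of_int (koszul_sign d l) * (of_int (koszul_sign d l) * F l) = of_int (koszul_sign d l) * (of_int (koszul_sign d l') * F l')"
    by simp
  then show ?thesis
    by (simp add: cancel koszul_sign_sq mult.assoc)
qed

lemma koszul_swap_sorted:
  fixes F :: "nat list \<Rightarrow> 'a::ring_1"
  assumes sw: "\<And>u i j v. distinct (u @ i # j # v) \<Longrightarrow> set (u @ i # j # v) = S \<Longrightarrow>
      F (u @ i # j # v) = of_int (swap_sign (d i) (d j)) * F (u @ j # i # v)"
    and "distinct l" "set l = S"
  shows "F l = of_int (koszul_sign d l) * F (sorted_list_of_set S)"
proof -
  have "finite S" using assms(3) by auto
  then show ?thesis
    using koszul_swap[where F=F and S=S and l=l and l'="sorted_list_of_set S" and d=d] assms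
    by (simp add: koszul_sign_sorted)
qed

definition degsum :: "(nat \<Rightarrow> bit) \<Rightarrow> nat list \<Rightarrow> bit" where
  "degsum d l = sum_list (map d l)"

lemma degsum_simps [simp]: "degsum d [] = 0" "degsum d (i # l) = d i + degsum d l"
  "degsum d (u @ v) = degsum d u + degsum d v"
  by (simp_all add: degsum_def)

lemma koszul_sign_move:
  assumes "distinct (u @ i # x @ v)"
  shows "koszul_sign d (u @ i # x @ v) = swap_sign (d i) (degsum d x) * koszul_sign d (u @ x @ i # v)"
  using assms
proof (induction x arbitrary: u)
  case (Cons j x)
  have "koszul_sign d (u @ i # j # x @ v) = swap_sign (d i) (d j) * koszul_sign d ((u @ [j]) @ i # x @ v)"
    using Cons.prems koszul_sign_swap[of i j d u "x @ v"] by simp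
  also have "\<dots> = swap_sign (d i) (d j) * swap_sign (d i) (degsum d x) * koszul_sign d ((u @ [j]) @ x @ i # v)"
    using Cons.IH[of "u @ [j]"] Cons.prems by auto
  finally show ?case by (simp add: swap_sign_add_right del: add_bit_eq_xor)
qed simp

text \<open>
  A block moves like a single symbol whose degree is the sum of the degrees in the block.
\<close>

lemma koszul_sign_swap_blocks:
  assumes "distinct (u @ x @ y @ v)"
  shows "koszul_sign d (u @ x @ y @ v) = swap_sign (degsum d x) (degsum d y) * koszul_sign d (u @ y @ x @ v)"
  using assms
proof (induction x arbitrary: v y rule: rev_induct)
  case (snoc i x)
  have "koszul_sign d (u @ (x @ [i]) @ y @ v) = koszul_sign d ((u @ x) @ i # y @ v)" by simp
  also have "\<dots> = swap_sign (d i) (degsum d y) * koszul_sign d ((u @ x) @ y @ i # v)"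
    using snoc.prems by (intro koszul_sign_move) auto
  also have "koszul_sign d ((u @ x) @ y @ i # v) = swap_sign (degsum d x) (degsum d y) * koszul_sign d (u @ y @ x @ i # v)"
    using snoc.IH[of y "i # v"] snoc.prems by auto
  finally show ?case by (simp add: swap_sign_add_left mult_ac del: add_bit_eq_xor)
qed simp

lemma koszul_sign_cong: "(\<And>i. i \<in> set l \<Longrightarrow> d i = d' i) \<Longrightarrow> koszul_sign d l = koszul_sign d' l"
proof (induction l)
  case (Cons i l)
  have "cross_sign d i l = cross_sign d' i l"
    unfolding cross_sign_def using Cons.prems by (intro arg_cong[of _ _ prod_list] map_cong) auto
  then show ?case using Cons by simp
qed simp

subsection \<open>The sign of the sorting permutation\<close>

lemma sorting_sign_eqI:
  assumes "distinct l" "p permutes {..<length l}" "sorted (permute_list p l)"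
  shows "sorting_sign l = sign p"
  unfolding sorting_sign_def
  using the1_equality[OF sorting_permutation_unique[OF assms(1)], of p] assms by simp

lemma sorting_sign_sorted:
  assumes "distinct l" "sorted l" shows "sorting_sign l = 1"
  using sorting_sign_eqI[of l id] assms by (simp add: permutes_id)

text \<open>
  If \<open>p\<close> sorts one of the two lists, then its composite with the transposition of the two positions
  sorts the other.
\<close>

lemma sorting_sign_swap:
  assumes "distinct (u @ i # j # v)"
  shows "sorting_sign (u @ i # j # v) = - sorting_sign (u @ j # i # v)"
proof -
  let ?l = "u @ i # j # v" and ?l' = "u @ j # i # v"
  let ?t = "Transposition.transpose (length u) (Suc (length u))"
  have t: "?t permutes {..<length ?l}" by (rule permutes_swap_id) auto
  have dl': "distinct ?l'" using assms by auto
  have l: "permute_list ?t ?l = ?l'"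
    using t by (intro nth_equalityI) (auto simp: permute_list_nth nth_append nth_Cons' Transposition.transpose_def)
  obtain p where p: "p permutes {..<length ?l'}" "sorted (permute_list p ?l')"
    using sorting_permutation_unique[OF dl'] by blast
  have "permute_list (?t \<circ> p) ?l = permute_list p ?l'"
    using p(1) by (subst permute_list_compose) (simp_all add: l)
  moreover have "(?t \<circ> p) permutes {..<length ?l}"
    using p(1) t by (intro permutes_compose) simp_all
  ultimately have "sorting_sign ?l = sign (?t \<circ> p)"
    using sorting_sign_eqI[OF assms, of "?t \<circ> p"] p(2) by simp
  also have "\<dots> = - sign p"
  proof -
    have "permutation p" using p(1) permutation_permutes by blast
    then show ?thesis
      using sign_compose[OF permutation_swap_id, of p "length u" "Suc (length u)"] by (simp add: sign_swap_id)
  qed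
  also have "sign p = sorting_sign ?l'"
    using sorting_sign_eqI[OF dl' p] by simp
  finally show ?thesis .
qed

lemma sorting_sign_koszul_sign:
  assumes "distinct l" shows "sorting_sign l = koszul_sign (\<lambda>_. 1) l"
proof -
  have "sorting_sign l = of_int (koszul_sign (\<lambda>_. 1) l) * sorting_sign (sorted_list_of_set (set l))"
  proof (rule koszul_swap_sorted[OF _ assms refl])
    fix u v :: "nat list" and i j assume "distinct (u @ i # j # v)"
    from sorting_sign_swap[OF this] show "sorting_sign (u @ i # j # v) = of_int (swap_sign 1 1) * sorting_sign (u @ j # i # v)"
      by simp
  qed
  then show ?thesis by (simp add: sorting_sign_sorted)
qed

lemma koszul_sign_filter: "koszul_sign (\<lambda>i. if i < e then 0 else 1) l = koszul_sign (\<lambda>_. 1) (filter (\<lambda>i. e \<le> i) l)"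
proof (induction l)
  case (Cons i l)
  have "cross_sign (\<lambda>i. if i < e then 0 else 1) i l = cross_sign (\<lambda>_. 1) i (filter (\<lambda>i. e \<le> i) l)" if "e \<le> i"
    using that by (induction l) (auto simp: cross_sign_def)
  moreover have "cross_sign (\<lambda>i. if i < e then 0 else 1) i l = 1" if "i < e"
    using that by (induction l) (auto simp: cross_sign_def)
  ultimately show ?case using Cons by auto
qed simp

definition dpar :: "nat \<Rightarrow> nat \<Rightarrow> bit" where
  "dpar e i = (if i < e then 0 else 1)"

lemma fermionic_sign_koszul_sign: "distinct l \<Longrightarrow> fermionic_sign e l = koszul_sign (dpar e) l"
  using sorting_sign_koszul_sign[of "filter (\<lambda>i. e \<le> i) l"] koszul_sign_filter[of e l]
  unfolding fermionic_sign_def dpar_def[abs_def] by (metis distinct_filter)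

section \<open>Trace monomials and displays of permutations\<close>

lemma of_int_left_commute: "x * (of_int k * y) = of_int k * (x * y)" for x y :: "'a::ring_1"
  by (metis mult.assoc mult_of_int_commute)

lemma ftconst_koszul: "ftconst (koszul p q) = of_int (swap_sign p q)"
  by (cases p; cases q) (auto simp: koszul_def swap_sign_def ftconst_minus)

lemma ftr_central: "a \<in> ftgrade p \<Longrightarrow> b \<in> ftgrade q \<Longrightarrow> ftr a * b = of_int (swap_sign p q) * (b * ftr a)"
  using ft.tr_central[of a p b q] by (simp add: ftconst_koszul)

lemma ftr_cyclic: "a \<in> ftgrade p \<Longrightarrow> b \<in> ftgrade q \<Longrightarrow> ftr (a * b) = of_int (swap_sign p q) * ftr (b * a)"
  using ft.tr_cyclic[of a p b q] by (simp add: ftconst_koszul)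

lemma ftr_0 [simp]: "ftr 0 = 0"
  using ftr_add[of 0 0] by simp

lemma ftr_sum: "ftr (\<Sum>i\<in>A. f i) = (\<Sum>i\<in>A. ftr (f i))"
  by (induction A rule: infinite_finite_induct) (auto simp: ftr_add)

text \<open>
  The axioms give this for homogeneous elements only; all maps involved are additive.
\<close>

lemma ftr_ftr: "ftr (ftr a * b) = ftr a * ftr b"
proof -
  obtain a0 a1 where a: "a0 \<in> ftgrade 0" "a1 \<in> ftgrade 1" "a = a0 + a1" using ft.hom_sum by blast
  obtain b0 b1 where b: "b0 \<in> ftgrade 0" "b1 \<in> ftgrade 1" "b = b0 + b1" using ft.hom_sum by blast
  show ?thesis
    unfolding a b ftr_add distrib_left distrib_right
    using a b by (simp add: ft.tr_tr ftr_add)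
qed

lemma of_int_ftgrade: "a \<in> ftgrade p \<Longrightarrow> of_int k * a \<in> ftgrade p"
proof -
  assume a: "a \<in> ftgrade p"
  have n: "of_nat m * a \<in> ftgrade p" for m
    by (induction m) (auto simp: distrib_right ftgrade_zero intro: ftgrade_add a)
  have "ftconst (-1) * b \<in> ftgrade p" if "b \<in> ftgrade p" for b
    using ftgrade_mult[OF ftgrade_const that, of "-1"] by (simp only: add_0)
  then have "- b \<in> ftgrade p" if "b \<in> ftgrade p" for b
    using that by (auto simp: ftconst_minus)
  with n show ?thesis by (cases k rule: int_cases2) auto
qed

text \<open>
  The variables of a trace monomial will be arbitrary homogeneous elements \<open>a i\<close> of prescribed degrees
  \<open>d i\<close>, so that substitution instances need no separate treatment.
\<close>

definition homog :: "(nat \<Rightarrow> ft) \<Rightarrow> (nat \<Rightarrow> bit) \<Rightarrow> nat set \<Rightarrow> bool" where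
  "homog a d S \<longleftrightarrow> (\<forall>i\<in>S. a i \<in> ftgrade (d i))"

abbreviation word :: "('i \<Rightarrow> ft) \<Rightarrow> 'i list \<Rightarrow> ft" where
  "word a w \<equiv> prod_list (map a w)"

abbreviation traces :: "('i \<Rightarrow> ft) \<Rightarrow> 'i list list \<Rightarrow> ft" where
  "traces a ws \<equiv> prod_list (map (\<lambda>w. ftr (word a w)) ws)"

lemma homog_word: "homog a d (set w) \<Longrightarrow> word a w \<in> ftgrade (degsum d w)"
proof (induction w)
  case Nil
  then show ?case using ftgrade_const[of 1] by simp
next
  case (Cons i w)
  then have "a i * word a w \<in> ftgrade (d i + degsum d w)"
    by (intro ftgrade_mult) (auto simp: homog_def)
  then show ?case by simp
qed

lemma homog_subset: "homog a d S \<Longrightarrow> T \<subseteq> S \<Longrightarrow> homog a d T"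
  by (auto simp: homog_def)

definition trace_monomial :: "(nat \<Rightarrow> ft) \<Rightarrow> nat list list \<Rightarrow> nat list \<Rightarrow> ft" where
  "trace_monomial a ws u = traces a ws * word a u"

lemma trace_monomial_simps:
  "trace_monomial a [] u = word a u"
  "trace_monomial a (w # ws) u = ftr (word a w) * trace_monomial a ws u"
  by (simp_all add: trace_monomial_def mult.assoc)

lemma trace_monomial_append: "trace_monomial a (vs @ ws) u = traces a vs * trace_monomial a ws u"
  by (simp add: trace_monomial_def mult.assoc)

lemma trace_monomial_cong: "(\<And>i. i \<in> set (concat ws @ u) \<Longrightarrow> a i = b i) \<Longrightarrow> trace_monomial a ws u = trace_monomial b ws u"
  unfolding trace_monomial_def by (intro arg_cong2[of _ _ _ _ "(*)"] arg_cong[of _ _ prod_list] map_cong arg_cong[of _ _ ftr]) auto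

lemma traces_grade:
  "homog a d (set (concat ws)) \<Longrightarrow>
     traces a ws \<in> ftgrade (degsum d (concat ws))"
proof (induction ws)
  case Nil
  then show ?case using ftgrade_const[of 1] by simp
next
  case (Cons w ws)
  then have "ftr (word a w) \<in> ftgrade (degsum d w)"
    by (intro ftgrade_tr homog_word) (auto simp: homog_def)
  moreover have "traces a ws \<in> ftgrade (degsum d (concat ws))"
    using Cons by (auto simp: homog_def)
  ultimately have "ftr (word a w) * traces a ws \<in>
      ftgrade (degsum d w + degsum d (concat ws))"
    by (rule ftgrade_mult)
  then show ?case by simp
qed

lemma ftr_traces: "ftr (prod_list (map (\<lambda>w. ftr (f w)) ws) * b) = prod_list (map (\<lambda>w. ftr (f w)) ws) * ftr b"
  by (induction ws arbitrary: b) (simp_all add: mult.assoc ftr_ftr)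

lemma ftr_trace_monomial: "ftr (trace_monomial a ws u) = trace_monomial a (ws @ [u]) []"
  unfolding trace_monomial_def ftr_traces by simp

text \<open>
  This is the monomial called \<Psi>, whose last trace is left open; for empty \<open>u\<close> all traces are closed, and
  it is the monomial called \<Phi> for the permutation with cycles \<open>ws\<close>.
\<close>

definition val :: "(nat \<Rightarrow> ft) \<Rightarrow> (nat \<Rightarrow> bit) \<Rightarrow> nat list list \<Rightarrow> nat list \<Rightarrow> ft" where
  "val a d ws u = of_int (koszul_sign d (concat ws @ u)) * trace_monomial a ws u"

text \<open>
  A permutation of \<open>insert s S\<close> in cycle notation; the cycle through \<open>s\<close> is \<open>u @ [s]\<close>.  The hole \<open>s\<close> marks the place
  where a trace has been cut open and carries no variable.  It lies outside \<open>S\<close>, so it does not enter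
  the sign, and any index, not only the last one, can serve as a hole.  If \<open>s\<close> is a fixed point, then
  \<open>u\<close> is empty and the permutation is one of \<open>S\<close>.
\<close>

definition display :: "nat set \<Rightarrow> nat \<Rightarrow> (nat \<Rightarrow> nat) \<Rightarrow> nat list list \<Rightarrow> nat list \<Rightarrow> bool" where
  "display S s \<sigma> ws u \<longleftrightarrow> distinct (concat ws @ u) \<and> set (concat ws @ u) = S \<and> s \<notin> S \<and> [] \<notin> set ws \<and>
     (\<forall>w\<in>set ws. map \<sigma> w = rotate1 w) \<and> map \<sigma> (u @ [s]) = rotate1 (u @ [s])"

lemma cyclic_word_rotate:
  assumes "map \<sigma> (x @ y) = rotate1 (x @ y)"
  shows "map \<sigma> (y @ x) = rotate1 (y @ x)"
proof -
  have "y @ x = rotate (length x) (x @ y)" by (simp add: rotate_append)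
  then show ?thesis by (metis assms rotate1_rotate_swap rotate_map)
qed

lemma cyclic_word_next:
  assumes "map \<sigma> w = rotate1 w" "w = x @ r # q # y"
  shows "\<sigma> r = q"
proof -
  have "map \<sigma> w ! length x = rotate1 w ! length x" using assms(1) by simp
  then show ?thesis using assms(2) by (simp add: nth_rotate1 nth_append)
qed

text \<open>
  Once \<open>r\<close> is deleted, its predecessor is mapped to its successor \<open>q\<close>; composing with the
  transposition of \<open>r\<close> and \<open>q\<close> has this effect.
\<close>

lemma cyclic_word_delete:
  assumes "map \<sigma> (x @ r # q # y) = rotate1 (x @ r # q # y)" "distinct (x @ r # q # y)"
  shows "map (Transposition.transpose r q \<circ> \<sigma>) (x @ q # y) = rotate1 (x @ q # y)"
proof -
  have "map \<sigma> ((r # q # y) @ x) = rotate1 ((r # q # y) @ x)"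
    by (rule cyclic_word_rotate) (use assms in simp)
  then have *: "map \<sigma> (q # y @ x) = y @ x @ [r]" by simp
  have "map (Transposition.transpose r q) (y @ x) = y @ x"
    using assms(2) by (intro map_idI) (auto simp: Transposition.transpose_def)
  then have "map (Transposition.transpose r q) (map \<sigma> (q # y @ x)) = y @ x @ [q]"
    unfolding * by simp
  then have "map (Transposition.transpose r q \<circ> \<sigma>) ((q # y) @ x) = rotate1 ((q # y) @ x)"
    by (simp only: map_map) simp
  from cyclic_word_rotate[OF this] show ?thesis .
qed

lemma cyclic_word_other:
  assumes "map \<sigma> w = rotate1 w" "r \<notin> set w" "q \<notin> set w"
  shows "map (Transposition.transpose r q \<circ> \<sigma>) w = rotate1 w"
proof -
  have "map (Transposition.transpose r q) (map \<sigma> w) = map \<sigma> w"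
    unfolding assms(1) using assms(2,3) by (intro map_idI) (auto simp: Transposition.transpose_def)
  then show ?thesis by (metis assms(1) map_map)
qed

lemma cyclic_word_closed:
  assumes "map \<sigma> w = rotate1 w" "r \<in> set w" shows "\<sigma> r \<in> set w"
  using assms by (metis image_eqI set_map set_rotate1)

lemma cyclic_word_split:
  assumes "map \<sigma> w = rotate1 w" "r \<in> set w" "\<sigma> r \<noteq> r"
  obtains x y where "w = x @ y" "y @ x = r # \<sigma> r # tl (tl (y @ x))"
proof -
  obtain x y where w: "w = x @ r # y" using assms(2) by (metis split_list)
  have "map \<sigma> ((r # y) @ x) = rotate1 ((r # y) @ x)"
    by (rule cyclic_word_rotate) (use assms w in simp)
  then have m: "map \<sigma> (r # y @ x) = y @ x @ [r]" by simp
  then have "y @ x \<noteq> []" using assms(3) by auto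
  then obtain b t where "y @ x = b # t" by (meson neq_Nil_conv)
  with m have "b = \<sigma> r" by (simp flip: append_assoc)
  with \<open>y @ x = b # t\<close> have "(r # y) @ x = r # \<sigma> r # tl (tl ((r # y) @ x))" by simp
  then show ?thesis using that[of x "r # y"] w by blast
qed

lemma display_rotate: "display S s \<sigma> (p @ (x @ y) # q) u \<Longrightarrow> display S s \<sigma> (p @ (y @ x) # q) u"
  using cyclic_word_rotate[of \<sigma> x y] unfolding display_def by (auto simp del: map_append)

text \<open>
  The sign from the cyclic invariance of the trace is the one by which the Koszul sign changes when
  the two blocks are interchanged.
\<close>

lemma val_rotate:
  assumes "distinct (concat (p @ (x @ y) # q) @ u)" "homog a d (set (concat (p @ (x @ y) # q) @ u))"
  shows "val a d (p @ (x @ y) # q) u = val a d (p @ (y @ x) # q) u"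
proof -
  let ?k = "swap_sign (degsum d x) (degsum d y)"
  have k: "koszul_sign d (concat (p @ (x @ y) # q) @ u) = ?k * koszul_sign d (concat (p @ (y @ x) # q) @ u)"
    using koszul_sign_swap_blocks[of "concat p" x y "concat q @ u" d] assms(1) by simp
  have "ftr (word a (x @ y)) = of_int ?k * ftr (word a (y @ x))"
    unfolding map_append prod_list.append
    using assms(2) by (intro ftr_cyclic homog_word) (auto simp: homog_def)
  then have m: "trace_monomial a (p @ (x @ y) # q) u = of_int ?k * trace_monomial a (p @ (y @ x) # q) u"
    unfolding trace_monomial_append trace_monomial_simps by (simp add: mult.assoc of_int_left_commute)
  have "koszul_sign d (concat (p @ (x @ y) # q) @ u) * ?k = koszul_sign d (concat (p @ (y @ x) # q) @ u)"
    unfolding k using swap_sign_sq[of "degsum d x" "degsum d y"] by algebra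
  then show ?thesis
    unfolding val_def m by (simp flip: mult.assoc of_int_mult)
qed

text \<open>
  If \<open>r\<close> is followed by \<open>q\<close> in its cycle, then the trace monomial arises from one in which \<open>r\<close> is missing
  by substituting the product \<open>a r * a q\<close> for the variable \<open>a q\<close>.  On words this replaces \<open>q\<close> by \<open>[r, q]\<close>;
  \<open>merge_arg\<close> and \<open>merge_deg\<close> are the effect on variables and degrees.
\<close>

definition expand :: "nat \<Rightarrow> nat \<Rightarrow> nat list \<Rightarrow> nat list" where
  "expand r q l = concat (map (\<lambda>i. if i = q then [r, q] else [i]) l)"

lemma expand_append: "expand r q (u @ v) = expand r q u @ expand r q v"
  by (simp add: expand_def)

lemma expand_notin: "q \<notin> set l \<Longrightarrow> expand r q l = l"
  by (induction l) (auto simp: expand_def)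

lemma expand_Cons: "expand r q (i # l) = (if i = q then [r, q] else [i]) @ expand r q l"
  by (simp add: expand_def)

lemma distinct_expand: "distinct l \<Longrightarrow> r \<notin> set l \<Longrightarrow> distinct (expand r q l)"
proof (induction l)
  case (Cons i l)
  have "set (expand r q l) \<subseteq> set l \<union> (if q \<in> set l then {r} else {})"
    by (auto simp: expand_def split: if_splits)
  with Cons show ?case by (auto simp: expand_Cons split: if_splits)
qed (simp add: expand_def)

definition merge_deg :: "nat \<Rightarrow> nat \<Rightarrow> (nat \<Rightarrow> bit) \<Rightarrow> nat \<Rightarrow> bit" where
  "merge_deg r q d = d(q := d r + d q)"

definition merge_arg :: "nat \<Rightarrow> nat \<Rightarrow> (nat \<Rightarrow> ft) \<Rightarrow> nat \<Rightarrow> ft" where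
  "merge_arg r q a = a(q := a r * a q)"

lemma prod_merge:
  "q \<notin> set l \<Longrightarrow> word (merge_arg r q a) l = word a l"
  by (intro arg_cong[of _ _ prod_list] map_cong) (auto simp: merge_arg_def)

lemma traces_merge:
  "q \<notin> set (concat ws) \<Longrightarrow> traces (merge_arg r q a) ws =
     traces a ws"
  by (intro arg_cong[of _ _ prod_list] map_cong arg_cong[of _ _ ftr] prod_merge) auto

text \<open>
  The second factor depends on \<open>S\<close>, \<open>r\<close> and \<open>q\<close> only.  This matters when signed monomials are summed
  over many permutations: the factor can be taken out of the sum.
\<close>

lemma koszul_sign_expand:
  assumes "distinct l" "set l = S" "r \<notin> S"
  shows "koszul_sign d (expand r q l) = koszul_sign (merge_deg r q d) l * koszul_sign d (expand r q (sorted_list_of_set S))"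
proof -
  have "koszul_sign d (expand r q l) = of_int (koszul_sign (merge_deg r q d) l) * koszul_sign d (expand r q (sorted_list_of_set S))"
  proof (rule koszul_swap_sorted[where F = "\<lambda>l. koszul_sign d (expand r q l)", OF _ assms(1,2)])
    fix u v i j assume *: "distinct (u @ i # j # v)" "set (u @ i # j # v) = S"
    let ?E = "\<lambda>i. if i = q then [r, q] else [i]"
    have "koszul_sign d (expand r q u @ ?E i @ ?E j @ expand r q v) =
       swap_sign (degsum d (?E i)) (degsum d (?E j)) * koszul_sign d (expand r q u @ ?E j @ ?E i @ expand r q v)"
    proof (rule koszul_sign_swap_blocks)
      have "distinct (expand r q (u @ i # j # v))"
        using * assms(3) by (intro distinct_expand) auto
      then show "distinct (expand r q u @ ?E i @ ?E j @ expand r q v)"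
        by (simp only: expand_append expand_Cons)
    qed
    moreover have "degsum d (?E i) = merge_deg r q d i" for i by (simp add: merge_deg_def)
    ultimately show "koszul_sign d (expand r q (u @ i # j # v)) =
        of_int (swap_sign (merge_deg r q d i) (merge_deg r q d j)) * koszul_sign d (expand r q (u @ j # i # v))"
      by (simp only: expand_append expand_Cons of_int_eq_id id_apply)
  qed
  then show ?thesis by simp
qed

lemma koszul_sign_Cons_sorted:
  assumes "distinct l" "set l = S" "r \<notin> S"
  shows "koszul_sign d (r # l) = koszul_sign d l * koszul_sign d (r # sorted_list_of_set S)"
proof -
  have "koszul_sign d (r # l) = of_int (koszul_sign d l) * koszul_sign d (r # sorted_list_of_set S)"
  proof (rule koszul_swap_sorted[where F = "\<lambda>l. koszul_sign d (r # l)", OF _ assms(1,2)])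
    fix u v :: "nat list" and i j assume "distinct (u @ i # j # v)"
    then show "koszul_sign d (r # u @ i # j # v) = of_int (swap_sign (d i) (d j)) * koszul_sign d (r # u @ j # i # v)"
      using koszul_sign_swap[of i j d "r # u" v] by (simp del: koszul_sign.simps)
  qed
  then show ?thesis by simp
qed

lemma koszul_sign_snoc_sorted:
  assumes "distinct l" "set l = S" "r \<notin> S"
  shows "koszul_sign d (l @ [r]) = koszul_sign d l * koszul_sign d (sorted_list_of_set S @ [r])"
proof -
  have "koszul_sign d (l @ [r]) = of_int (koszul_sign d l) * koszul_sign d (sorted_list_of_set S @ [r])"
  proof (rule koszul_swap_sorted[where F = "\<lambda>l. koszul_sign d (l @ [r])", OF _ assms(1,2)])
    fix u v :: "nat list" and i j assume "distinct (u @ i # j # v)"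
    then show "koszul_sign d ((u @ i # j # v) @ [r]) = of_int (swap_sign (d i) (d j)) * koszul_sign d ((u @ j # i # v) @ [r])"
      using koszul_sign_swap[of i j d u "v @ [r]"] by (simp del: koszul_sign.simps)
  qed
  then show ?thesis by simp
qed

text \<open>
  The next three lemmas delete an index \<open>r\<close> from a display, according to the image of \<open>r\<close>: a fixed
  point splits off as a separate trace, the index before the hole is the last letter of the open
  word, and any other index is merged with its successor.  The signs do not depend on the permutation.
\<close>

lemma display_delete_fixed:
  assumes D: "display S s \<sigma> ws u" and r: "r \<in> S" "\<sigma> r = r" and h: "homog a d S"
  shows "\<exists>ws'. display (S - {r}) s \<sigma> ws' u \<and>
    val a d ws u = of_int (koszul_sign d (r # sorted_list_of_set (S - {r}))) * (ftr (a r) * val a d ws' u)"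
proof -
  have "r \<notin> set u"
  proof
    assume "r \<in> set u"
    then obtain x y where u: "u = x @ r # y" by (metis split_list)
    obtain b z where z: "y @ [s] = b # z" by (cases y) auto
    have "\<sigma> r = b"
      using D u z by (intro cyclic_word_next[of \<sigma> "u @ [s]" x r b z]) (auto simp: display_def)
    then show False using D u z r by (cases y) (auto simp: display_def)
  qed
  then obtain w where w: "w \<in> set ws" "r \<in> set w" using D r by (auto simp: display_def)
  obtain p q where ws: "ws = p @ w # q" using w(1) by (metis split_list)
  obtain x y where xy: "w = x @ r # y" using w(2) by (metis split_list)
  have dw: "distinct (concat ws @ u)" and cw: "map \<sigma> w = rotate1 w" using D w by (auto simp: display_def)
  have "w = [r]"
  proof -
    have "map \<sigma> ((r # y) @ x) = rotate1 ((r # y) @ x)"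
      by (rule cyclic_word_rotate) (use cw xy in simp)
    then have *: "map \<sigma> (r # y @ x) = y @ x @ [r]" by simp
    have "y @ x = []"
    proof (rule ccontr)
      assume "y @ x \<noteq> []"
      then obtain b t where "y @ x = b # t" by (meson neq_Nil_conv)
      with * r have "b = r" by (simp flip: append_assoc)
      with \<open>y @ x = b # t\<close> have "r \<in> set y \<union> set x" by (metis list.set_intros(1) set_append)
      then show False using dw ws xy by auto
    qed
    then show ?thesis using xy by simp
  qed
  with ws have ws: "ws = p @ [r] # q" by simp
  let ?l = "concat (p @ q) @ u"
  have dl: "distinct ?l" "set ?l = S - {r}" "r \<notin> S - {r}"
    using D unfolding display_def ws by auto
  have "display (S - {r}) s \<sigma> (p @ q) u"
    using D dl unfolding display_def ws by auto
  moreover have "val a d ws u = of_int (koszul_sign d (r # sorted_list_of_set (S - {r}))) * (ftr (a r) * val a d (p @ q) u)"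
  proof -
    let ?k = "swap_sign (d r) (degsum d (concat p))" and ?c = "koszul_sign d (r # sorted_list_of_set (S - {r}))"
    let ?P = "traces a p"
    have k: "koszul_sign d (r # ?l) = ?k * koszul_sign d (concat ws @ u)"
      using koszul_sign_move[of "[]" r "concat p" "concat q @ u" d] dw ws by auto
    have "ftr (a r) * ?P = of_int ?k * (?P * ftr (a r))"
      using h D unfolding display_def ws
      by (intro ftr_central traces_grade) (auto simp: homog_def)
    then have m: "ftr (a r) * trace_monomial a (p @ q) u = of_int ?k * trace_monomial a ws u"
      unfolding ws trace_monomial_append trace_monomial_simps by (simp flip: mult.assoc)
    have e: "koszul_sign d (r # ?l) = koszul_sign d ?l * ?c" by (rule koszul_sign_Cons_sorted[OF dl])
    have c: "?c * koszul_sign d ?l * ?k = koszul_sign d (concat ws @ u)"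
      using e k swap_sign_sq[of "d r" "degsum d (concat p)"] by algebra
    have "of_int ?c * (ftr (a r) * val a d (p @ q) u) = of_int (?c * koszul_sign d ?l) * (ftr (a r) * trace_monomial a (p @ q) u)"
      unfolding val_def of_int_left_commute[of "ftr (a r)"] by (simp add: mult.assoc)
    also have "\<dots> = of_int (?c * koszul_sign d ?l * ?k) * trace_monomial a ws u"
      unfolding m by (simp add: mult.assoc)
    also have "\<dots> = val a d ws u" unfolding c val_def ..
    finally show ?thesis by simp
  qed
  ultimately show ?thesis by blast
qed

lemma display_delete_last:
  assumes D: "display S s \<sigma> ws u" and r: "r \<in> S" "\<sigma> r = s"
  shows "\<exists>u'. display (S - {r}) s (Transposition.transpose r (\<sigma> r) \<circ> \<sigma>) ws u' \<and>
    val a d ws u = of_int (koszul_sign d (sorted_list_of_set (S - {r}) @ [r])) * (val a d ws u' * a r)"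
proof -
  have "r \<notin> set (concat ws)"
  proof
    assume "r \<in> set (concat ws)"
    then obtain w where "w \<in> set ws" "r \<in> set w" by auto
    then have "s \<in> set w" using D cyclic_word_closed r unfolding display_def by metis
    then show False using D \<open>w \<in> set ws\<close> by (auto simp: display_def)
  qed
  then have "r \<in> set u" using D r by (auto simp: display_def)
  then obtain x y where u: "u = x @ r # y" by (metis split_list)
  have "y = []"
  proof (cases y)
    case (Cons b z)
    then have "\<sigma> r = b"
      using D u by (intro cyclic_word_next[of \<sigma> "u @ [s]" x r b "z @ [s]"]) (auto simp: display_def)
    then show ?thesis using D u Cons r by (auto simp: display_def)
  qed
  with u have u: "u = x @ [r]" by simp
  let ?l = "concat ws @ x"
  have dl: "distinct ?l" "set ?l = S - {r}" "r \<notin> S - {r}"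
    using D unfolding display_def u by auto
  have "display (S - {r}) s (Transposition.transpose r s \<circ> \<sigma>) ws x"
    unfolding display_def
  proof (intro conjI ballI)
    show "map (Transposition.transpose r s \<circ> \<sigma>) (x @ [s]) = rotate1 (x @ [s])"
      using D r by (intro cyclic_word_delete) (auto simp: display_def u)
    fix w assume "w \<in> set ws"
    then show "map (Transposition.transpose r s \<circ> \<sigma>) w = rotate1 w"
      using D by (intro cyclic_word_other) (auto simp: display_def u)
  qed (use D dl in \<open>auto simp: display_def\<close>)
  moreover have "val a d ws u = of_int (koszul_sign d (sorted_list_of_set (S - {r}) @ [r])) * (val a d ws x * a r)"
    using koszul_sign_snoc_sorted[OF dl, of d] unfolding val_def trace_monomial_def u by (simp add: mult.commute flip: mult.assoc of_int_mult)
  ultimately show ?thesis using r by auto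
qed

lemma display_delete_merge:
  assumes D: "display S s \<sigma> ws u" and r: "r \<in> S" "\<sigma> r = q" "q \<noteq> r" "q \<in> S" and h: "homog a d S"
  shows "\<exists>ws' u'. display (S - {r}) s (Transposition.transpose r (\<sigma> r) \<circ> \<sigma>) ws' u' \<and>
    val a d ws u = of_int (koszul_sign d (expand r q (sorted_list_of_set (S - {r})))) *
      val (merge_arg r q a) (merge_deg r q d) ws' u'"
proof (cases "r \<in> set u")
  case True
  then obtain x y where u: "u = x @ r # y" by (metis split_list)
  have "y \<noteq> []"
  proof
    assume "y = []"
    then have "\<sigma> r = s"
      using D u by (intro cyclic_word_next[of \<sigma> "u @ [s]" x r s "[]"]) (auto simp: display_def)
    then show False using D r by (auto simp: display_def)
  qed
  then obtain b z where y: "y = b # z" by (meson neq_Nil_conv)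
  have "\<sigma> r = b"
    using D u y by (intro cyclic_word_next[of \<sigma> "u @ [s]" x r b "z @ [s]"]) (auto simp: display_def)
  then have u: "u = x @ r # q # z" using u y r by simp
  let ?u = "x @ q # z" and ?d = "merge_deg r q d" and ?a = "merge_arg r q a"
  let ?l = "concat ws @ ?u"
  have dl: "distinct ?l" "set ?l = S - {r}" "r \<notin> S - {r}"
    using D unfolding display_def u by auto
  have "display (S - {r}) s (Transposition.transpose r q \<circ> \<sigma>) ws ?u"
    unfolding display_def
  proof (intro conjI ballI)
    have "map (Transposition.transpose r q \<circ> \<sigma>) (x @ q # (z @ [s])) = rotate1 (x @ q # (z @ [s]))"
      using D r by (intro cyclic_word_delete) (auto simp: display_def u)
    then show "map (Transposition.transpose r q \<circ> \<sigma>) (?u @ [s]) = rotate1 (?u @ [s])" by simp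
    fix w assume "w \<in> set ws"
    then show "map (Transposition.transpose r q \<circ> \<sigma>) w = rotate1 w"
      using D by (intro cyclic_word_other) (auto simp: display_def u)
  qed (use D dl in \<open>auto simp: display_def\<close>)
  moreover have "val a d ws u = of_int (koszul_sign d (expand r q (sorted_list_of_set (S - {r})))) * val ?a ?d ws ?u"
  proof -
    have "q \<notin> set (concat ws @ x @ z)" using dl by auto
    then have e: "expand r q ?l = concat ws @ u"
      by (simp add: u expand_append expand_Cons expand_notin)
    have "trace_monomial ?a ws ?u = trace_monomial a ws u"
      using \<open>q \<notin> _\<close> unfolding trace_monomial_def u
      by (simp add: prod_merge traces_merge mult.assoc) (simp add: merge_arg_def mult.assoc)
    then show ?thesis
      using koszul_sign_expand[OF dl, of d q] unfolding val_def e by (simp add: mult.commute flip: mult.assoc of_int_mult)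
  qed
  ultimately show ?thesis using r by blast
next
  case False
  then obtain w where w: "w \<in> set ws" "r \<in> set w" using D r by (auto simp: display_def)
  obtain p p' where ws: "ws = p @ w # p'" using w(1) by (metis split_list)
  have cw: "map \<sigma> w = rotate1 w" using D w by (auto simp: display_def)
  obtain x y where xy: "w = x @ y" "y @ x = r # \<sigma> r # tl (tl (y @ x))"
    using cyclic_word_split[OF cw w(2)] r by metis
  define z where "z = tl (tl (y @ x))"
  have yx: "y @ x = r # q # z" using xy r z_def by simp
  have D': "display S s \<sigma> (p @ (r # q # z) # p') u"
    using display_rotate[of S s \<sigma> p x y p' u] D ws xy yx by simp
  have "val a d ws u = val a d (p @ (y @ x) # p') u"
    unfolding ws xy(1) using D h by (intro val_rotate) (auto simp: display_def ws xy(1) homog_def)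
  then have v: "val a d ws u = val a d (p @ (r # q # z) # p') u" using yx by simp
  let ?ws = "p @ (q # z) # p'" and ?d = "merge_deg r q d" and ?a = "merge_arg r q a"
  let ?l = "concat ?ws @ u"
  have dl: "distinct ?l" "set ?l = S - {r}" "r \<notin> S - {r}"
    using D' unfolding display_def by auto
  have "display (S - {r}) s (Transposition.transpose r q \<circ> \<sigma>) ?ws u"
    unfolding display_def
  proof (intro conjI ballI)
    show "map (Transposition.transpose r q \<circ> \<sigma>) (u @ [s]) = rotate1 (u @ [s])"
      using D' by (intro cyclic_word_other) (auto simp: display_def)
    fix w assume w: "w \<in> set ?ws"
    show "map (Transposition.transpose r q \<circ> \<sigma>) w = rotate1 w"
    proof (cases "w = q # z")
      case True
      then show ?thesis
        using cyclic_word_delete[of \<sigma> "[]" r q z] D' by (auto simp: display_def)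
    next
      case False
      then have "w \<in> set p \<union> set p'" using w by auto
      then show ?thesis
        using D' by (intro cyclic_word_other) (auto simp: display_def)
    qed
  qed (use D' dl in \<open>auto simp: display_def\<close>)
  moreover have "val a d ws u = of_int (koszul_sign d (expand r q (sorted_list_of_set (S - {r})))) * val ?a ?d ?ws u"
  proof -
    have qn: "q \<notin> set (concat p @ z @ concat p' @ u)" using dl by auto
    then have e: "expand r q ?l = concat (p @ (r # q # z) # p') @ u"
      by (simp add: expand_append expand_Cons expand_notin)
    have "trace_monomial ?a ?ws u = trace_monomial a (p @ (r # q # z) # p') u"
      using qn unfolding trace_monomial_def
      by (simp add: prod_merge traces_merge mult.assoc) (simp add: merge_arg_def mult.assoc)
    then show ?thesis
      using koszul_sign_expand[OF dl, of d q] unfolding v unfolding val_def e by (simp add: mult.commute flip: mult.assoc of_int_mult)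
  qed
  ultimately show ?thesis using r by blast
qed

lemma merge_homog: "homog a d S \<Longrightarrow> r \<in> S \<Longrightarrow> q \<in> S \<Longrightarrow> homog (merge_arg r q a) (merge_deg r q d) (S - {r})"
  by (auto simp: homog_def merge_arg_def merge_deg_def intro: ftgrade_mult simp del: add_bit_eq_xor)

lemma display_image: "display S s \<sigma> ws u \<Longrightarrow> r \<in> S \<Longrightarrow> \<sigma> r \<in> insert s S"
proof -
  assume D: "display S s \<sigma> ws u" and r: "r \<in> S"
  then consider w where "w \<in> set ws" "r \<in> set w" | "r \<in> set (u @ [s])" by (auto simp: display_def)
  then show ?thesis
  proof cases
    case 1
    then have "\<sigma> r \<in> set w" using D cyclic_word_closed[of \<sigma> w r] by (auto simp: display_def)
    then show ?thesis using D 1 by (auto simp: display_def)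
  next
    case 2
    then have "\<sigma> r \<in> set (u @ [s])" using D cyclic_word_closed[of \<sigma> "u @ [s]" r] unfolding display_def by blast
    then show ?thesis using D by (auto simp: display_def)
  qed
qed

text \<open>
  Deleting the same index from two displays of a permutation yields two displays of one smaller
  permutation, and changes both values by the same operation.
\<close>

lemma val_unique:
  assumes "display S s \<sigma> ws u" "display S s \<sigma> ws' u'" "homog a d S"
  shows "val a d ws u = val a d ws' u'"
  using assms
proof (induction "card S" arbitrary: S \<sigma> ws u ws' u' a d)
  case 0
  have "finite S" using 0(2) by (auto simp: display_def)
  with 0 have "S = {}" by simp
  then have "u = []" "u' = []" "ws = []" "ws' = []"
    using 0(2,3) unfolding display_def by (cases ws; cases ws'; force)+
  then show ?case by simp
next
  case (Suc n)
  then obtain r where r: "r \<in> S" by (metis card.empty ex_in_conv nat.distinct(1))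
  have n: "n = card (S - {r})" using Suc r by (metis card_Suc_Diff1 card_ge_0_finite nat.inject zero_less_Suc)
  consider "\<sigma> r = r" | "\<sigma> r = s" | "\<sigma> r \<noteq> r" "\<sigma> r \<in> S"
    using display_image[OF Suc.prems(1) r] by auto
  then show ?case
  proof cases
    case 1
    obtain vs where v: "display (S - {r}) s \<sigma> vs u"
      "val a d ws u = of_int (koszul_sign d (r # sorted_list_of_set (S - {r}))) * (ftr (a r) * val a d vs u)"
      using display_delete_fixed[OF Suc.prems(1) r 1 Suc.prems(3)] by blast
    obtain vs' where v': "display (S - {r}) s \<sigma> vs' u'"
      "val a d ws' u' = of_int (koszul_sign d (r # sorted_list_of_set (S - {r}))) * (ftr (a r) * val a d vs' u')"
      using display_delete_fixed[OF Suc.prems(2) r 1 Suc.prems(3)] by blast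
    have "val a d vs u = val a d vs' u'"
      by (rule Suc.hyps(1)[OF n v(1) v'(1) homog_subset[OF Suc.prems(3)]]) auto
    then show ?thesis unfolding v v' by simp
  next
    case 2
    let ?t = "Transposition.transpose r (\<sigma> r) \<circ> \<sigma>"
    obtain v where v: "display (S - {r}) s ?t ws v"
      "val a d ws u = of_int (koszul_sign d (sorted_list_of_set (S - {r}) @ [r])) * (val a d ws v * a r)"
      using display_delete_last[OF Suc.prems(1) r 2, of a d] by blast
    obtain v' where v': "display (S - {r}) s ?t ws' v'"
      "val a d ws' u' = of_int (koszul_sign d (sorted_list_of_set (S - {r}) @ [r])) * (val a d ws' v' * a r)"
      using display_delete_last[OF Suc.prems(2) r 2, of a d] by blast
    have "val a d ws v = val a d ws' v'"
      by (rule Suc.hyps(1)[OF n v(1) v'(1) homog_subset[OF Suc.prems(3)]]) auto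
    then show ?thesis unfolding v v' by simp
  next
    case 3
    let ?t = "Transposition.transpose r (\<sigma> r) \<circ> \<sigma>" and ?a = "merge_arg r (\<sigma> r) a"
      and ?d = "merge_deg r (\<sigma> r) d" and ?c = "koszul_sign d (expand r (\<sigma> r) (sorted_list_of_set (S - {r})))"
    obtain vs v where v: "display (S - {r}) s ?t vs v" "val a d ws u = of_int ?c * val ?a ?d vs v"
      using display_delete_merge[OF Suc.prems(1) r refl 3 Suc.prems(3)] by blast
    obtain vs' v' where v': "display (S - {r}) s ?t vs' v'" "val a d ws' u' = of_int ?c * val ?a ?d vs' v'"
      using display_delete_merge[OF Suc.prems(2) r refl 3 Suc.prems(3)] by blast
    have "val ?a ?d vs v = val ?a ?d vs' v'"
      by (rule Suc.hyps(1)[OF n v(1) v'(1) merge_homog[OF Suc.prems(3) r 3(2)]])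
    then show ?thesis unfolding v v' by simp
  qed
qed

section \<open>The trace monomial of a permutation with a hole\<close>

lemma ftconst_of_int: "ftconst (of_int k) = of_int k"
proof -
  have "ftconst (of_nat m) = of_nat m" for m
    by (induction m) (simp_all add: ftconst_add)
  then show ?thesis by (cases k rule: int_cases2) (auto simp: ftconst_minus)
qed

lemma ftr_of_int: "ftr (of_int k * a) = of_int k * ftr a"
  using ft.tr_scale[of "of_int k" a] by (simp add: ftconst_of_int)

lemma traces_central:
  assumes "homog a d (set (concat ws))" "b \<in> ftgrade p"
  shows "b * traces a ws =
    of_int (swap_sign p (degsum d (concat ws))) * (traces a ws * b)"
  using assms(1)
proof (induction ws)
  case (Cons w ws)
  let ?t = "ftr (word a w)" and ?T = "traces a ws"
  let ?k = "swap_sign p (degsum d w)" and ?k' = "swap_sign p (degsum d (concat ws))"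
  have t: "?t * b = of_int ?k * (b * ?t)"
    unfolding swap_sign_commute[of p] using Cons.prems assms(2) by (intro ftr_central homog_word) (auto simp: homog_def)
  have "of_int ?k * (?t * b) = b * ?t"
    unfolding t by (simp add: swap_sign_sq flip: mult.assoc of_int_mult)
  then have "b * (?t * ?T) = of_int ?k * (?t * (b * ?T))"
    by (simp flip: mult.assoc)
  also have "b * ?T = of_int ?k' * (?T * b)"
    using Cons by (auto simp: homog_def)
  also have "of_int ?k * (?t * (of_int ?k' * (?T * b))) = of_int (?k * ?k') * (?t * ?T * b)"
    unfolding of_int_left_commute[of ?t] by (simp add: mult.assoc)
  finally show ?case by (simp add: swap_sign_add_right del: add_bit_eq_xor)
qed simp

lemma display_map:
  assumes D: "display S s \<sigma> ws u" and inj: "inj_on g (insert s S)"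
    and \<sigma>: "\<And>i. i \<in> insert s S \<Longrightarrow> \<sigma>' (g i) = g (\<sigma> i)"
  shows "display (g ` S) (g s) \<sigma>' (map (map g) ws) (map g u)"
proof -
  have c: "concat (map (map g) ws) @ map g u = map g (concat ws @ u)" by (simp add: map_concat)
  have w: "map \<sigma>' (map g w) = rotate1 (map g w)" if "map \<sigma> w = rotate1 w" "set w \<subseteq> insert s S" for w
  proof -
    have "map \<sigma>' (map g w) = map g (map \<sigma> w)" 
      unfolding map_map o_def using that(2) \<sigma> by (intro map_cong) auto
    then show ?thesis unfolding that(1) by (simp only: rotate1_map)
  qed
  have "map \<sigma>' (map g (u @ [s])) = rotate1 (map g (u @ [s]))"
    using D by (intro w) (auto simp: display_def)
  moreover have "map \<sigma>' (map g w) = rotate1 (map g w)" if "w \<in> set ws" for w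
    using D that by (intro w) (auto simp: display_def)
  moreover have "distinct (map g (concat ws @ u))"
    unfolding distinct_map using D inj by (auto simp: display_def inj_on_insert)
  moreover have "set (map g (concat ws @ u)) = g ` S" using D unfolding display_def set_map by simp
  moreover have "g s \<notin> g ` S" using D inj unfolding display_def inj_on_def by blast
  ultimately show ?thesis
    using D unfolding display_def c by auto
qed

text \<open>
  A bijection of \<open>insert s S\<close> with an initial segment that sends \<open>s\<close> to the last index reduces this to
  the cycle decomposition with a prescribed last element.
\<close>

lemma display_exists:
  assumes "finite S" "s \<notin> S" "\<sigma> permutes insert s S"
  shows "\<exists>ws u. display S s \<sigma> ws u"
proof -
  let ?m = "card S"
  obtain h where h: "bij_betw h {..<?m} S" using assms(1) ex_bij_betw_nat_finite by (metis atLeast0LessThan)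
  define g where "g = h(?m := s)"
  have g: "bij_betw g {..<Suc ?m} (insert s S)"
  proof -
    have "bij_betw g {..<?m} S" using h by (rule bij_betw_cong[THEN iffD1, rotated]) (auto simp: g_def)
    then have "bij_betw g ({..<?m} \<union> {?m}) (S \<union> {s})"
      by (rule bij_betw_combine) (use assms in \<open>auto simp: g_def bij_betw_def\<close>)
    then show ?thesis by (simp add: lessThan_Suc Un_commute)
  qed
  let ?A = "insert s S"
  let ?k = "inv_into {..<Suc ?m} g"
  have k: "bij_betw ?k ?A {..<Suc ?m}" using g by (rule bij_betw_inv_into)
  have kg: "?k (g i) = i" if "i < Suc ?m" for i using that g by (simp add: bij_betw_inv_into_left)
  have gk: "g (?k i) = i" if "i \<in> ?A" for i using that g by (simp add: bij_betw_inv_into_right)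
  define \<tau> where "\<tau> = map_permutation ?A ?k \<sigma>"
  have \<tau>: "\<tau> permutes {..<Suc ?m}" unfolding \<tau>_def using map_permutation_permutes[OF k assms(3)] .
  obtain ws u where c: "cycle_form (Suc ?m) \<tau> (ws @ [u @ [?m]])" using cycle_form_last_exists[OF \<tau>, of ?m] by auto
  have D: "display {..<?m} ?m \<tau> ws u"
  proof -
    have d: "distinct (concat ws @ u @ [?m])" "set (concat ws @ u @ [?m]) = {..<Suc ?m}"
      using c by (auto simp: cycle_form_def)
    then have "set (concat ws @ u) = {..<Suc ?m} - {?m}" by auto
    also have "\<dots> = {..<?m}" by auto
    finally show ?thesis using c d unfolding display_def cycle_form_def by auto
  qed
  have "display (g ` {..<?m}) (g ?m) \<sigma> (map (map g) ws) (map g u)"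
  proof (rule display_map[OF D])
    show "inj_on g (insert ?m {..<?m})" using g by (simp add: bij_betw_def lessThan_Suc)
    fix i assume "i \<in> insert ?m {..<?m}"
    then have i: "i < Suc ?m" by auto
    then have gi: "g i \<in> ?A" using g by (auto simp: bij_betw_def)
    then have "\<tau> (?k (g i)) = ?k (\<sigma> (g i))"
      unfolding \<tau>_def using k by (intro map_permutation_apply) (auto simp: bij_betw_def)
    then have "g (\<tau> i) = g (?k (\<sigma> (g i)))" using kg i by simp
    moreover have "\<sigma> (g i) \<in> ?A" using gi permutes_in_image[OF assms(3)] by blast
    ultimately show "\<sigma> (g i) = g (\<tau> i)" using gk by simp
  qed
  moreover have "g ` {..<?m} = S" using h by (auto simp: g_def bij_betw_def)
  moreover have "g ?m = s" by (simp add: g_def)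
  ultimately show ?thesis by auto
qed

text \<open>
  By \<open>val_unique\<close> the choice of the display is immaterial.
\<close>

definition psi :: "nat set \<Rightarrow> nat \<Rightarrow> (nat \<Rightarrow> nat) \<Rightarrow> (nat \<Rightarrow> ft) \<Rightarrow> (nat \<Rightarrow> bit) \<Rightarrow> ft" where
  "psi S s \<sigma> a d = (case SOME (ws, u). display S s \<sigma> ws u of (ws, u) \<Rightarrow> val a d ws u)"

lemma psi_eq:
  assumes "display S s \<sigma> ws u" "homog a d S"
  shows "psi S s \<sigma> a d = val a d ws u"
proof -
  obtain ws' u' where *: "(SOME (ws, u). display S s \<sigma> ws u) = (ws', u')" by fastforce
  have "case (SOME (ws, u). display S s \<sigma> ws u) of (ws, u) \<Rightarrow> display S s \<sigma> ws u"
    by (rule someI[of _ "(ws, u)"]) (use assms in simp)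
  then have "display S s \<sigma> ws' u'" unfolding * by simp
  from val_unique[OF this assms] show ?thesis unfolding psi_def * by simp
qed

lemma val_cong:
  "(\<And>i. i \<in> set (concat ws @ u) \<Longrightarrow> a i = b i) \<Longrightarrow> (\<And>i. i \<in> set (concat ws @ u) \<Longrightarrow> d i = d' i) \<Longrightarrow>
    val a d ws u = val b d' ws u"
  unfolding val_def using trace_monomial_cong[of ws u a b] koszul_sign_cong[of "concat ws @ u" d d'] by simp

definition perm_hole :: "nat set \<Rightarrow> nat \<Rightarrow> (nat \<Rightarrow> nat) \<Rightarrow> bool" where
  "perm_hole S s \<sigma> \<longleftrightarrow> finite S \<and> s \<notin> S \<and> \<sigma> permutes insert s S"

lemma perm_holeE:
  assumes "perm_hole S s \<sigma>" obtains ws u where "display S s \<sigma> ws u"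
  using assms display_exists unfolding perm_hole_def by blast

lemma psi_cong:
  assumes "perm_hole S s \<sigma>" "homog a d S" "\<And>i. i \<in> S \<Longrightarrow> a i = b i" "\<And>i. i \<in> S \<Longrightarrow> d i = d' i"
  shows "psi S s \<sigma> a d = psi S s \<sigma> b d'"
proof -
  obtain ws u where D: "display S s \<sigma> ws u" using assms(1) by (rule perm_holeE)
  have "homog b d' S" using assms by (auto simp: homog_def)
  moreover have "val a d ws u = val b d' ws u"
    using D assms(3,4) by (intro val_cong) (auto simp: display_def)
  ultimately show ?thesis using D assms(2) by (simp add: psi_eq)
qed

lemma psi_delete_fixed:
  assumes "perm_hole S s \<sigma>" "r \<in> S" "\<sigma> r = r" "homog a d S"
  shows "psi S s \<sigma> a d = of_int (koszul_sign d (r # sorted_list_of_set (S - {r}))) * (ftr (a r) * psi (S - {r}) s \<sigma> a d)"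
proof -
  obtain ws u where D: "display S s \<sigma> ws u" using assms(1) by (rule perm_holeE)
  from display_delete_fixed[OF D assms(2,3,4)] obtain ws' where
    "display (S - {r}) s \<sigma> ws' u" "val a d ws u = of_int (koszul_sign d (r # sorted_list_of_set (S - {r}))) * (ftr (a r) * val a d ws' u)"
    by blast
  moreover have "homog a d (S - {r})" using assms(4) by (auto simp: homog_def)
  ultimately show ?thesis using D assms(4) by (simp add: psi_eq)
qed

lemma psi_delete_last:
  assumes "perm_hole S s \<sigma>" "r \<in> S" "\<sigma> r = s" "homog a d S"
  shows "psi S s \<sigma> a d = of_int (koszul_sign d (sorted_list_of_set (S - {r}) @ [r])) *
    (psi (S - {r}) s (Transposition.transpose r s \<circ> \<sigma>) a d * a r)"
proof -
  obtain ws u where D: "display S s \<sigma> ws u" using assms(1) by (rule perm_holeE)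
  from display_delete_last[OF D assms(2,3), of a d] obtain u' where
    "display (S - {r}) s (Transposition.transpose r s \<circ> \<sigma>) ws u'"
    "val a d ws u = of_int (koszul_sign d (sorted_list_of_set (S - {r}) @ [r])) * (val a d ws u' * a r)"
    unfolding assms(3) by blast
  moreover have "homog a d (S - {r})" using assms(4) by (auto simp: homog_def)
  ultimately show ?thesis using D assms(4) by (simp add: psi_eq)
qed

lemma psi_delete_merge:
  assumes "perm_hole S s \<sigma>" "r \<in> S" "\<sigma> r = q" "q \<noteq> r" "q \<in> S" "homog a d S"
  shows "psi S s \<sigma> a d = of_int (koszul_sign d (expand r q (sorted_list_of_set (S - {r})))) *
    psi (S - {r}) s (Transposition.transpose r q \<circ> \<sigma>) (merge_arg r q a) (merge_deg r q d)"
proof -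
  obtain ws u where D: "display S s \<sigma> ws u" using assms(1) by (rule perm_holeE)
  from display_delete_merge[OF D assms(2-6)] obtain ws' u' where
    "display (S - {r}) s (Transposition.transpose r q \<circ> \<sigma>) ws' u'"
    "val a d ws u = of_int (koszul_sign d (expand r q (sorted_list_of_set (S - {r})))) * val (merge_arg r q a) (merge_deg r q d) ws' u'"
    unfolding assms(3) by blast
  then show ?thesis using D assms(6) merge_homog[OF assms(6,2,5)] by (simp add: psi_eq)
qed

text \<open>
  The first letter \<open>a q\<close> of the open word is taken out, and its place becomes the hole.
\<close>

lemma psi_delete_hole:
  assumes "perm_hole S s \<sigma>" "\<sigma> s = q" "q \<in> S" "homog a d S"
  shows "psi S s \<sigma> a d = of_int (koszul_sign d (q # sorted_list_of_set (S - {q}))) *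
    (a q * psi (S - {q}) q (Transposition.transpose s q \<circ> \<sigma>) a d)"
proof -
  let ?\<tau> = "Transposition.transpose s q \<circ> \<sigma>"
  obtain ws u where D: "display S s \<sigma> ws u" using assms(1) by (rule perm_holeE)
  have "u \<noteq> []" using D assms by (auto simp: display_def)
  then obtain b v where u: "u = b # v" by (meson neq_Nil_conv)
  have m: "map \<sigma> ((b # v) @ [s]) = rotate1 ((b # v) @ [s])" using D u by (simp add: display_def)
  from arg_cong[OF m, of last] have "q = b" using assms(2) by simp
  then have u: "u = q # v" using u by simp
  let ?l = "concat ws @ v"
  have dl: "distinct ?l" "set ?l = S - {q}" "q \<notin> S - {q}"
    using D unfolding display_def u by auto
  have D': "display (S - {q}) q ?\<tau> ws v"
    unfolding display_def
  proof (intro conjI ballI)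
    have "map \<sigma> ([s] @ u) = rotate1 ([s] @ u)"
      by (rule cyclic_word_rotate) (use D in \<open>simp only: display_def\<close>)
    moreover have "distinct ([] @ s # q # v)" using D unfolding display_def u by auto
    ultimately have "map ?\<tau> ([] @ q # v) = rotate1 ([] @ q # v)"
      unfolding u by (intro cyclic_word_delete) simp_all
    then show "map ?\<tau> (v @ [q]) = rotate1 (v @ [q])"
      using cyclic_word_rotate[of ?\<tau> "[q]" v] by simp
    fix w assume "w \<in> set ws"
    then show "map ?\<tau> w = rotate1 w"
      using D by (intro cyclic_word_other) (auto simp: display_def u)
  next
    show "distinct (concat ws @ v)" "set (concat ws @ v) = S - {q}" "q \<notin> S - {q}" "[] \<notin> set ws"
      using dl D by (auto simp: display_def)
  qed
  let ?k = "swap_sign (d q) (degsum d (concat ws))" and ?c = "koszul_sign d (q # sorted_list_of_set (S - {q}))"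
  let ?T = "traces a ws"
  have k: "koszul_sign d (q # ?l) = ?k * koszul_sign d (concat ws @ u)"
    using koszul_sign_move[of "[]" q "concat ws" v d] dl u by auto
  have e: "koszul_sign d (q # ?l) = koszul_sign d ?l * ?c" by (rule koszul_sign_Cons_sorted[OF dl])
  have c: "?c * koszul_sign d ?l * ?k = koszul_sign d (concat ws @ u)"
    using e k swap_sign_sq[of "d q" "degsum d (concat ws)"] by algebra
  have q: "a q * ?T = of_int ?k * (?T * a q)"
    using D assms(3,4) by (intro traces_central) (auto simp: display_def homog_def)
  have "of_int ?c * (a q * val a d ws v) = of_int (?c * koszul_sign d ?l) * (a q * ?T * word a v)"
    unfolding val_def trace_monomial_def of_int_left_commute[of "a q"] by (simp add: mult.assoc)
  also have "\<dots> = of_int (?c * koszul_sign d ?l * ?k) * (?T * word a u)"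
    unfolding q u by (simp add: mult.assoc)
  also have "\<dots> = val a d ws u"
    unfolding c val_def trace_monomial_def ..
  finally show ?thesis
    using psi_eq[OF D assms(4)] psi_eq[OF D', of a d] assms(4) by (simp add: homog_def)
qed

text \<open>
  Filling the hole with a variable and taking the trace closes the open cycle; the permutation stays
  the same and now fixes a new hole \<open>s'\<close>.
\<close>

lemma psi_close:
  assumes "perm_hole S s \<sigma>" "s' \<notin> insert s S" "homog a d (insert s S)"
  shows "ftr (psi S s \<sigma> a d * a s) = of_int (koszul_sign d (sorted_list_of_set S @ [s])) * psi (insert s S) s' \<sigma> a d"
proof -
  obtain ws u where D: "display S s \<sigma> ws u" using assms(1) by (rule perm_holeE)
  have "\<sigma> s' = s'" using assms(1,2) permutes_not_in[of \<sigma> "insert s S" s'] unfolding perm_hole_def by blast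
  then have D': "display (insert s S) s' \<sigma> (ws @ [u @ [s]]) []"
    using D assms(2) unfolding display_def by (intro conjI) auto
  have l: "distinct (concat ws @ u)" "set (concat ws @ u) = S" "s \<notin> S"
    using D by (auto simp: display_def)
  have k: "koszul_sign d ((concat ws @ u) @ [s]) = koszul_sign d (concat ws @ u) * koszul_sign d (sorted_list_of_set S @ [s])"
    by (rule koszul_sign_snoc_sorted) (use l in auto)
  have "val a d ws u * a s = of_int (koszul_sign d (concat ws @ u)) * trace_monomial a ws (u @ [s])"
    unfolding val_def trace_monomial_def by (simp add: mult.assoc)
  then have "ftr (val a d ws u * a s) = of_int (koszul_sign d (concat ws @ u)) * trace_monomial a (ws @ [u @ [s]]) []"
    by (simp only: ftr_of_int ftr_trace_monomial)
  also have "\<dots> = of_int (koszul_sign d (sorted_list_of_set S @ [s])) * val a d (ws @ [u @ [s]]) []"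
  proof -
    have "koszul_sign d (concat ws @ u) = koszul_sign d (sorted_list_of_set S @ [s]) * koszul_sign d ((concat ws @ u) @ [s])"
      unfolding k using koszul_sign_sq[of d "sorted_list_of_set S @ [s]"] by algebra
    then have "of_int (koszul_sign d (concat ws @ u)) * x =
        of_int (koszul_sign d (sorted_list_of_set S @ [s])) * (of_int (koszul_sign d ((concat ws @ u) @ [s])) * x)" for x :: ft
      by (simp only: of_int_mult mult.assoc)
    then show ?thesis unfolding val_def by simp
  qed
  finally show ?thesis
    using psi_eq[OF D homog_subset[OF assms(3) subset_insertI]] psi_eq[OF D' assms(3)] by auto
qed

text \<open>
  Renaming indices preserves the monomial; only the order of the indices, hence the sign, changes, and
  this change is the same for all permutations.
\<close>

lemma psi_relabel:
  assumes "perm_hole S s \<sigma>" "inj_on g (insert s S)" "\<And>i. i \<in> insert s S \<Longrightarrow> \<sigma>' (g i) = g (\<sigma> i)"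
    and h: "homog a d (g ` S)"
  shows "psi (g ` S) (g s) \<sigma>' a d = of_int (koszul_sign d (map g (sorted_list_of_set S))) * psi S s \<sigma> (a \<circ> g) (d \<circ> g)"
proof -
  obtain ws u where D: "display S s \<sigma> ws u" using assms(1) by (rule perm_holeE)
  have D': "display (g ` S) (g s) \<sigma>' (map (map g) ws) (map g u)" by (rule display_map[OF D assms(2,3)])
  have h': "homog (a \<circ> g) (d \<circ> g) S" using h by (auto simp: homog_def)
  let ?l = "concat ws @ u"
  have l: "distinct ?l" "set ?l = S" using D by (auto simp: display_def)
  have "koszul_sign d (map g ?l) = of_int (koszul_sign (d \<circ> g) ?l) * koszul_sign d (map g (sorted_list_of_set S))"
  proof (rule koszul_swap_sorted[where F = "\<lambda>l. koszul_sign d (map g l)", OF _ l])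
    fix u v i j assume *: "distinct (u @ i # j # v)" "set (u @ i # j # v) = S"
    then have "i \<in> S" "j \<in> S" "i \<noteq> j" by auto
    then have "g i \<noteq> g j" using assms(2) by (auto simp: inj_on_def)
    then show "koszul_sign d (map g (u @ i # j # v)) = of_int (swap_sign ((d \<circ> g) i) ((d \<circ> g) j)) * koszul_sign d (map g (u @ j # i # v))"
      using koszul_sign_swap[of "g i" "g j" d "map g u" "map g v"] by simp
  qed
  then have k: "koszul_sign d (map g ?l) = koszul_sign d (map g (sorted_list_of_set S)) * koszul_sign (d \<circ> g) ?l" by simp
  have "trace_monomial a (map (map g) ws) (map g u) = trace_monomial (a \<circ> g) ws u"
    unfolding trace_monomial_def by (simp add: o_def)
  moreover have "concat (map (map g) ws) @ map g u = map g ?l" by (simp add: map_concat)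
  ultimately have "val a d (map (map g) ws) (map g u) = of_int (koszul_sign d (map g (sorted_list_of_set S))) * val (a \<circ> g) (d \<circ> g) ws u"
    unfolding val_def by (simp only: k of_int_mult mult.assoc)
  then show ?thesis using psi_eq[OF D' h] psi_eq[OF D h'] by simp
qed

section \<open>Substitutions and alternating sums\<close>

context
  fixes \<phi> assumes \<phi>: "substitution \<phi>"
begin

lemma substitution_simps:
  "\<phi> (a + b) = \<phi> a + \<phi> b" "\<phi> (a * b) = \<phi> a * \<phi> b" "\<phi> (ftconst c) = ftconst c" "\<phi> (ftr a) = ftr (\<phi> a)"
  "a \<in> ftgrade p \<Longrightarrow> \<phi> a \<in> ftgrade p"
  using \<phi> unfolding substitution_def trace_hom_def by blast+

lemma substitution_of_int: "\<phi> (of_int k) = of_int k" "\<phi> 0 = 0" "\<phi> 1 = 1"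
  using substitution_simps(3)[of "of_int k"] substitution_simps(3)[of 0] substitution_simps(3)[of 1]
  by (simp_all add: ftconst_of_int)

lemma substitution_sum: "\<phi> (\<Sum>i\<in>A. f i) = (\<Sum>i\<in>A. \<phi> (f i))"
  by (induction A rule: infinite_finite_induct) (auto simp: substitution_simps substitution_of_int)

lemma substitution_prod_list: "\<phi> (prod_list l) = prod_list (map \<phi> l)"
  by (induction l) (auto simp: substitution_simps substitution_of_int)

lemma substitution_trace_monomial: "\<phi> (trace_monomial a ws u) = trace_monomial (\<phi> \<circ> a) ws u"
  by (simp add: trace_monomial_def substitution_simps substitution_prod_list o_def)

lemma substitution_homog: "homog a d S \<Longrightarrow> homog (\<phi> \<circ> a) d S"
  by (simp add: homog_def substitution_simps)

lemma substitution_psi: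
  assumes "perm_hole S s \<sigma>" "homog a d S"
  shows "\<phi> (psi S s \<sigma> a d) = psi S s \<sigma> (\<phi> \<circ> a) d"
proof -
  obtain ws u where D: "display S s \<sigma> ws u" using assms(1) by (rule perm_holeE)
  show ?thesis
    using psi_eq[OF D assms(2)] psi_eq[OF D substitution_homog[OF assms(2)]]
    by (simp add: val_def substitution_simps substitution_of_int substitution_trace_monomial)
qed

end

definition subst :: "(nat \<Rightarrow> ft) \<Rightarrow> (nat \<Rightarrow> ft) \<Rightarrow> ft \<Rightarrow> ft" where
  "subst = ft_eval (*) ftconst ftr"

lemma subst:
  assumes "\<And>i. x i \<in> ftgrade 1" "\<And>i. y i \<in> ftgrade 0"
  shows "substitution (subst x y)" "subst x y (ftx i) = x i" "subst x y (fty i) = y i"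
  unfolding substitution_def subst_def using ft.ft_eval_simps[of x y] assms by auto

text \<open>
  With \<open>A = S\<close> these are the sums \<open>T_rel\<close>, with \<open>A = insert s S\<close> the sums \<open>CH\<close>, at arbitrary variables.
\<close>

definition alt_sum :: "nat set \<Rightarrow> nat set \<Rightarrow> nat \<Rightarrow> (nat \<Rightarrow> ft) \<Rightarrow> (nat \<Rightarrow> bit) \<Rightarrow> ft" where
  "alt_sum A S s a d = (\<Sum>\<pi> | \<pi> permutes A. of_int (sign \<pi>) * psi S s \<pi> a d)"

lemma perm_holeI: "finite S \<Longrightarrow> s \<notin> S \<Longrightarrow> A \<subseteq> insert s S \<Longrightarrow> \<pi> permutes A \<Longrightarrow> perm_hole S s \<pi>"
  unfolding perm_hole_def using permutes_subset by blast

lemma substitution_alt_sum: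
  assumes "substitution \<phi>" "finite S" "s \<notin> S" "A \<subseteq> insert s S" "homog a d S"
  shows "\<phi> (alt_sum A S s a d) = alt_sum A S s (\<phi> \<circ> a) d"
  unfolding alt_sum_def substitution_sum[OF assms(1)]
  using assms by (intro sum.cong) (auto simp: substitution_simps substitution_of_int substitution_psi perm_holeI)

lemma alt_sum_cong:
  assumes "finite S" "s \<notin> S" "A \<subseteq> insert s S" "homog a d S"
    "\<And>i. i \<in> S \<Longrightarrow> a i = b i" "\<And>i. i \<in> S \<Longrightarrow> d i = d' i"
  shows "alt_sum A S s a d = alt_sum A S s b d'"
  unfolding alt_sum_def
proof (rule sum.cong)
  fix \<pi> assume "\<pi> \<in> {\<pi>. \<pi> permutes A}"
  then have "perm_hole S s \<pi>" using assms(1-3) by (auto intro: perm_holeI)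
  from psi_cong[OF this assms(4-6)]
  show "of_int (sign \<pi>) * psi S s \<pi> a d = of_int (sign \<pi>) * psi S s \<pi> b d'" by simp
qed simp

lemma sum_permutations_relabel:
  assumes "bij_betw g A B"
  shows "(\<Sum>\<pi> | \<pi> permutes B. F \<pi>) = (\<Sum>\<pi> | \<pi> permutes A. F (map_permutation A g \<pi>))"
proof (rule sum.reindex_bij_witness[of _ "map_permutation A g" "map_permutation B (inv_into A g)"])
  fix \<pi> assume \<pi>: "\<pi> \<in> {\<pi>. \<pi> permutes B}"
  have b: "bij_betw (inv_into A g) B A" using assms by (rule bij_betw_inv_into)
  show "map_permutation A g (map_permutation B (inv_into A g) \<pi>) = \<pi>"
    using \<pi> assms by (intro map_permutation_compose_inv[OF b]) (auto simp: bij_betw_inv_into_right)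
  show "map_permutation B (inv_into A g) \<pi> \<in> {\<pi>. \<pi> permutes A}"
    using \<pi> map_permutation_permutes[OF b] by auto
  show "F (map_permutation A g (map_permutation B (inv_into A g) \<pi>)) = F \<pi>"
    by (simp add: \<open>map_permutation A g (map_permutation B (inv_into A g) \<pi>) = \<pi>\<close>)
next
  fix \<pi> assume \<pi>: "\<pi> \<in> {\<pi>. \<pi> permutes A}"
  show "map_permutation B (inv_into A g) (map_permutation A g \<pi>) = \<pi>"
    using \<pi> assms by (intro map_permutation_compose_inv[OF assms]) (auto simp: bij_betw_inv_into_left)
  show "map_permutation A g \<pi> \<in> {\<pi>. \<pi> permutes B}"
    using \<pi> map_permutation_permutes[OF assms] by auto
qed

lemma alt_sum_relabel:
  assumes "finite S" "s \<notin> S" "A \<subseteq> insert s S" and inj: "inj_on g (insert s S)" and h: "homog a d (g ` S)"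
  shows "alt_sum (g ` A) (g ` S) (g s) a d = of_int (koszul_sign d (map g (sorted_list_of_set S))) * alt_sum A S s (a \<circ> g) (d \<circ> g)"
proof -
  have injA: "inj_on g A" using inj assms(3) by (rule inj_on_subset)
  have fA: "finite A" using assms(1,3) by (meson finite.insertI finite_subset)
  have psi: "psi (g ` S) (g s) (map_permutation A g \<pi>) a d =
      of_int (koszul_sign d (map g (sorted_list_of_set S))) * psi S s \<pi> (a \<circ> g) (d \<circ> g)" if \<pi>: "\<pi> permutes A" for \<pi>
  proof (rule psi_relabel[OF _ inj _ h])
    show "perm_hole S s \<pi>" using assms(1-3) \<pi> by (rule perm_holeI)
    fix i assume i: "i \<in> insert s S"
    show "map_permutation A g \<pi> (g i) = g (\<pi> i)"
    proof (cases "i \<in> A")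
      case True
      then show ?thesis by (rule map_permutation_apply[OF injA])
    next
      case False
      then have "g i \<notin> g ` A" using i inj assms(3) by (auto simp: inj_on_def)
      moreover have "map_permutation A g \<pi> permutes g ` A"
        using \<pi> injA by (intro map_permutation_permutes) (auto simp: bij_betw_def)
      ultimately show ?thesis using False \<pi> permutes_not_in by metis
    qed
  qed
  have "alt_sum (g ` A) (g ` S) (g s) a d = (\<Sum>\<pi> | \<pi> permutes A.
      of_int (sign (map_permutation A g \<pi>)) * psi (g ` S) (g s) (map_permutation A g \<pi>) a d)"
    unfolding alt_sum_def using injA by (intro sum_permutations_relabel) (auto simp: bij_betw_def)
  also have "\<dots> = (\<Sum>\<pi> | \<pi> permutes A. of_int (koszul_sign d (map g (sorted_list_of_set S))) *
      (of_int (sign \<pi>) * psi S s \<pi> (a \<circ> g) (d \<circ> g)))"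
    by (intro sum.cong) (auto simp: psi sign_map_permutation[OF injA _ fA]
        of_int_left_commute[of "of_int (sign _)" "koszul_sign d (map g (sorted_list_of_set S))"])
  finally show ?thesis by (simp add: alt_sum_def sum_distrib_left)
qed

lemma parity_sort:
  fixes S :: "nat set" and d :: "nat \<Rightarrow> bit"
  assumes "finite S"
  shows "\<exists>g e. e \<le> card S \<and> bij_betw g {..<card S} S \<and> (\<forall>i<card S. d (g i) = dpar e i)"
proof -
  have f: "finite {i\<in>S. d i = 0}" "finite {i\<in>S. d i = 1}" using assms by auto
  obtain p where p: "set p = {i\<in>S. d i = 0}" "distinct p" using finite_distinct_list[OF f(1)] by blast
  obtain q where q: "set q = {i\<in>S. d i = 1}" "distinct q" using finite_distinct_list[OF f(2)] by blast
  have "d i = 0 \<or> d i = 1" for i by (cases "d i") auto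
  then have s: "set (p @ q) = S" unfolding set_append p q by blast
  have dist: "distinct (p @ q)" using p q by auto
  have len: "length (p @ q) = card S" unfolding s[symmetric] by (rule distinct_card[OF dist, symmetric])
  have "bij_betw (nth (p @ q)) {..<card S} S" 
    by (rule bij_betw_nth[OF dist]) (simp_all only: len s)
  moreover have "d ((p @ q) ! i) = dpar (length p) i" if "i < card S" for i
  proof (cases "i < length p")
    case True
    then have "(p @ q) ! i \<in> set p" by (simp add: nth_append)
    then have "d ((p @ q) ! i) = 0" unfolding p by blast
    then show ?thesis using True by (simp add: dpar_def)
  next
    case False
    then have "(p @ q) ! i \<in> set q" using that len by (simp add: nth_append)
    then have "d ((p @ q) ! i) = 1" unfolding q by blast
    then show ?thesis using False by (simp add: dpar_def)
  qed
  moreover have "length p \<le> card S" using len by simp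
  ultimately show ?thesis by blast
qed

lemma zvar_homog: "homog (zvar e) (dpar e) S"
  by (auto simp: homog_def zvar_def dpar_def ftgrade_x ftgrade_y)

lemma val_zvar:
  assumes "distinct (concat ws @ u)"
  shows "val (zvar e) (dpar e) ws u = of_int (fermionic_sign e (concat ws @ u)) *
     prod_list (map (\<lambda>w. ftr (zword e w)) ws) * zword e u"
  unfolding val_def trace_monomial_def zword_def using fermionic_sign_koszul_sign[OF assms, of e] by (simp add: mult.assoc)

lemma CH_eq_alt_sum:
  assumes "e + f = Suc n"
  shows "CH e f = alt_sum {..<Suc n} {..<n} n (zvar e) (dpar e)"
  unfolding CH_def alt_sum_def assms
proof (intro sum.cong refl arg_cong2[of _ _ _ _ "(*)"])
  fix \<sigma> assume "\<sigma> \<in> {\<sigma>. \<sigma> permutes {..<Suc n}}"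
  then have \<sigma>: "\<sigma> permutes {..<Suc n}" by simp
  obtain vs v where v: "cycle_form (Suc n) \<sigma> (vs @ [v @ [n]])" using cycle_form_last_exists[OF \<sigma>, of n] by auto
  obtain ws u where *: "(SOME (ws, u). cycle_form (e + f) \<sigma> (ws @ [u @ [e + f - 1]])) = (ws, u)" by fastforce
  have "case (SOME (ws, u). cycle_form (e + f) \<sigma> (ws @ [u @ [e + f - 1]])) of (ws, u) \<Rightarrow>
     cycle_form (e + f) \<sigma> (ws @ [u @ [e + f - 1]])"
    by (rule someI[of _ "(vs, v)"]) (use v assms in simp)
  then have c: "cycle_form (Suc n) \<sigma> (ws @ [u @ [n]])" unfolding * using assms by simp
  have d: "distinct (concat ws @ u @ [n])" "set (concat ws @ u @ [n]) = {..<Suc n}"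
    using c by (auto simp: cycle_form_def)
  then have "set (concat ws @ u) = {..<Suc n} - {n}" by auto
  also have "\<dots> = {..<n}" by auto
  finally have D: "display {..<n} n \<sigma> ws u" using c d unfolding display_def cycle_form_def by auto
  then have "distinct (concat ws @ u)" by (simp add: display_def)
  then show "Psi e f \<sigma> = psi {..<n} n \<sigma> (zvar e) (dpar e)"
    unfolding psi_eq[OF D zvar_homog] Psi_def * Let_def by (simp add: val_zvar)
qed

lemma T_rel_eq_alt_sum:
  assumes "m \<ge> e + f"
  shows "T_rel e f = alt_sum {..<e + f} {..<e + f} m (zvar e) (dpar e)"
  unfolding T_rel_def alt_sum_def
proof (intro sum.cong refl arg_cong2[of _ _ _ _ "(*)"])
  fix \<sigma> assume "\<sigma> \<in> {\<sigma>. \<sigma> permutes {..<e + f}}"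
  then have \<sigma>: "\<sigma> permutes {..<e + f}" by simp
  define ws where "ws = (SOME ws. cycle_form (e + f) \<sigma> ws)"
  have c: "cycle_form (e + f) \<sigma> ws" unfolding ws_def using cycle_form_exists[OF \<sigma>] by (rule someI_ex)
  have "\<sigma> m = m" using \<sigma> assms by (auto simp: permutes_def)
  then have D: "display {..<e + f} m \<sigma> ws []" using c assms by (auto simp: display_def cycle_form_def)
  then have "distinct (concat ws @ [])" by (simp add: display_def)
  from val_zvar[OF this, of e] show "Phi e f \<sigma> = psi {..<e + f} m \<sigma> (zvar e) (dpar e)"
    unfolding psi_eq[OF D zvar_homog] Phi_def ws_def[symmetric] Let_def by (simp add: zword_def)
qed

lemma substitution_zvar:
  assumes "e \<le> n" "\<And>i. i < n \<Longrightarrow> b i \<in> ftgrade (dpar e i)"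
  shows "\<exists>\<phi>. substitution \<phi> \<and> (\<forall>i<n. \<phi> (zvar e i) = b i)"
proof -
  let ?x = "\<lambda>j. if e + j < n then b (e + j) else 0" and ?y = "\<lambda>i. if i < e then b i else 0"
  have x: "?x j \<in> ftgrade 1" for j using assms(2)[of "e + j"] by (auto simp: dpar_def ftgrade_zero)
  have y: "?y i \<in> ftgrade 0" for i using assms(1) assms(2)[of i] by (auto simp: dpar_def ftgrade_zero)
  have "subst ?x ?y (zvar e i) = b i" if "i < n" for i
    using that subst(2)[of ?x ?y "i - e", OF x y] subst(3)[of ?x ?y i, OF x y] by (auto simp: zvar_def)
  then show ?thesis using subst(1)[of ?x ?y, OF x y] by blast
qed

text \<open>
  The definitions of \<open>T_rel\<close> and \<open>CH\<close> list the even variables before the odd ones.  Relabelling the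
  indices achieves this for any family of homogeneous elements, at the expense of a sign, and then the
  elements can be substituted for the variables.  The hole goes to the last index, so one relabelling
  serves both kinds of sums.
\<close>

lemma alternating_parity_sorted:
  assumes "finite S" "s \<notin> S" "card S = m" "homog a d S"
  shows "\<exists>\<phi> e k. substitution \<phi> \<and> e \<le> m \<and>
    alt_sum S S s a d = of_int k * \<phi> (alt_sum {..<m} {..<m} m (zvar e) (dpar e)) \<and>
    alt_sum (insert s S) S s a d = of_int k * \<phi> (alt_sum {..<Suc m} {..<m} m (zvar e) (dpar e))"
proof -
  obtain g0 e where g0: "e \<le> m" "bij_betw g0 {..<m} S" "\<And>i. i < m \<Longrightarrow> d (g0 i) = dpar e i"
    using parity_sort[OF assms(1), of d] assms(3) by blast
  define g where "g = g0(m := s)"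
  have im: "g ` {..<m} = S" using g0(2) by (auto simp: g_def bij_betw_def)
  have gs: "g m = s" by (simp add: g_def)
  then have im': "g ` {..<Suc m} = insert s S" using im by (simp add: lessThan_Suc)
  have inj: "inj_on g (insert m {..<m})"
    using g0(2) assms(2) by (auto simp: g_def bij_betw_def inj_on_def)
  have gd: "d (g i) = dpar e i" if "i < m" for i using that g0(3) by (simp add: g_def)
  have b: "a (g i) \<in> ftgrade (dpar e i)" if "i < m" for i
  proof -
    have "g i \<in> S" using that im by auto
    then show ?thesis using assms(4) gd[OF that] by (auto simp: homog_def)
  qed
  obtain \<phi> where \<phi>: "substitution \<phi>" "\<And>i. i < m \<Longrightarrow> \<phi> (zvar e i) = a (g i)"
    using substitution_zvar[of e m "a \<circ> g"] g0(1) b by auto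
  have "alt_sum (g ` A) S s a d = of_int (koszul_sign d (map g (sorted_list_of_set {..<m}))) * \<phi> (alt_sum A {..<m} m (zvar e) (dpar e))"
    if A: "A \<subseteq> insert m {..<m}" for A
  proof -
    have "alt_sum (g ` A) S s a d = of_int (koszul_sign d (map g (sorted_list_of_set {..<m}))) * alt_sum A {..<m} m (a \<circ> g) (d \<circ> g)"
      using alt_sum_relabel[of "{..<m}" m A g a d] inj assms(4) A unfolding im gs by simp
    also have "alt_sum A {..<m} m (a \<circ> g) (d \<circ> g) = alt_sum A {..<m} m (\<phi> \<circ> zvar e) (dpar e)"
      using b gd \<phi>(2) A by (intro alt_sum_cong) (auto simp: homog_def)
    also have "\<dots> = \<phi> (alt_sum A {..<m} m (zvar e) (dpar e))"
      using A by (intro substitution_alt_sum[symmetric] \<phi> zvar_homog) auto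
    finally show ?thesis .
  qed
  from this[of "{..<m}"] this[of "{..<Suc m}"] show ?thesis
    using \<phi>(1) g0(1) unfolding im im' by (auto simp: lessThan_Suc)
qed

lemma alternating_CH:
  assumes "finite S" "s \<notin> S" "card S = n" "homog a d S"
  shows "\<exists>\<phi> e f k. substitution \<phi> \<and> e + f = n + 1 \<and> 1 \<le> f \<and> alt_sum (insert s S) S s a d = of_int k * \<phi> (CH e f)"
proof -
  obtain \<phi> e k where *: "substitution \<phi>" "e \<le> n"
    "alt_sum (insert s S) S s a d = of_int k * \<phi> (alt_sum {..<Suc n} {..<n} n (zvar e) (dpar e))"
    using alternating_parity_sorted[OF assms] by blast
  then have "alt_sum (insert s S) S s a d = of_int k * \<phi> (CH e (Suc n - e))" by (simp add: CH_eq_alt_sum)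
  moreover have "e + (Suc n - e) = n + 1" "1 \<le> Suc n - e" using *(2) by auto
  ultimately show ?thesis using *(1) by blast
qed

lemma alternating_T_rel:
  assumes "finite S" "s \<notin> S" "card S = m" "homog a d S"
  shows "\<exists>\<phi> e f k. substitution \<phi> \<and> e + f = m \<and> alt_sum S S s a d = of_int k * \<phi> (T_rel e f)"
proof -
  obtain \<phi> e k where *: "substitution \<phi>" "e \<le> m"
    "alt_sum S S s a d = of_int k * \<phi> (alt_sum {..<m} {..<m} m (zvar e) (dpar e))"
    using alternating_parity_sorted[OF assms] by blast
  moreover have "T_rel e (m - e) = alt_sum {..<m} {..<m} m (zvar e) (dpar e)"
    using T_rel_eq_alt_sum[of e "m - e" m] *(2) by simp
  ultimately show ?thesis by (metis le_add_diff_inverse)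
qed

section \<open>Straightening modulo a T-ideal\<close>

lemma sum_pull_out:
  fixes f g :: "'b \<Rightarrow> ft"
  assumes "\<And>\<rho>. \<rho> \<in> A \<Longrightarrow> f \<rho> = of_int c * (x * g \<rho> * y)"
  shows "(\<Sum>\<rho>\<in>A. of_int (k \<rho>) * f \<rho>) = of_int c * (x * (\<Sum>\<rho>\<in>A. of_int (k \<rho>) * g \<rho>) * y)"
proof -
  have "of_int (k \<rho>) * (of_int c * (x * b * y)) = of_int c * (x * (of_int (k \<rho>) * b) * y)" for \<rho> b
    unfolding of_int_left_commute[of "of_int (k \<rho>)" c] of_int_left_commute[of x "k \<rho>"] mult.assoc ..
  then show ?thesis
    using assms by (simp add: sum_distrib_left sum_distrib_right)
qed

context
  fixes I assumes I: "T_ideal I"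
begin

lemma T_ideal_closed:
  "0 \<in> I" "a \<in> I \<Longrightarrow> b \<in> I \<Longrightarrow> a + b \<in> I" "a \<in> I \<Longrightarrow> x * a \<in> I" "a \<in> I \<Longrightarrow> a * x \<in> I" "a \<in> I \<Longrightarrow> ftr a \<in> I"
  using I unfolding T_ideal_def graded_ideal_def by blast+

lemma T_ideal_substitution: "a \<in> I \<Longrightarrow> substitution \<phi> \<Longrightarrow> \<phi> a \<in> I"
  using I unfolding T_ideal_def by blast

context
  fixes n assumes CH: "\<And>e f. e + f = n + 1 \<Longrightarrow> 1 \<le> f \<Longrightarrow> CH e f \<in> I"
begin

lemma alt_sum_hole_in_T_ideal:
  assumes "finite S" "s \<notin> S" "card S = n" "homog a d S"
  shows "alt_sum (insert s S) S s a d \<in> I"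
proof -
  obtain \<phi> e f k where "substitution \<phi>" "e + f = n + 1" "1 \<le> f" "alt_sum (insert s S) S s a d = of_int k * \<phi> (CH e f)"
    using alternating_CH[OF assms] by blast
  then show ?thesis using T_ideal_closed(3) T_ideal_substitution CH by simp
qed

lemma sum_compose_alt_sum:
  assumes "finite P" "\<sigma> permutes P"
  shows "(\<Sum>\<rho> | \<rho> permutes P. of_int (sign \<rho>) * psi S s (\<sigma> \<circ> \<rho>) a d) = of_int (sign \<sigma>) * alt_sum P S s a d"
proof -
  have "alt_sum P S s a d = (\<Sum>\<rho> | \<rho> permutes P. of_int (sign (\<sigma> \<circ> \<rho>)) * psi S s (\<sigma> \<circ> \<rho>) a d)"
    unfolding alt_sum_def by (rule setum_permutations_compose_left[OF assms(2)])
  also have "\<dots> = (\<Sum>\<rho> | \<rho> permutes P. of_int (sign \<sigma>) * (of_int (sign \<rho>) * psi S s (\<sigma> \<circ> \<rho>) a d))"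
  proof (rule sum.cong)
    fix \<rho> assume "\<rho> \<in> {\<rho>. \<rho> permutes P}"
    then have "sign (\<sigma> \<circ> \<rho>) = sign \<sigma> * sign \<rho>"
      using assms by (intro sign_compose) (auto simp: permutation_permutes)
    then show "of_int (sign (\<sigma> \<circ> \<rho>)) * psi S s (\<sigma> \<circ> \<rho>) a d = of_int (sign \<sigma>) * (of_int (sign \<rho>) * psi S s (\<sigma> \<circ> \<rho>) a d)"
      by (simp add: mult.assoc)
  qed simp
  finally have e: "alt_sum P S s a d = of_int (sign \<sigma>) * (\<Sum>\<rho> | \<rho> permutes P. of_int (sign \<rho>) * psi S s (\<sigma> \<circ> \<rho>) a d)"
    by (simp add: sum_distrib_left)
  have "of_int (sign \<sigma>) * (of_int (sign \<sigma>) * x) = x" for x :: ft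
    by (simp flip: mult.assoc of_int_mult)
  then show ?thesis unfolding e by simp
qed

lemma permutes_fix: "\<sigma> permutes A \<Longrightarrow> \<sigma> r = r \<Longrightarrow> \<sigma> permutes A - {r}"
  by (rule permutes_superset) auto

lemma permutes_delete:
  assumes "\<sigma> permutes A" "r \<in> A"
  shows "(Transposition.transpose r (\<sigma> r) \<circ> \<sigma>) permutes A - {r}"
proof (rule permutes_fix)
  show "(Transposition.transpose r (\<sigma> r) \<circ> \<sigma>) permutes A"
    using assms permutes_in_image[OF assms(1), of r] by (intro permutes_compose permutes_swap_id) auto
qed simp

text \<open>
  Antisymmetrizing a trace monomial over \<open>n + 1\<close> positions \<open>P\<close> yields a consequence of the Cayley--Hamilton
  identities.  An index outside \<open>P\<close> is moved by every \<open>\<sigma> \<circ> \<rho>\<close> as by \<open>\<sigma>\<close>, so it can be deleted from all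
  monomials of the sum at once: up to a common sign it splits off as a factor or is merged into a
  neighbouring variable.  When only the positions in \<open>P\<close> and the hole \<open>s\<close> are left, the sum is a
  Cayley--Hamilton expression if \<open>s\<close> belongs to \<open>P\<close>.  Otherwise either \<open>\<sigma>\<close> fixes \<open>s\<close>, and the sum is the trace of
  a Cayley--Hamilton expression times a variable, or a variable splits off on the left and its place
  takes over as hole.
\<close>

lemma antisymmetrized_in_T_ideal:
  assumes "finite S" "s \<notin> S" "\<sigma> permutes insert s S" "P \<subseteq> insert s S" "card P = n + 1" "homog a d S"
  shows "(\<Sum>\<rho> | \<rho> permutes P. of_int (sign \<rho>) * psi S s (\<sigma> \<circ> \<rho>) a d) \<in> I"
  using assms
proof (induction "card S" arbitrary: S \<sigma> a d)
  case (0 S \<sigma> a d)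
  then have "S = {}" by simp
  with 0 have "P \<subseteq> {s}" by simp
  with \<open>card P = n + 1\<close> have "P = insert s S" "n = card S"
    using \<open>S = {}\<close> by (auto dest: subset_singletonD)
  then have "finite P" "\<sigma> permutes P" "alt_sum P S s a d \<in> I"
    using 0 alt_sum_hole_in_T_ideal[of S s a d] by auto
  then show ?case
    unfolding sum_compose_alt_sum[OF \<open>finite P\<close> \<open>\<sigma> permutes P\<close>] by (intro T_ideal_closed)
next
  case (Suc k S \<sigma> a d)
  have fP: "finite P" using Suc.prems by (meson finite.insertI finite_subset)
  have ph: "perm_hole S s (\<sigma> \<circ> \<rho>)" if "\<rho> permutes P" for \<rho>
    unfolding perm_hole_def using Suc.prems(1-4) permutes_compose[OF permutes_subset[OF that] Suc.prems(3)] by auto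
  show ?case
  proof (cases "S \<subseteq> P")
    case False
    then obtain r where r: "r \<in> S" "r \<notin> P" by auto
    have \<rho>r: "(\<sigma> \<circ> \<rho>) r = \<sigma> r" if "\<rho> permutes P" for \<rho>
      using that r by (simp add: permutes_not_in)
    let ?\<tau> = "Transposition.transpose r (\<sigma> r) \<circ> \<sigma>"
    have ins: "insert s (S - {r}) = insert s S - {r}" using r Suc.prems(2) by auto
    have k: "k = card (S - {r})" using Suc.hyps(2) r(1) Suc.prems(1) by simp
    have prems: "finite (S - {r})" "s \<notin> S - {r}" "P \<subseteq> insert s (S - {r})" "homog a d (S - {r})"
      using Suc.prems r by (auto simp: homog_def)
    have \<tau>: "?\<tau> permutes insert s (S - {r})"
      unfolding ins using Suc.prems(3) r(1) by (intro permutes_delete) auto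
    have "\<sigma> r \<in> insert s S" using r(1) permutes_in_image[OF Suc.prems(3)] by blast
    then consider "\<sigma> r = r" | "\<sigma> r = s" | "\<sigma> r \<noteq> r" "\<sigma> r \<in> S" by blast
    then show ?thesis
    proof cases
      case 1
      have \<sigma>: "\<sigma> permutes insert s (S - {r})" using \<tau> 1 by simp
      let ?c = "koszul_sign d (r # sorted_list_of_set (S - {r}))"
      have "(\<Sum>\<rho> | \<rho> permutes P. of_int (sign \<rho>) * psi S s (\<sigma> \<circ> \<rho>) a d) =
          of_int ?c * (ftr (a r) * (\<Sum>\<rho> | \<rho> permutes P. of_int (sign \<rho>) * psi (S - {r}) s (\<sigma> \<circ> \<rho>) a d) * 1)"
        using psi_delete_fixed[OF ph r(1) _ Suc.prems(6)] \<rho>r 1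
        by (intro sum_pull_out) (simp del: koszul_sign.simps)
      moreover have "(\<Sum>\<rho> | \<rho> permutes P. of_int (sign \<rho>) * psi (S - {r}) s (\<sigma> \<circ> \<rho>) a d) \<in> I"
        by (rule Suc.hyps(1)[OF k prems(1,2) \<sigma> prems(3) Suc.prems(5) prems(4)])
      ultimately show ?thesis by (simp only: T_ideal_closed)
    next
      case 2
      let ?c = "koszul_sign d (sorted_list_of_set (S - {r}) @ [r])"
      have "(\<Sum>\<rho> | \<rho> permutes P. of_int (sign \<rho>) * psi S s (\<sigma> \<circ> \<rho>) a d) =
          of_int ?c * (1 * (\<Sum>\<rho> | \<rho> permutes P. of_int (sign \<rho>) * psi (S - {r}) s (?\<tau> \<circ> \<rho>) a d) * a r)"
        using psi_delete_last[OF ph r(1) _ Suc.prems(6)] \<rho>r 2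
        by (intro sum_pull_out) (simp add: o_assoc del: koszul_sign.simps)
      moreover have "(\<Sum>\<rho> | \<rho> permutes P. of_int (sign \<rho>) * psi (S - {r}) s (?\<tau> \<circ> \<rho>) a d) \<in> I"
        by (rule Suc.hyps(1)[OF k prems(1,2) \<tau> prems(3) Suc.prems(5) prems(4)])
      ultimately show ?thesis by (simp only: T_ideal_closed)
    next
      case 3
      let ?c = "koszul_sign d (expand r (\<sigma> r) (sorted_list_of_set (S - {r})))"
      let ?a = "merge_arg r (\<sigma> r) a" and ?d = "merge_deg r (\<sigma> r) d"
      have "(\<Sum>\<rho> | \<rho> permutes P. of_int (sign \<rho>) * psi S s (\<sigma> \<circ> \<rho>) a d) =
          of_int ?c * (1 * (\<Sum>\<rho> | \<rho> permutes P. of_int (sign \<rho>) * psi (S - {r}) s (?\<tau> \<circ> \<rho>) ?a ?d) * 1)"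
      proof (rule sum_pull_out)
        fix \<rho> assume "\<rho> \<in> {\<rho>. \<rho> permutes P}"
        then have "\<rho> permutes P" by simp
        from psi_delete_merge[OF ph[OF this] r(1) \<rho>r[OF this] 3 Suc.prems(6)]
        show "psi S s (\<sigma> \<circ> \<rho>) a d = of_int ?c * (1 * psi (S - {r}) s (?\<tau> \<circ> \<rho>) ?a ?d * 1)"
          by (simp only: o_assoc mult_1_left mult_1_right)
      qed
      moreover have "(\<Sum>\<rho> | \<rho> permutes P. of_int (sign \<rho>) * psi (S - {r}) s (?\<tau> \<circ> \<rho>) ?a ?d) \<in> I"
        by (rule Suc.hyps(1)[OF k prems(1,2) \<tau> prems(3) Suc.prems(5) merge_homog[OF Suc.prems(6) r(1) 3(2)]])
      ultimately show ?thesis by (simp only: T_ideal_closed)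
    qed
  next
    case True
    consider "P = insert s S" | "P = S" "s \<notin> P" using True Suc.prems(4) by blast
    then show ?thesis
    proof cases
      case 1
      then have "card S = n" using Suc.prems by simp
      then have "alt_sum P S s a d \<in> I" using alt_sum_hole_in_T_ideal[of S s a d] Suc.prems 1 by blast
      then show ?thesis
        using sum_compose_alt_sum[OF fP, of \<sigma> S s a d] Suc.prems(3) 1 by (simp only: T_ideal_closed)
    next
      case 2
      have cp: "card (P - {p}) = n" "insert p (P - {p}) = P" if "p \<in> P" for p
        using that Suc.prems(5) fP by auto
      show ?thesis
      proof (cases "\<sigma> s = s")
        case True
        have \<sigma>: "\<sigma> permutes P" using permutes_fix[OF Suc.prems(3) True] 2 by simp
        \<comment> \<open>Any position \<open>p\<close> will do: each closed monomial is opened at \<open>p\<close>.\<close>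
        obtain p where p: "p \<in> P" using Suc.prems(5) by fastforce
        let ?k = "koszul_sign d (sorted_list_of_set (P - {p}) @ [p])"
        have c: "psi P s \<pi> a d = of_int ?k * ftr (psi (P - {p}) p \<pi> a d * a p)" if \<pi>: "\<pi> permutes P" for \<pi>
        proof -
          have "ftr (psi (P - {p}) p \<pi> a d * a p) = of_int ?k * psi P s \<pi> a d"
            using psi_close[of "P - {p}" p \<pi> s a d] cp[OF p] 2 fP \<pi> Suc.prems(6)
            by (auto simp: perm_hole_def)
          then show ?thesis by (simp add: koszul_sign_sq flip: mult.assoc of_int_mult)
        qed
        have "alt_sum P P s a d = of_int ?k * ftr (alt_sum P (P - {p}) p a d * a p)"
        proof -
          have t: "ftr (alt_sum P (P - {p}) p a d * a p) =
              (\<Sum>\<pi> | \<pi> permutes P. of_int (sign \<pi>) * ftr (psi (P - {p}) p \<pi> a d * a p))"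
            unfolding alt_sum_def sum_distrib_right ftr_sum by (simp add: mult.assoc ftr_of_int)
          show ?thesis
            unfolding t alt_sum_def[of P P]
            using sum_pull_out[of "{\<pi>. \<pi> permutes P}" "\<lambda>\<pi>. psi P s \<pi> a d" ?k 1
                "\<lambda>\<pi>. ftr (psi (P - {p}) p \<pi> a d * a p)" 1 sign] c by simp
        qed
        moreover have "alt_sum P (P - {p}) p a d \<in> I"
          using alt_sum_hole_in_T_ideal[of "P - {p}" p a d] cp[OF p] fP Suc.prems(6) 2 by (auto simp: homog_def)
        ultimately have "alt_sum P P s a d \<in> I" by (simp only: T_ideal_closed)
        then show ?thesis
          using sum_compose_alt_sum[OF fP \<sigma>, of S s a d] 2 by (simp only: T_ideal_closed)
      next
        case False
        define q where "q = \<sigma> s"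
        have "\<sigma> s \<in> insert s S" using permutes_in_image[OF Suc.prems(3)] by blast
        then have q: "q \<in> P" using False 2 q_def by auto
        let ?\<tau> = "Transposition.transpose s q \<circ> \<sigma>" and ?k = "koszul_sign d (q # sorted_list_of_set (P - {q}))"
        have \<tau>: "?\<tau> permutes P"
          using permutes_delete[OF Suc.prems(3), of s] 2 by (simp add: q_def)
        have \<rho>s: "(\<sigma> \<circ> \<rho>) s = q" if "\<rho> permutes P" for \<rho>
          using that 2 by (simp add: q_def permutes_not_in)
        have "(\<Sum>\<rho> | \<rho> permutes P. of_int (sign \<rho>) * psi S s (\<sigma> \<circ> \<rho>) a d) =
          of_int ?k * (a q * (\<Sum>\<rho> | \<rho> permutes P. of_int (sign \<rho>) * psi (P - {q}) q (?\<tau> \<circ> \<rho>) a d) * 1)"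
        proof (rule sum_pull_out)
          fix \<rho> assume "\<rho> \<in> {\<rho>. \<rho> permutes P}"
          then have "\<rho> permutes P" by simp
          from psi_delete_hole[OF ph[OF this] \<rho>s[OF this] _ Suc.prems(6)] q 2(1)
          show "psi S s (\<sigma> \<circ> \<rho>) a d = of_int ?k * (a q * psi (P - {q}) q (?\<tau> \<circ> \<rho>) a d * 1)"
            by (simp only: o_assoc mult_1_left mult_1_right)
        qed
        moreover have "(\<Sum>\<rho> | \<rho> permutes P. of_int (sign \<rho>) * psi (P - {q}) q (?\<tau> \<circ> \<rho>) a d) =
            of_int (sign ?\<tau>) * alt_sum P (P - {q}) q a d"
          by (rule sum_compose_alt_sum[OF fP \<tau>])
        moreover have "alt_sum P (P - {q}) q a d \<in> I"
          using alt_sum_hole_in_T_ideal[of "P - {q}" q a d] cp[OF q] fP Suc.prems(6) 2 by (auto simp: homog_def)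
        ultimately show ?thesis by (simp only: T_ideal_closed)
      qed
    qed
  qed
qed

end

end

section \<open>Products of distinct odd variables\<close>

text \<open>
  The odd derivation with respect to the odd variable \<open>j\<close>; repeated derivation extracts the
  coefficient of a product of distinct odd variables.  It is defined on terms with values in the
  quotient, where the ring laws are at hand for checking that it respects the congruence.
\<close>

primrec sc_der :: "'o \<Rightarrow> ('e, 'o) scterm \<Rightarrow> ('e, 'o) sc" where
  "sc_der j (SEven i) = 0"
| "sc_der j (SOdd i) = (if i = j then 1 else 0)"
| "sc_der j (SConst u) = 0"
| "sc_der j (SAdd a b) = sc_der j a + sc_der j b"
| "sc_der j (SMul a b) = sc_der j a * abs_sc b + scpar (abs_sc a) * sc_der j b"

lemma scgrade_minus: "a \<in> scgrade p \<Longrightarrow> - a \<in> scgrade p"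
  using scgrade_scale[of a p "-1"] by (simp add: scconst_minus)

lemma scpar_0_1: "scpar 0 = 0" "scpar 1 = 1"
  using scpar_gen(3)[of 0] scpar_gen(3)[of 1] by simp_all

lemma abs_sc_grade: "scdeg p a \<Longrightarrow> abs_sc a \<in> scgrade p"
  by (auto simp: scgrade_def)

lemma sc_der_grade: "scdeg p a \<Longrightarrow> sc_der j a \<in> scgrade (p + 1)"
proof (induction rule: scdeg.induct)
  case (5 p a q b)
  have "sc_der j a * abs_sc b \<in> scgrade ((p + 1) + q)"
    by (rule scgrade_mult[OF 5(3) abs_sc_grade[OF 5(2)]])
  moreover have "scpar (abs_sc a) \<in> scgrade p"
    using scpar_deg[OF 5(1)] abs_sc_grade[OF 5(1)] scgrade_minus by auto
  then have "scpar (abs_sc a) * sc_der j b \<in> scgrade (p + (q + 1))"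
    by (rule scgrade_mult[OF _ 5(4)])
  moreover have "(p + 1) + q = p + q + 1" "p + (q + 1) = p + q + 1" by (simp_all only: ac_simps)
  ultimately show ?case by (simp only: sc_der.simps scgrade_add)
qed (use scgrade_const[of 1] scgrade_zero scgrade_add in auto)

lemma sc_der_cong: "a \<approx>\<^sub>s b \<Longrightarrow> sc_der j a = sc_der j b"
proof (induction rule: sccong.induct)
  case (sc_Mul a a' b b')
  then have "abs_sc a = abs_sc a'" "abs_sc b = abs_sc b'" by (simp_all add: sc.abs_eq_iff)
  with sc_Mul show ?case by simp
next
  case (sc_supercomm p a q b)
  let ?A = "abs_sc a" and ?B = "abs_sc b"
  have A: "?A \<in> scgrade p" and B: "?B \<in> scgrade q" using sc_supercomm by (auto intro: abs_sc_grade)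
  have DA: "sc_der j a \<in> scgrade (p + 1)" and DB: "sc_der j b \<in> scgrade (q + 1)"
    using sc_supercomm by (auto intro: sc_der_grade simp del: add_bit_eq_xor)
  have 1: "sc_der j a * ?B = scconst (koszul (p + 1) q) * (?B * sc_der j a)" by (rule sc.supercomm[OF DA B])
  have 2: "?A * sc_der j b = scconst (koszul p (q + 1)) * (sc_der j b * ?A)" by (rule sc.supercomm[OF A DB])
  show ?case
    unfolding sc_der.simps abs_sc_simps scpar_gen scpar_deg[OF sc_supercomm(1)] scpar_deg[OF sc_supercomm(2)]
    using 1 2 by (cases p; cases q) (simp_all add: koszul_def scconst_minus algebra_simps)
qed (simp_all add: abs_sc_simps scpar_0_1 scpar_gen scpar_add scpar_mul algebra_simps scconst_add scconst_mult scconst_central)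

definition scder :: "'o \<Rightarrow> ('e, 'o) sc \<Rightarrow> ('e, 'o) sc" where
  "scder j a = sc_der j (rep_sc a)"

lemma scder_abs: "scder j (abs_sc a) = sc_der j a"
  unfolding scder_def by (rule sc_der_cong) (simp add: abs_rep_sc flip: sc.abs_eq_iff)

lemma scder_mult: "scder j (a * b) = scder j a * b + scpar a * scder j b"
proof -
  obtain s t where "a = abs_sc s" "b = abs_sc t" using abs_rep_sc by metis
  then show ?thesis by (simp add: scder_abs flip: abs_sc_simps)
qed

lemma scder_gen: "scder j (scconst c) = 0" "scder j (scodd i) = (if i = j then 1 else 0)"
  by (simp_all add: scder_abs flip: abs_sc_simps)

lemma scconst_eq_0: "scconst c = (0 :: ('e, 'o) sc) \<Longrightarrow> c = 0"
proof -
  assume "scconst c = (0 :: ('e, 'o) sc)"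
  then have "abs_sc (SConst c :: ('e, 'o) scterm) = abs_sc (SConst 0)" by (simp add: abs_sc_simps)
  then have "(SConst c :: ('e, 'o) scterm) \<approx>\<^sub>s SConst 0" by (simp add: sc.abs_eq_iff)
  from sccong_aug[OF this] show "c = 0" by simp
qed

text \<open>
  Deriving by the first variable removes it from the product, as the remaining variables are
  different from it.
\<close>

lemma odd_product_nonzero:
  fixes js :: "'o list"
  assumes "distinct js" "scconst c * prod_list (map scodd js) = (0 :: ('e, 'o) sc)"
  shows "c = 0"
  using assms
proof (induction js)
  case Nil
  then show ?case using scconst_eq_0 by simp
next
  case (Cons j js)
  let ?R = "prod_list (map scodd js) :: ('e, 'o) sc"
  have "scder j (prod_list (map scodd js) :: ('e, 'o) sc) = 0" if "j \<notin> set js" for js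
    using that
  proof (induction js)
    case Nil
    show ?case using scder_gen(1)[of j 1] by simp
  qed (auto simp: scder_mult scder_gen)
  then have R: "scder j ?R = 0" using Cons.prems(1) by simp
  have "scder j (scconst c * (scodd j * ?R)) = scconst c * ?R"
    by (simp add: scder_mult scder_gen scpar_gen R)
  moreover have "scder j (0 :: ('e, 'o) sc) = 0" using scder_gen(1)[of j 0] by simp
  ultimately show ?case using Cons by simp
qed

lemma scconst_of_int: "scconst (of_int k) = of_int k"
proof -
  have "scconst (of_nat m) = of_nat m" for m
    by (induction m) (simp_all add: scconst_add)
  then show ?thesis by (cases k rule: int_cases2) (auto simp: scconst_minus)
qed

lemma scconst_koszul: "scconst (koszul p q) = of_int (swap_sign p q)"
  by (cases p; cases q) (auto simp: koszul_def swap_sign_def scconst_minus)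

text \<open>
  Supercommutativity is the Koszul rule for adjacent factors.
\<close>

lemma scprod_sorted:
  assumes "\<And>i. i \<in> S \<Longrightarrow> \<zeta> i \<in> scgrade (d i)" "distinct l" "set l = S"
  shows "prod_list (map \<zeta> l) = of_int (koszul_sign d l) * prod_list (map \<zeta> (sorted_list_of_set S))"
proof (rule koszul_swap_sorted[where F = "\<lambda>l. prod_list (map \<zeta> l)", OF _ assms(2,3)])
  fix u v i j assume "set (u @ i # j # v) = S"
  then have ij: "\<zeta> i \<in> scgrade (d i)" "\<zeta> j \<in> scgrade (d j)" using assms(1) by auto
  have "\<zeta> i * \<zeta> j = of_int (swap_sign (d i) (d j)) * (\<zeta> j * \<zeta> i)"
    using sc.supercomm[OF ij] by (simp only: scconst_koszul)
  then have "\<zeta> i * (\<zeta> j * x) = of_int (swap_sign (d i) (d j)) * (\<zeta> j * (\<zeta> i * x))" for x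
    by (metis mult.assoc)
  then show "prod_list (map \<zeta> (u @ i # j # v)) = of_int (swap_sign (d i) (d j)) * prod_list (map \<zeta> (u @ j # i # v))"
    by (simp add: of_int_left_commute[of "prod_list (map \<zeta> u)"])
qed

section \<open>Evaluation on elementary matrices\<close>

type_synonym 'n gmat = "'n gen ^ 'n ^ 'n"

definition elem_mat :: "'n gen \<Rightarrow> 'n \<Rightarrow> 'n \<Rightarrow> ('n::finite) gmat" where
  "elem_mat z h k = (\<chi> i j. if i = h \<and> j = k then z else 0)"

lemma elem_mat_mult: "elem_mat z h k ** elem_mat z' h' k' = (if k = h' then elem_mat (z * z') h k' else 0)"
proof -
  have "(\<Sum>l\<in>UNIV. (if i = h \<and> l = k then z else 0) * (if l = h' \<and> j = k' then z' else 0)) =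
     (\<Sum>l\<in>UNIV. if l = k then (if i = h \<and> k = h' \<and> j = k' then z * z' else 0) else 0)" for i j
    by (rule sum.cong) auto
  then show ?thesis
    by (auto simp: elem_mat_def matrix_matrix_mult_def vec_eq_iff)
qed

lemma trace_elem_mat: "trace (elem_mat z h k) = (if h = k then z else 0)"
proof -
  have "trace (elem_mat z h k) = (\<Sum>i\<in>UNIV. if i = h then (if h = k then z else 0) else 0)"
    unfolding trace_def elem_mat_def by (rule sum.cong) auto
  then show ?thesis by simp
qed

lemma elem_mat_grade: "z \<in> scgrade p \<Longrightarrow> elem_mat z h k \<in> mgrade p"
  by (auto simp: elem_mat_def mgrade_def scgrade_zero)

lemma mat_0 [simp]: "mat 0 = (0 :: 'a::zero ^ 'n ^ 'n)"
  by (simp add: mat_def vec_eq_iff)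

abbreviation matrix_hom :: "(ft \<Rightarrow> ('n::finite) gmat) \<Rightarrow> bool" where
  "matrix_hom \<equiv> trace_hom (**) mconst mgrade mtr"

context
  fixes \<psi> :: "ft \<Rightarrow> ('n::finite) gmat"
  assumes \<psi>: "matrix_hom \<psi>"
begin

lemma matrix_hom_simps:
  "\<psi> (a + b) = \<psi> a + \<psi> b" "\<psi> (a * b) = \<psi> a ** \<psi> b" "\<psi> (ftconst c) = mat (scconst c)"
  "\<psi> (ftr a) = mat (trace (\<psi> a))" "\<psi> 0 = 0" "\<psi> 1 = mat 1" "\<psi> (of_int k) = mat (of_int k)"
proof -
  show c: "\<psi> (ftconst c) = mat (scconst c)" for c using \<psi> by (auto simp: trace_hom_def mconst_def)
  show "\<psi> 0 = 0" "\<psi> 1 = mat 1" "\<psi> (of_int k) = mat (of_int k)"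
    using c[of 0] c[of 1] c[of "of_int k"] by (simp_all add: ftconst_of_int scconst_of_int)
qed (use \<psi> in \<open>auto simp: trace_hom_def mtr_def\<close>)

lemma matrix_hom_grade: "a \<in> ftgrade p \<Longrightarrow> \<psi> a \<in> mgrade p"
  using \<psi> unfolding trace_hom_def by blast

lemma matrix_hom_sum: "\<psi> (\<Sum>i\<in>A. f i) = (\<Sum>i\<in>A. \<psi> (f i))"
  by (induction A rule: infinite_finite_induct) (auto simp: matrix_hom_simps)

context
  fixes a :: "nat \<Rightarrow> ft" and \<zeta> :: "nat \<Rightarrow> 'n gen" and \<alpha> \<beta> :: "nat \<Rightarrow> 'n" and S :: "nat set"
  assumes a: "\<And>i. i \<in> S \<Longrightarrow> \<psi> (a i) = elem_mat (\<zeta> i) (\<alpha> i) (\<beta> i)"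
begin

text \<open>
  A product of elementary matrices vanishes unless the column index of each factor is the row index of
  the next one.
\<close>

lemma eval_word:
  "w \<noteq> [] \<Longrightarrow> set w \<subseteq> S \<Longrightarrow> \<psi> (word a w) =
    (if map \<beta> (butlast w) = map \<alpha> (tl w) then elem_mat (prod_list (map \<zeta> w)) (\<alpha> (hd w)) (\<beta> (last w)) else 0)"
proof (induction w)
  case (Cons i w)
  show ?case
  proof (cases w)
    case Nil
    then show ?thesis using Cons.prems a by (simp add: matrix_hom_simps)
  next
    case (Cons j v)
    then show ?thesis
      using Cons.IH Cons.prems a by (auto simp: matrix_hom_simps elem_mat_mult)
  qed
qed simp

lemma eval_cycle:
  assumes "w \<noteq> []" "set w \<subseteq> S" "map \<sigma> w = rotate1 w"
  shows "\<psi> (ftr (word a w)) = mat (if \<forall>i\<in>set w. \<beta> i = \<alpha> (\<sigma> i) then prod_list (map \<zeta> w) else 0)"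
proof -
  have w: "map f w = map f (butlast w) @ [f (last w)]" for f :: "nat \<Rightarrow> 'n"
    using assms(1) by (metis append_butlast_last_id list.simps(8) list.simps(9) map_append)
  have "(\<forall>i\<in>set w. \<beta> i = \<alpha> (\<sigma> i)) \<longleftrightarrow> map \<beta> w = map \<alpha> (map \<sigma> w)" by simp
  also have "\<dots> \<longleftrightarrow> map \<beta> (butlast w) @ [\<beta> (last w)] = map \<alpha> (tl w) @ [\<alpha> (hd w)]"
    unfolding assms(3) w[of \<beta>] using assms(1) by (cases w) auto
  finally have "(\<forall>i\<in>set w. \<beta> i = \<alpha> (\<sigma> i)) \<longleftrightarrow> map \<beta> (butlast w) = map \<alpha> (tl w) \<and> \<alpha> (hd w) = \<beta> (last w)"
    by auto
  moreover have "trace (0 :: 'n gmat) = 0" by (simp add: trace_def)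
  ultimately show ?thesis
    using eval_word[OF assms(1,2)] by (simp add: matrix_hom_simps trace_elem_mat)
qed

lemma eval_traces:
  assumes "[] \<notin> set ws" "set (concat ws) \<subseteq> S" "\<And>w. w \<in> set ws \<Longrightarrow> map \<sigma> w = rotate1 w"
  shows "\<psi> (traces a ws) =
    mat (if \<forall>i\<in>set (concat ws). \<beta> i = \<alpha> (\<sigma> i) then prod_list (map \<zeta> (concat ws)) else 0)"
  using assms
proof (induction ws)
  case (Cons w ws)
  have "\<psi> (ftr (word a w)) = mat (if \<forall>i\<in>set w. \<beta> i = \<alpha> (\<sigma> i) then prod_list (map \<zeta> w) else 0)"
    using Cons.prems by (intro eval_cycle) auto
  moreover have "\<psi> (traces a ws) =
    mat (if \<forall>i\<in>set (concat ws). \<beta> i = \<alpha> (\<sigma> i) then prod_list (map \<zeta> (concat ws)) else 0)"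
    using Cons.prems by (intro Cons.IH) auto
  ultimately show ?case by (auto simp: matrix_hom_simps mat_mult_mat)
qed (simp add: matrix_hom_simps)

text \<open>
  On elementary matrices, a product of traces becomes the product of the scalars \<open>\<zeta> i\<close> in the order of
  the display, provided that indices match along all cycles.  The sign of sorting this product is the
  Koszul sign of the display, so the two cancel: up to a factor that is common to all permutations,
  only a matrix coefficient of the permutation acting on a tensor power remains.
\<close>

lemma eval_psi:
  assumes "perm_hole S s \<sigma>" "\<sigma> s = s" "homog a d S" "\<And>i. i \<in> S \<Longrightarrow> \<zeta> i \<in> scgrade (d i)"
  shows "\<psi> (psi S s \<sigma> a d) = mat (if \<forall>i\<in>S. \<beta> i = \<alpha> (\<sigma> i) then prod_list (map \<zeta> (sorted_list_of_set S)) else 0)"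
proof -
  obtain ws u where D: "display S s \<sigma> ws u" using assms(1) by (rule perm_holeE)
  have "map \<sigma> (u @ [s]) = rotate1 (u @ [s])" using D by (simp add: display_def)
  from arg_cong[OF this, of last] have "hd (u @ [s]) = s" using assms(2) by (cases u) simp_all
  then have u: "u = []" using D by (cases u) (auto simp: display_def)
  let ?l = "concat ws"
  have l: "distinct ?l" "set ?l = S" "[] \<notin> set ws" "\<And>w. w \<in> set ws \<Longrightarrow> map \<sigma> w = rotate1 w"
    using D u unfolding display_def by simp_all
  have "\<psi> (traces a ws) =
    mat (if \<forall>i\<in>set (concat ws). \<beta> i = \<alpha> (\<sigma> i) then prod_list (map \<zeta> (concat ws)) else 0)"
    using l by (intro eval_traces) auto
  then have "\<psi> (traces a ws) =
    mat (if \<forall>i\<in>S. \<beta> i = \<alpha> (\<sigma> i) then prod_list (map \<zeta> (concat ws)) else 0)"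
    unfolding l(2) .
  moreover have "prod_list (map \<zeta> ?l) = of_int (koszul_sign d ?l) * prod_list (map \<zeta> (sorted_list_of_set S))"
    by (rule scprod_sorted[OF assms(4) l(1,2)])
  moreover have "of_int (koszul_sign d ?l) * (of_int (koszul_sign d ?l) * x) = x" for x :: "'n gen"
    by (simp add: koszul_sign_sq flip: mult.assoc of_int_mult)
  ultimately show ?thesis
    unfolding psi_eq[OF D assms(3)] val_def trace_monomial_def u
    by (simp add: matrix_hom_simps mat_mult_mat)
qed

end

end

text \<open>
  Specializing the entries of the generic matrices to those of \<open>\<psi> (fty i)\<close> and \<open>\<psi> (ftx i)\<close> is a homomorphism
  \<open>\<theta>\<close>; applied to the entries of \<open>ev\<close>, it agrees with \<open>\<psi>\<close> on the generators.
\<close>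

lemma ev_generic:
  fixes \<psi> :: "ft \<Rightarrow> ('n::finite) gmat"
  assumes \<psi>: "matrix_hom \<psi>"
  shows "\<exists>\<theta>. \<theta> 0 = 0 \<and> (\<forall>a. \<psi> a = (\<chi> h k. \<theta> (ev a $ h $ k)))"
proof -
  define X where "X = (\<lambda>(i, h, k). \<psi> (fty i) $ h $ k)"
  define Y where "Y = (\<lambda>(i, h, k). \<psi> (ftx i) $ h $ k)"
  define \<theta> where "\<theta> = sc_eval (*) scconst X Y"
  have X: "X t \<in> scgrade 0" for t
    using matrix_hom_grade[OF \<psi> ftgrade_y[of "fst t"]] by (cases t) (auto simp: X_def mgrade_def)
  have Y: "Y t \<in> scgrade 1" for t
    using matrix_hom_grade[OF \<psi> ftgrade_x[of "fst t"]] by (cases t) (auto simp: Y_def mgrade_def)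
  have \<theta>: "super_hom (*) scconst scgrade \<theta>" "\<And>t. \<theta> (sceven t) = X t" "\<And>t. \<theta> (scodd t) = Y t"
    unfolding \<theta>_def using sc.sc_eval_simps[of X Y, OF X Y] by auto
  have t: "\<theta> (x + y) = \<theta> x + \<theta> y" "\<theta> (x * y) = \<theta> x * \<theta> y" "\<theta> (scconst c) = scconst c"
    "x \<in> scgrade p \<Longrightarrow> \<theta> x \<in> scgrade p" for x y c p
    using \<theta>(1) unfolding super_hom_def by blast+
  have t0: "\<theta> 0 = 0" using t(3)[of 0] by simp
  have tsum: "\<theta> (\<Sum>i\<in>A. f i) = (\<Sum>i\<in>A. \<theta> (f i))" for A :: "'n set" and f
    by (induction A rule: infinite_finite_induct) (auto simp: t t0)
  let ?\<chi> = "\<lambda>a. \<chi> h k. \<theta> (ev a $ h $ k)"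
  have x: "\<psi> (ftx i) \<in> mgrade 1" and y: "\<psi> (fty i) \<in> mgrade 0" for i
    using matrix_hom_grade[OF \<psi>] ftgrade_x ftgrade_y by auto
  have "matrix_hom ?\<chi>"
    unfolding trace_hom_def
  proof (intro conjI allI subsetI)
    fix a b u p A
    show "?\<chi> (a + b) = ?\<chi> a + ?\<chi> b" by (simp add: ev_simps t vec_eq_iff)
    show "?\<chi> (a * b) = ?\<chi> a ** ?\<chi> b" by (simp add: ev_simps t tsum vec_eq_iff matrix_matrix_mult_def)
    show "?\<chi> (ftconst u) = mconst u" by (simp add: ev_simps mconst_def mat_def t t0 vec_eq_iff)
    show "?\<chi> (ftr a) = mtr (?\<chi> a)" by (simp add: ev_simps mtr_def mat_def trace_def t t0 tsum vec_eq_iff)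
    assume "A \<in> ?\<chi> ` ftgrade p"
    then obtain c where c: "c \<in> ftgrade p" "A = ?\<chi> c" by blast
    have "ev c \<in> (mgrade p :: 'n gmat set)" by (rule matrix_hom_grade[OF ev_trace_hom c(1)])
    then show "A \<in> mgrade p" using t(4) unfolding c(2) mgrade_def by simp
  qed
  moreover have "?\<chi> (ftx i) = \<psi> (ftx i)" "?\<chi> (fty i) = \<psi> (fty i)" for i
    by (simp_all add: ev_x ev_y xi_def eta_def \<theta> X_def Y_def vec_eq_iff)
  moreover have "\<exists>!\<phi>. matrix_hom \<phi> \<and> (\<forall>i. \<phi> (ftx i) = \<psi> (ftx i)) \<and> (\<forall>i. \<phi> (fty i) = \<psi> (fty i))"
    by (rule matr.free_trace_universal[OF x y])
  ultimately have "\<psi> = ?\<chi>" using \<psi> by blast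
  then have "\<psi> a = (\<chi> h k. \<theta> (ev a $ h $ k))" for a by (rule fun_cong)
  then show ?thesis using t0 by blast
qed

lemma ev_zero_matrix_hom:
  fixes \<psi> :: "ft \<Rightarrow> ('n::finite) gmat"
  assumes "matrix_hom \<psi>" "ev a = (0 :: 'n gmat)"
  shows "\<psi> a = 0"
proof -
  obtain \<theta> where "\<theta> 0 = 0" "\<forall>a. \<psi> a = (\<chi> h k. \<theta> (ev a $ h $ k))" using ev_generic[OF assms(1)] by blast
  then show ?thesis using assms(2) by (simp add: vec_eq_iff)
qed

definition matsubst :: "(nat \<Rightarrow> 'n gmat) \<Rightarrow> (nat \<Rightarrow> 'n gmat) \<Rightarrow> ft \<Rightarrow> ('n::finite) gmat" where
  "matsubst = ft_eval (**) mconst mtr"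

lemma matsubst:
  assumes "\<And>i. x i \<in> mgrade 1" "\<And>i. y i \<in> mgrade 0"
  shows "matrix_hom (matsubst x y)" "matsubst x y (ftx i) = x i" "matsubst x y (fty i) = y i"
  unfolding matsubst_def by (rule matr.ft_eval_simps[OF assms])+

section \<open>Permutations without long decreasing subsequences\<close>

definition decreasing :: "(nat \<Rightarrow> nat) \<Rightarrow> nat set \<Rightarrow> bool" where
  "decreasing \<sigma> D \<longleftrightarrow> (\<forall>i\<in>D. \<forall>j\<in>D. i < j \<longrightarrow> \<sigma> j < \<sigma> i)"

definition good_perm :: "nat \<Rightarrow> nat \<Rightarrow> (nat \<Rightarrow> nat) \<Rightarrow> bool" where
  "good_perm n m \<sigma> \<longleftrightarrow> (\<forall>D. D \<subseteq> {..<m} \<longrightarrow> decreasing \<sigma> D \<longrightarrow> card D \<noteq> n + 1)"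

definition lexlt :: "nat \<Rightarrow> (nat \<Rightarrow> nat) \<Rightarrow> (nat \<Rightarrow> nat) \<Rightarrow> bool" where
  "lexlt m \<sigma> \<tau> \<longleftrightarrow> (\<exists>p<m. (\<forall>i<p. \<sigma> i = \<tau> i) \<and> \<sigma> p < \<tau> p)"

lemma lexlt_irrefl: "\<not> lexlt m \<sigma> \<sigma>"
  by (auto simp: lexlt_def)

lemma lexlt_trans:
  assumes "lexlt m \<rho> \<sigma>" "lexlt m \<sigma> \<tau>" shows "lexlt m \<rho> \<tau>"
proof -
  obtain p where p: "p < m" "\<forall>i<p. \<rho> i = \<sigma> i" "\<rho> p < \<sigma> p" using assms(1) by (auto simp: lexlt_def)
  obtain q where q: "q < m" "\<forall>i<q. \<sigma> i = \<tau> i" "\<sigma> q < \<tau> q" using assms(2) by (auto simp: lexlt_def)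
  have "\<rho> (min p q) < \<tau> (min p q)"
    using p q by (cases p q rule: linorder_cases) (auto simp: min_def)
  then show ?thesis using p q unfolding lexlt_def by (intro exI[of _ "min p q"]) auto
qed

text \<open>
  The least moved point cannot be moved down, because all smaller points are fixed.
\<close>

lemma first_moved:
  assumes "\<rho> permutes {..<m :: nat}" "\<rho> \<noteq> id"
  obtains p where "p < m" "\<And>i. i < p \<Longrightarrow> \<rho> i = i" "p < \<rho> p" "\<rho> p < m"
proof -
  obtain x where "\<rho> x \<noteq> x" using assms(2) by fastforce
  define p where "p = (LEAST x. \<rho> x \<noteq> x)"
  have p: "\<rho> p \<noteq> p" unfolding p_def using \<open>\<rho> x \<noteq> x\<close> by (rule LeastI)
  have l: "\<rho> i = i" if "i < p" for i using that not_less_Least p_def by blast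
  have pm: "p < m" using p assms(1) by (metis lessThan_iff permutes_not_in)
  have "\<not> \<rho> p < p"
  proof
    assume "\<rho> p < p"
    then have "\<rho> (\<rho> p) = \<rho> p" by (rule l)
    then show False using p permutes_inj[OF assms(1)] by (metis injD)
  qed
  moreover have "\<rho> p < m" using pm permutes_in_image[OF assms(1), of p] by simp
  ultimately show ?thesis using that[of p] pm l p by simp
qed

text \<open>
  Colour \<open>i\<close> by the length of the longest decreasing subsequence ending at \<open>i\<close>.  A later index with a smaller
  value has a longer such subsequence, so the permutation is increasing on each colour class.
\<close>

lemma good_perm_coloring:
  assumes "\<sigma> permutes {..<m}" "good_perm n m \<sigma>"
  shows "\<exists>cl. (\<forall>i<m. cl i < n) \<and> (\<forall>i<m. \<forall>j<m. i < j \<longrightarrow> cl i = cl j \<longrightarrow> \<sigma> i < \<sigma> j)"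
proof -
  define F where "F i = {D. D \<subseteq> {..i} \<and> i \<in> D \<and> decreasing \<sigma> D}" for i
  define M where "M i = Max (card ` F i)" for i
  have "finite (F i)" for i by (rule finite_subset[of _ "Pow {..i}"]) (auto simp: F_def)
  then have fin: "finite (card ` F i)" for i by (rule finite_imageI)
  have F1: "{i} \<in> F i" for i by (simp add: F_def decreasing_def)
  have M1: "1 \<le> M i" for i unfolding M_def by (rule Max_ge[OF fin image_eqI[OF _ F1]]) simp
  have Mn: "M i \<le> n" if "i < m" for i
  proof -
    have "card D \<le> n" if D: "D \<in> F i" for D
    proof (rule ccontr)
      assume "\<not> card D \<le> n"
      then obtain E where E: "E \<subseteq> D" "card E = n + 1" using obtain_subset_with_card_n[of "n + 1" D] by auto
      have "decreasing \<sigma> E" "E \<subseteq> {..<m}" using D E(1) \<open>i < m\<close> unfolding F_def decreasing_def by auto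
      then show False using assms(2) E(2) by (auto simp: good_perm_def)
    qed
    then show ?thesis unfolding M_def using fin[of i] F1[of i] by (subst Max_le_iff) blast+
  qed
  have inc: "\<sigma> i < \<sigma> j" if ij: "i < j" "M i = M j" for i j
  proof (rule ccontr)
    assume "\<not> \<sigma> i < \<sigma> j"
    moreover have "\<sigma> i \<noteq> \<sigma> j" using permutes_inj[OF assms(1)] ij(1) by (metis injD nat_neq_iff)
    ultimately have gt: "\<sigma> j < \<sigma> i" by simp
    have "M i \<in> card ` F i" unfolding M_def by (rule Max_in[OF fin]) (use F1 in blast)
    then obtain D where D: "D \<in> F i" "card D = M i" by auto
    have D': "D \<subseteq> {..i}" "i \<in> D" "decreasing \<sigma> D" using D(1) by (auto simp: F_def)
    have below: "a < j" "\<sigma> j < \<sigma> a" if "a \<in> D" for a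
    proof -
      have "a \<le> i" using D'(1) that by auto
      then have "\<sigma> i \<le> \<sigma> a" using D'(2,3) that by (cases "a = i") (auto simp: decreasing_def intro: less_imp_le)
      with \<open>a \<le> i\<close> show "a < j" "\<sigma> j < \<sigma> a" using gt ij(1) by auto
    qed
    have "decreasing \<sigma> (insert j D)"
      unfolding decreasing_def
    proof (intro ballI impI)
      fix a b assume "a \<in> insert j D" "b \<in> insert j D" "a < b"
      then show "\<sigma> b < \<sigma> a" using D'(3) below(1)[of b] below(2)[of a] by (auto simp: decreasing_def)
    qed
    moreover have "insert j D \<subseteq> {..j}" using below(1) by (auto intro: less_imp_le)
    ultimately have "insert j D \<in> F j" by (simp add: F_def)
    then have "card (insert j D) \<le> M j" unfolding M_def by (intro Max_ge[OF fin] imageI)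
    moreover have "finite D" by (rule finite_subset[OF D'(1)]) simp
    moreover have "j \<notin> D" using below(1) by blast
    ultimately show False using D(2) ij(2) by simp
  qed
  have "M i - 1 < n" if "i < m" for i using M1[of i] Mn[OF that] by simp
  moreover have "\<sigma> i < \<sigma> j" if "i < j" "M i - 1 = M j - 1" for i j
    using inc[of i j] that M1[of i] M1[of j] by simp
  ultimately show ?thesis by (intro exI[of _ "\<lambda>i. M i - 1"]) blast
qed

text \<open>
  Suppose that \<open>\<sigma>\<close> is lexicographically maximal in the support of \<open>c\<close>, and colour its positions so
  that it increases on each colour class.  Let \<open>\<beta>\<close> be the colouring and \<open>\<alpha> = \<beta> \<circ> inv \<sigma>\<close>.  The permutations counted
  by the matrix coefficient of \<open>\<alpha>\<close> and \<open>\<beta>\<close> are \<open>\<sigma> \<circ> \<rho>\<close> with \<open>\<rho>\<close> preserving colours; at the first point that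
  \<open>\<rho>\<close> moves it takes a larger value than \<open>\<sigma>\<close>.  By maximality \<open>c \<sigma>\<close> is the only term.
\<close>

lemma good_perms_independent:
  fixes c :: "(nat \<Rightarrow> nat) \<Rightarrow> complex"
  assumes supp: "\<And>\<sigma>. \<sigma> permutes {..<m} \<Longrightarrow> \<not> good_perm CARD('n::finite) m \<sigma> \<Longrightarrow> c \<sigma> = 0"
    and L: "\<And>\<alpha> \<beta> :: nat \<Rightarrow> 'n. (\<Sum>\<sigma> | \<sigma> permutes {..<m} \<and> (\<forall>i<m. \<beta> i = \<alpha> (\<sigma> i)). c \<sigma>) = 0"
    and "\<sigma> permutes {..<m}"
  shows "c \<sigma> = 0"
proof (rule ccontr)
  assume "c \<sigma> \<noteq> 0"
  let ?X = "{\<sigma>. \<sigma> permutes {..<m} \<and> c \<sigma> \<noteq> 0}"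
  have "finite ?X" by (rule finite_subset[OF _ finite_permutations[of "{..<m}"]]) auto
  moreover have "?X \<noteq> {}" using assms(3) \<open>c \<sigma> \<noteq> 0\<close> by blast
  moreover have "transp_on ?X (lexlt m)" using lexlt_trans by (auto intro: transp_onI)
  moreover have "asymp_on ?X (lexlt m)" using lexlt_trans lexlt_irrefl by (blast intro: asymp_onI)
  ultimately obtain \<sigma> where \<sigma>: "\<sigma> \<in> ?X" "\<And>\<tau>. \<tau> \<in> ?X \<Longrightarrow> \<tau> \<noteq> \<sigma> \<Longrightarrow> \<not> lexlt m \<sigma> \<tau>"
    using Finite_Set.bex_max_element[of ?X "lexlt m"] by blast
  then have \<sigma>p: "\<sigma> permutes {..<m}" and c\<sigma>: "c \<sigma> \<noteq> 0" by auto
  have "good_perm CARD('n) m \<sigma>" using supp[OF \<sigma>p] c\<sigma> by metis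
  from good_perm_coloring[OF \<sigma>p this] obtain cl where
    "(\<forall>i<m. cl i < CARD('n)) \<and> (\<forall>i<m. \<forall>j<m. i < j \<longrightarrow> cl i = cl j \<longrightarrow> \<sigma> i < \<sigma> j)" ..
  then have cl: "i < m \<Longrightarrow> cl i < CARD('n)"
    "i < m \<Longrightarrow> j < m \<Longrightarrow> i < j \<Longrightarrow> cl i = cl j \<Longrightarrow> \<sigma> i < \<sigma> j" for i j
    by simp_all
  obtain h :: "nat \<Rightarrow> 'n" where h: "bij_betw h {0..<CARD('n)} UNIV" using ex_bij_betw_nat_finite[of "UNIV :: 'n set"] by auto
  define \<beta> where "\<beta> i = h (cl i)" for i
  define \<alpha> where "\<alpha> j = \<beta> (inv \<sigma> j)" for j
  let ?T = "{\<tau>. \<tau> permutes {..<m} \<and> (\<forall>i<m. \<beta> i = \<alpha> (\<tau> i))}"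
  have fT: "finite ?T" by (rule finite_subset[OF _ finite_permutations[of "{..<m}"]]) auto
  have "\<beta> i = \<alpha> (\<sigma> i)" for i using permutes_inverses(2)[OF \<sigma>p] by (simp add: \<alpha>_def)
  then have "\<sigma> \<in> ?T" using \<sigma>p by simp
  have "c \<tau> = 0" if \<tau>: "\<tau> \<in> ?T - {\<sigma>}" for \<tau>
  proof (rule ccontr)
    assume "c \<tau> \<noteq> 0"
    have \<tau>p: "\<tau> permutes {..<m}" using \<tau> by simp
    define \<rho> where "\<rho> = inv \<sigma> \<circ> \<tau>"
    have \<rho>: "\<rho> permutes {..<m}" unfolding \<rho>_def by (intro permutes_compose permutes_inv \<tau>p \<sigma>p)
    have \<sigma>\<rho>: "\<sigma> (\<rho> i) = \<tau> i" for i using permutes_inverses(1)[OF \<sigma>p] by (simp add: \<rho>_def)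
    then have "\<rho> \<noteq> id" using \<tau> by auto
    then obtain p where p: "p < m" "\<And>i. i < p \<Longrightarrow> \<rho> i = i" "p < \<rho> p" "\<rho> p < m" using first_moved[OF \<rho>] by blast
    have "\<beta> p = \<alpha> (\<tau> p)" using \<tau> p(1) by blast
    then have "h (cl p) = h (cl (\<rho> p))" by (simp add: \<alpha>_def \<beta>_def \<rho>_def)
    then have "cl p = cl (\<rho> p)" using h cl(1) p(1,4) by (auto simp: bij_betw_def inj_on_def)
    then have "\<sigma> p < \<tau> p" using cl(2)[OF p(1,4,3)] \<sigma>\<rho> by simp
    moreover have "\<sigma> i = \<tau> i" if "i < p" for i using \<sigma>\<rho>[of i] p(2)[OF that] by simp
    ultimately have "lexlt m \<sigma> \<tau>" using p(1) unfolding lexlt_def by blast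
    then show False using \<sigma>(2)[of \<tau>] \<tau> \<open>c \<tau> \<noteq> 0\<close> by auto
  qed
  then have "(\<Sum>\<tau>\<in>?T. c \<tau>) = (\<Sum>\<tau>\<in>{\<sigma>}. c \<tau>)"
    using fT \<open>\<sigma> \<in> ?T\<close> by (intro sum.mono_neutral_right) auto
  then show False using L[of \<beta> \<alpha>] c\<sigma> by simp
qed

section \<open>Multilinear identities\<close>

definition gvar :: "(nat \<Rightarrow> bit) \<Rightarrow> nat \<Rightarrow> ft" where
  "gvar \<delta> j = (if \<delta> j = 0 then fty j else ftx j)"

lemma gvar_homog: "homog (gvar \<delta>) \<delta> S"
proof -
  have "gvar \<delta> j \<in> ftgrade (\<delta> j)" for j by (cases "\<delta> j") (simp_all add: gvar_def ftgrade_x ftgrade_y)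
  then show ?thesis by (simp add: homog_def)
qed

text \<open>
  The multilinear monomials in the variables with index below \<open>N\<close>, and their linear combinations.  The hole
  is \<open>N\<close>, so the permutations are those of \<open>{..<Suc N}\<close>.
\<close>

definition mpsi :: "nat \<Rightarrow> (nat \<Rightarrow> bit) \<Rightarrow> (nat \<Rightarrow> nat) \<Rightarrow> ft" where
  "mpsi N \<delta> \<sigma> = psi {..<N} N \<sigma> (gvar \<delta>) \<delta>"

definition mcomb :: "nat \<Rightarrow> (nat \<Rightarrow> bit) \<Rightarrow> ((nat \<Rightarrow> nat) \<Rightarrow> complex) \<Rightarrow> ft" where
  "mcomb N \<delta> c = (\<Sum>\<sigma> | \<sigma> permutes {..<Suc N}. ftconst (c \<sigma>) * mpsi N \<delta> \<sigma>)"

text \<open>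
  The hole is filled with a further even variable, and the trace is taken, which turns the expression into
  one to which \<open>eval_psi\<close> applies.  Even variables are evaluated at elementary matrices, odd variables
  at elementary matrices times different odd generators, whose product is nonzero.
\<close>

lemma multilinear_coefficients:
  fixes \<alpha> \<beta> :: "nat \<Rightarrow> 'n::finite"
  assumes ev: "ev (mcomb N \<delta> c) = (0 :: 'n gmat)"
  shows "(\<Sum>\<sigma> | \<sigma> permutes {..<Suc N} \<and> (\<forall>i<Suc N. \<beta> i = \<alpha> (\<sigma> i)). c \<sigma>) = 0"
proof -
  fix h0 :: 'n
  let ?A = "{\<sigma>. \<sigma> permutes {..<Suc N}}"
  define \<psi> :: "ft \<Rightarrow> 'n gmat" where
    "\<psi> = matsubst (\<lambda>j. elem_mat (scodd (j, h0, h0)) (\<alpha> j) (\<beta> j)) (\<lambda>j. elem_mat 1 (\<alpha> j) (\<beta> j))"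
  have g1: "(1 :: 'n gen) \<in> scgrade 0" using scgrade_const[of 1] by simp
  have \<psi>: "matrix_hom \<psi>" "\<And>j. \<psi> (ftx j) = elem_mat (scodd (j, h0, h0)) (\<alpha> j) (\<beta> j)"
    "\<And>j. \<psi> (fty j) = elem_mat 1 (\<alpha> j) (\<beta> j)"
    unfolding \<psi>_def by (rule matsubst[OF elem_mat_grade[OF scgrade_odd] elem_mat_grade[OF g1]])+
  define a where "a = (gvar \<delta>)(N := fty N)"
  define d where "d = \<delta>(N := 0)"
  define \<zeta> :: "nat \<Rightarrow> 'n gen" where "\<zeta> j = (if d j = 0 then 1 else scodd (j, h0, h0))" for j
  have \<psi>a: "\<psi> (a i) = elem_mat (\<zeta> i) (\<alpha> i) (\<beta> i)" for i
    by (auto simp: a_def d_def \<zeta>_def gvar_def \<psi>)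
  have \<zeta>: "\<zeta> i \<in> scgrade (d i)" for i
    using g1 scgrade_odd by (cases "d i") (auto simp: \<zeta>_def)
  have ah: "homog a d {..<Suc N}"
    using gvar_homog[of \<delta> "{..<Suc N}"] ftgrade_y by (auto simp: homog_def a_def d_def)
  have ins: "insert N {..<N} = {..<Suc N}" by auto
  define Z where "Z = prod_list (map \<zeta> (sorted_list_of_set {..<Suc N}))"
  define k where "k = koszul_sign d (sorted_list_of_set {..<N} @ [N])"
  have trm: "\<psi> (ftr (mpsi N \<delta> \<sigma> * a N)) = mat (of_int k * (if \<forall>i<Suc N. \<beta> i = \<alpha> (\<sigma> i) then Z else 0))"
    if \<sigma>: "\<sigma> permutes {..<Suc N}" for \<sigma>
  proof -
    have ph: "perm_hole {..<N} N \<sigma>" using \<sigma> by (simp add: perm_hole_def ins)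
    have "mpsi N \<delta> \<sigma> = psi {..<N} N \<sigma> a d"
      unfolding mpsi_def by (rule psi_cong[OF ph gvar_homog]) (auto simp: a_def d_def)
    moreover have "ftr (psi {..<N} N \<sigma> a d * a N) = of_int k * psi {..<Suc N} (Suc N) \<sigma> a d"
      unfolding k_def ins[symmetric] using ah ins by (intro psi_close[OF ph]) auto
    moreover have "perm_hole {..<Suc N} (Suc N) \<sigma>" by (rule perm_holeI[OF _ _ _ \<sigma>]) auto
    moreover have "\<sigma> (Suc N) = Suc N" by (rule permutes_not_in[OF \<sigma>]) simp
    ultimately have "ftr (mpsi N \<delta> \<sigma> * a N) = of_int k * psi {..<Suc N} (Suc N) \<sigma> a d"
      and "\<psi> (psi {..<Suc N} (Suc N) \<sigma> a d) = mat (if \<forall>i\<in>{..<Suc N}. \<beta> i = \<alpha> (\<sigma> i) then Z else 0)"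
      unfolding Z_def using \<psi>a \<zeta> ah by (simp_all only: eval_psi[OF \<psi>(1)])
    moreover have "(\<forall>i\<in>{..<Suc N}. \<beta> i = \<alpha> (\<sigma> i)) = (\<forall>i<Suc N. \<beta> i = \<alpha> (\<sigma> i))" by blast
    ultimately show ?thesis
      by (simp only: matrix_hom_simps[OF \<psi>(1)] mat_mult_mat)
  qed
  let ?P = "\<lambda>\<sigma>. \<forall>i<Suc N. \<beta> i = \<alpha> (\<sigma> i)"
  have "\<psi> (ftr (mcomb N \<delta> c * a N)) = 0"
    using ev_zero_matrix_hom[OF \<psi>(1) ev] by (simp add: matrix_hom_simps[OF \<psi>(1)] trace_def)
  moreover have "ftr (mcomb N \<delta> c * a N) = (\<Sum>\<sigma>\<in>?A. ftconst (c \<sigma>) * ftr (mpsi N \<delta> \<sigma> * a N))"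
    by (simp add: mcomb_def sum_distrib_right ftr_sum mult.assoc ft.tr_scale)
  moreover have "\<psi> (\<Sum>\<sigma>\<in>?A. ftconst (c \<sigma>) * ftr (mpsi N \<delta> \<sigma> * a N)) =
      (\<Sum>\<sigma>\<in>?A. mat (scconst (c \<sigma>) * (of_int k * (if ?P \<sigma> then Z else 0))))"
    unfolding matrix_hom_sum[OF \<psi>(1)]
    by (intro sum.cong refl) (simp only: matrix_hom_simps(2,3)[OF \<psi>(1)] trm mem_Collect_eq mat_mult_mat)
  ultimately have "(\<Sum>\<sigma>\<in>?A. mat (scconst (c \<sigma>) * (of_int k * (if ?P \<sigma> then Z else 0)))) = (0 :: 'n gmat)"
    by simp
  then have "(\<Sum>\<sigma>\<in>?A. mat (scconst (c \<sigma>) * (of_int k * (if ?P \<sigma> then Z else 0))) :: 'n gmat) $ h0 $ h0 = 0"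
    by simp
  then have "(\<Sum>\<sigma>\<in>?A. scconst (c \<sigma>) * (of_int k * (if ?P \<sigma> then Z else 0))) = 0"
    by (simp add: mat_def)
  also have "(\<Sum>\<sigma>\<in>?A. scconst (c \<sigma>) * (of_int k * (if ?P \<sigma> then Z else 0))) =
      (\<Sum>\<sigma>\<in>?A. of_int k * (if ?P \<sigma> then scconst (c \<sigma>) * Z else 0))"
    by (intro sum.cong) (auto simp: of_int_left_commute)
  also have "\<dots> = of_int k * (\<Sum>\<sigma>\<in>?A. if ?P \<sigma> then scconst (c \<sigma>) * Z else 0)"
    by (simp add: sum_distrib_left)
  also have "(\<Sum>\<sigma>\<in>?A. if ?P \<sigma> then scconst (c \<sigma>) * Z else 0) = (\<Sum>\<sigma>\<in>{\<sigma>\<in>?A. ?P \<sigma>}. scconst (c \<sigma>) * Z)"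
    by (rule sum.inter_filter[symmetric]) (simp add: finite_permutations)
  also have "{\<sigma>\<in>?A. ?P \<sigma>} = {\<sigma>. \<sigma> permutes {..<Suc N} \<and> ?P \<sigma>}" by auto
  also have "(\<Sum>\<sigma> | \<sigma> permutes {..<Suc N} \<and> ?P \<sigma>. scconst (c \<sigma>) * Z) =
      scconst (\<Sum>\<sigma> | \<sigma> permutes {..<Suc N} \<and> ?P \<sigma>. c \<sigma>) * Z"
    by (simp add: scconst_sum sum_distrib_right)
  finally have z: "of_int k * (scconst (\<Sum>\<sigma> | \<sigma> permutes {..<Suc N} \<and> ?P \<sigma>. c \<sigma>) * Z) = 0" .
  have "of_int k * (of_int k * x) = x" for x :: "'n gen"
    by (simp add: k_def koszul_sign_sq flip: mult.assoc of_int_mult)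
  from this[of "scconst (\<Sum>\<sigma> | \<sigma> permutes {..<Suc N} \<and> ?P \<sigma>. c \<sigma>) * Z"]
  have Z0: "scconst (\<Sum>\<sigma> | \<sigma> permutes {..<Suc N} \<and> ?P \<sigma>. c \<sigma>) * Z = 0" unfolding z by simp
  have Z: "prod_list (map \<zeta> l) = prod_list (map scodd (map (\<lambda>j. (j, h0, h0)) (filter (\<lambda>j. d j \<noteq> 0) l)))" for l
    by (induction l) (auto simp: \<zeta>_def)
  have dist: "distinct (map (\<lambda>j. (j, h0, h0)) (filter (\<lambda>j. d j \<noteq> 0) (sorted_list_of_set {..<Suc N})))"
    by (intro distinct_map[THEN iffD2]) (auto simp: inj_on_def)
  show ?thesis
    by (rule odd_product_nonzero[OF dist Z0[unfolded Z_def Z]])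
qed

lemma mcomb_add: "mcomb N \<delta> (\<lambda>\<sigma>. c \<sigma> + c' \<sigma>) = mcomb N \<delta> c + mcomb N \<delta> c'"
  by (simp add: mcomb_def ftconst_add distrib_right sum.distrib)

lemma mcomb_scale: "mcomb N \<delta> (\<lambda>\<sigma>. u * c \<sigma>) = ftconst u * mcomb N \<delta> c"
  by (simp add: mcomb_def ftconst_mult mult.assoc sum_distrib_left)

lemma mcomb_single:
  assumes "\<sigma> permutes {..<Suc N}"
  shows "mcomb N \<delta> (\<lambda>\<tau>. if \<tau> = \<sigma> then 1 else 0) = mpsi N \<delta> \<sigma>"
proof -
  have "mcomb N \<delta> (\<lambda>\<tau>. if \<tau> = \<sigma> then 1 else 0) = (\<Sum>\<tau> | \<tau> permutes {..<Suc N}. if \<tau> = \<sigma> then mpsi N \<delta> \<sigma> else 0)"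
    unfolding mcomb_def by (rule sum.cong) auto
  also have "\<dots> = mpsi N \<delta> \<sigma>" using assms by (simp add: finite_permutations)
  finally show ?thesis .
qed

definition good_span :: "ft set \<Rightarrow> nat \<Rightarrow> nat \<Rightarrow> (nat \<Rightarrow> bit) \<Rightarrow> ft set" where
  "good_span I n N \<delta> = {f. \<exists>c. (\<forall>\<sigma>. \<sigma> permutes {..<Suc N} \<longrightarrow> \<not> good_perm n (Suc N) \<sigma> \<longrightarrow> c \<sigma> = 0) \<and>
     f - mcomb N \<delta> c \<in> I}"

context
  fixes I and n N :: nat and \<delta> :: "nat \<Rightarrow> bit"
  assumes I: "T_ideal I" and CH: "\<And>e f. e + f = n + 1 \<Longrightarrow> 1 \<le> f \<Longrightarrow> CH e f \<in> I"
begin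

lemma good_span_add: "f \<in> good_span I n N \<delta> \<Longrightarrow> g \<in> good_span I n N \<delta> \<Longrightarrow> f + g \<in> good_span I n N \<delta>"
proof -
  assume "f \<in> good_span I n N \<delta>" "g \<in> good_span I n N \<delta>"
  then obtain c c' where c: "\<forall>\<sigma>. \<sigma> permutes {..<Suc N} \<longrightarrow> \<not> good_perm n (Suc N) \<sigma> \<longrightarrow> c \<sigma> = 0" "f - mcomb N \<delta> c \<in> I"
    "\<forall>\<sigma>. \<sigma> permutes {..<Suc N} \<longrightarrow> \<not> good_perm n (Suc N) \<sigma> \<longrightarrow> c' \<sigma> = 0" "g - mcomb N \<delta> c' \<in> I"
    unfolding good_span_def by blast
  have "f + g - mcomb N \<delta> (\<lambda>\<sigma>. c \<sigma> + c' \<sigma>) = (f - mcomb N \<delta> c) + (g - mcomb N \<delta> c')"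
    by (simp add: mcomb_add)
  also have "\<dots> \<in> I" using c by (intro T_ideal_closed[OF I])
  finally show ?thesis using c unfolding good_span_def by (intro CollectI exI[of _ "\<lambda>\<sigma>. c \<sigma> + c' \<sigma>"]) auto
qed

lemma good_span_scale: "f \<in> good_span I n N \<delta> \<Longrightarrow> ftconst u * f \<in> good_span I n N \<delta>"
proof -
  assume "f \<in> good_span I n N \<delta>"
  then obtain c where c: "\<forall>\<sigma>. \<sigma> permutes {..<Suc N} \<longrightarrow> \<not> good_perm n (Suc N) \<sigma> \<longrightarrow> c \<sigma> = 0" "f - mcomb N \<delta> c \<in> I"
    unfolding good_span_def by blast
  have "ftconst u * f - mcomb N \<delta> (\<lambda>\<sigma>. u * c \<sigma>) = ftconst u * (f - mcomb N \<delta> c)"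
    by (simp add: mcomb_scale right_diff_distrib)
  also have "\<dots> \<in> I" using c by (intro T_ideal_closed[OF I])
  finally show ?thesis using c unfolding good_span_def by (intro CollectI exI[of _ "\<lambda>\<sigma>. u * c \<sigma>"]) auto
qed

lemma good_span_ideal: "f \<in> I \<Longrightarrow> f \<in> good_span I n N \<delta>"
  unfolding good_span_def by (intro CollectI exI[of _ "\<lambda>_. 0"]) (simp add: mcomb_def)

lemma good_span_sum: "(\<And>i. i \<in> A \<Longrightarrow> f i \<in> good_span I n N \<delta>) \<Longrightarrow> (\<Sum>i\<in>A. f i) \<in> good_span I n N \<delta>"
  by (induction A rule: infinite_finite_induct)
    (auto intro: good_span_add good_span_ideal T_ideal_closed(1)[OF I])

text \<open>
  If \<open>\<sigma>\<close> is decreasing on \<open>n + 1\<close> positions \<open>P\<close>, then composing it with a nontrivial permutation of \<open>P\<close> makes it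
  lexicographically smaller.  Antisymmetrization over \<open>P\<close> therefore expresses the monomial of \<open>\<sigma>\<close> modulo \<open>I\<close> by
  smaller ones.
\<close>

lemma good_span_mpsi:
  assumes "\<sigma> permutes {..<Suc N}" shows "mpsi N \<delta> \<sigma> \<in> good_span I n N \<delta>"
  using assms
proof (induction "card {\<tau>. \<tau> permutes {..<Suc N} \<and> lexlt (Suc N) \<tau> \<sigma>}" arbitrary: \<sigma> rule: less_induct)
  case (less \<sigma>)
  show ?case
  proof (cases "good_perm n (Suc N) \<sigma>")
    case True
    then show ?thesis
      unfolding good_span_def using mcomb_single[OF less.prems] T_ideal_closed(1)[OF I]
      by (intro CollectI exI[of _ "\<lambda>\<tau>. if \<tau> = \<sigma> then 1 else 0"]) auto
  next
    case False
    then obtain P where P: "P \<subseteq> {..<Suc N}" "decreasing \<sigma> P" "card P = n + 1" by (auto simp: good_perm_def)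
    have fP: "finite P" using P(1) by (rule finite_subset) simp
    have ins: "insert N {..<N} = {..<Suc N}" by auto
    let ?R = "{\<rho>. \<rho> permutes P}" and ?f = "\<lambda>\<rho>. of_int (sign \<rho>) * mpsi N \<delta> (\<sigma> \<circ> \<rho>)"
    have tot: "(\<Sum>\<rho>\<in>?R. ?f \<rho>) \<in> I"
      unfolding mpsi_def
      using antisymmetrized_in_T_ideal[OF I, of n "{..<N}" N \<sigma> P "gvar \<delta>" \<delta>] CH P less.prems gvar_homog ins by simp
    have "?f \<rho> \<in> good_span I n N \<delta>" if \<rho>: "\<rho> \<in> ?R - {id}" for \<rho>
    proof -
      have \<rho>P: "\<rho> permutes P" and \<rho>m: "\<rho> permutes {..<Suc N}" using \<rho> P(1) permutes_subset by auto
      obtain p where p: "p < Suc N" "\<And>i. i < p \<Longrightarrow> \<rho> i = i" "p < \<rho> p" "\<rho> p < Suc N"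
        using first_moved[OF \<rho>m] \<rho> by blast
      have "p \<in> P" using p(3) permutes_not_in[OF \<rho>P, of p] by fastforce
      moreover from this have "\<rho> p \<in> P" using permutes_in_image[OF \<rho>P] by blast
      ultimately have "\<sigma> (\<rho> p) < \<sigma> p" using P(2) p(3) by (auto simp: decreasing_def)
      then have lt: "lexlt (Suc N) (\<sigma> \<circ> \<rho>) \<sigma>" unfolding lexlt_def using p by (intro exI[of _ p]) auto
      have \<sigma>\<rho>: "(\<sigma> \<circ> \<rho>) permutes {..<Suc N}" by (intro permutes_compose \<rho>m less.prems)
      have "{\<tau>. \<tau> permutes {..<Suc N} \<and> lexlt (Suc N) \<tau> (\<sigma> \<circ> \<rho>)} \<subset> {\<tau>. \<tau> permutes {..<Suc N} \<and> lexlt (Suc N) \<tau> \<sigma>}"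
        using lt \<sigma>\<rho> lexlt_trans lexlt_irrefl by blast
      moreover have "finite {\<tau>. \<tau> permutes {..<Suc N} \<and> lexlt (Suc N) \<tau> \<sigma>}"
        by (rule finite_subset[OF _ finite_permutations[of "{..<Suc N}"]]) auto
      ultimately have "mpsi N \<delta> (\<sigma> \<circ> \<rho>) \<in> good_span I n N \<delta>"
        using \<sigma>\<rho> by (intro less.hyps psubset_card_mono)
      then show ?thesis using good_span_scale[of _ "of_int (sign \<rho>)"] by (simp add: ftconst_of_int)
    qed
    then have "ftconst (-1) * (\<Sum>\<rho>\<in>?R - {id}. ?f \<rho>) \<in> good_span I n N \<delta>" by (intro good_span_scale good_span_sum)
    moreover have "(\<Sum>\<rho>\<in>?R. ?f \<rho>) = mpsi N \<delta> \<sigma> + (\<Sum>\<rho>\<in>?R - {id}. ?f \<rho>)"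
      using finite_permutations[OF fP] permutes_id by (subst sum.remove[of _ id]) auto
    then have "mpsi N \<delta> \<sigma> = (\<Sum>\<rho>\<in>?R. ?f \<rho>) + ftconst (-1) * (\<Sum>\<rho>\<in>?R - {id}. ?f \<rho>)"
      by (simp add: ftconst_minus)
    ultimately show ?thesis using good_span_add[OF good_span_ideal[OF tot]] by simp
  qed
qed

end

theorem multilinear_identity_in_T_ideal:
  assumes I: "T_ideal I" and CH: "\<And>e f. e + f = CARD('n::finite) + 1 \<Longrightarrow> 1 \<le> f \<Longrightarrow> CH e f \<in> I"
    and Ik: "\<And>a. a \<in> I \<Longrightarrow> ev a = (0 :: 'n gmat)"
    and ev: "ev (mcomb N \<delta> c) = (0 :: 'n gmat)"
  shows "mcomb N \<delta> c \<in> I"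
proof -
  have "mcomb N \<delta> c \<in> good_span I CARD('n) N \<delta>"
    unfolding mcomb_def[of N \<delta> c]
    by (intro good_span_sum[OF I] good_span_scale[OF I] good_span_mpsi[OF I] CH) auto
  then obtain c' where c': "\<And>\<sigma>. \<sigma> permutes {..<Suc N} \<Longrightarrow> \<not> good_perm CARD('n) (Suc N) \<sigma> \<Longrightarrow> c' \<sigma> = 0"
    "mcomb N \<delta> c - mcomb N \<delta> c' \<in> I"
    unfolding good_span_def by blast
  have "ev (mcomb N \<delta> c) = ev (mcomb N \<delta> c - mcomb N \<delta> c') + (ev (mcomb N \<delta> c') :: 'n gmat)"
    using ev_simps(1)[of "mcomb N \<delta> c - mcomb N \<delta> c'" "mcomb N \<delta> c'"] by simp
  then have ev': "ev (mcomb N \<delta> c') = (0 :: 'n gmat)" using ev Ik[OF c'(2)] by simp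
  have "c' \<sigma> = 0" if "\<sigma> permutes {..<Suc N}" for \<sigma>
    by (rule good_perms_independent[OF c'(1) multilinear_coefficients[OF ev'] that])
  \<comment> \<open>The normal form modulo \<open>I\<close> is again an identity, so its coefficients vanish.\<close>
  then have "mcomb N \<delta> c' = 0" unfolding mcomb_def by (intro sum.neutral) auto
  then show ?thesis using c'(2) by simp
qed

section \<open>Trace monomials span\<close>

text \<open>
  Even numbers code the even variables and odd numbers the odd ones, so that the lemmas on words in
  natural numbers apply to words in the variables.
\<close>

definition gen :: "nat \<Rightarrow> ft" where
  "gen i = (if even i then fty (i div 2) else ftx (i div 2))"

definition gdeg :: "nat \<Rightarrow> bit" where
  "gdeg i = (if even i then 0 else 1)"

lemma gen_grade: "gen i \<in> ftgrade (gdeg i)"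
  by (simp add: gen_def gdeg_def ftgrade_x ftgrade_y)

lemma gen_homog: "homog gen gdeg S"
  by (simp add: homog_def gen_grade)

inductive_set cspan :: "ft set \<Rightarrow> ft set" for M where
  cspan_0: "0 \<in> cspan M"
| cspan_step: "m \<in> M \<Longrightarrow> f \<in> cspan M \<Longrightarrow> ftconst c * m + f \<in> cspan M"

lemma cspan_add: "f \<in> cspan M \<Longrightarrow> g \<in> cspan M \<Longrightarrow> f + g \<in> cspan M"
  by (induction rule: cspan.induct) (auto simp: add.assoc intro: cspan.intros)

lemma cspan_scale: "f \<in> cspan M \<Longrightarrow> ftconst c * f \<in> cspan M"
proof (induction rule: cspan.induct)
  case (cspan_step m f u)
  then have "ftconst (c * u) * m + ftconst c * f \<in> cspan M" by (intro cspan.cspan_step)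
  then show ?case by (simp add: ftconst_mult distrib_left mult.assoc)
qed (simp add: cspan_0)

lemma cspan_base: "m \<in> M \<Longrightarrow> m \<in> cspan M"
  using cspan_step[of m M 0 1] by (simp add: cspan_0)

lemma cspan_linear:
  assumes "f \<in> cspan M" "\<And>a b. F (a + b) = F a + F b" "\<And>c a. F (ftconst c * a) = ftconst c * F a"
    "\<And>m. m \<in> M \<Longrightarrow> F m \<in> cspan M'"
  shows "F f \<in> cspan M'"
  using assms(1)
proof induction
  case cspan_0
  have "F 0 = 0" using assms(3)[of 0 0] by simp
  then show ?case by (simp add: cspan.cspan_0)
next
  case (cspan_step m f c)
  then show ?case unfolding assms(2,3) by (intro cspan_add cspan_scale) (auto intro: assms(4))
qed

definition monomials :: "ft set" where
  "monomials = {trace_monomial gen ws u | ws u. True}"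

lemma trace_monomial_mult:
  "trace_monomial gen ws u * trace_monomial gen ws' u' = of_int (swap_sign (degsum gdeg u) (degsum gdeg (concat ws'))) * trace_monomial gen (ws @ ws') (u @ u')"
proof -
  let ?T = "traces gen ws" and ?T' = "traces gen ws'"
  let ?k = "swap_sign (degsum gdeg u) (degsum gdeg (concat ws'))"
  have "word gen u * ?T' = of_int ?k * (?T' * word gen u)"
    by (rule traces_central[OF gen_homog homog_word[OF gen_homog]])
  then have "?T * (word gen u * ?T') * word gen u' =
      of_int ?k * (?T * ?T' * (word gen u * word gen u'))"
    by (simp only: of_int_left_commute[of ?T] mult.assoc)
  then show ?thesis by (simp add: trace_monomial_def mult.assoc)
qed

lemma ftconst_left_commute: "a * (ftconst c * b) = ftconst c * (a * b)"
  by (metis ftconst_central mult.assoc)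

lemma monomials_span: "abs_ft t \<in> cspan monomials"
proof (induction t)
  case (FX i)
  have "trace_monomial gen [] [2 * i + 1] = ftx i" by (simp add: trace_monomial_def gen_def)
  then have "ftx i \<in> monomials" unfolding monomials_def by (metis (mono_tags, lifting) mem_Collect_eq)
  then show ?case by (simp add: abs_ft_simps cspan_base)
next
  case (FY i)
  have "trace_monomial gen [] [2 * i] = fty i" by (simp add: trace_monomial_def gen_def)
  then have "fty i \<in> monomials" unfolding monomials_def by (metis (mono_tags, lifting) mem_Collect_eq)
  then show ?case by (simp add: abs_ft_simps cspan_base)
next
  case (FConst c)
  have "trace_monomial gen [] [] = 1" by (simp add: trace_monomial_def)
  then have "1 \<in> monomials" unfolding monomials_def by (metis (mono_tags, lifting) mem_Collect_eq)
  from cspan_scale[OF cspan_base[OF this], of c] show ?case by (simp add: abs_ft_simps)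
next
  case (FAdd s t)
  then show ?case by (simp add: abs_ft_simps cspan_add)
next
  case (FMul s t)
  have mm: "m * m' \<in> cspan monomials" if M: "m \<in> monomials" "m' \<in> monomials" for m m'
  proof -
    obtain ws u ws' u' where m: "m = trace_monomial gen ws u" "m' = trace_monomial gen ws' u'"
      using M unfolding monomials_def by blast
    have "trace_monomial gen (ws @ ws') (u @ u') \<in> cspan monomials"
      by (rule cspan_base) (auto simp: monomials_def)
    from cspan_scale[OF this, of "of_int (swap_sign (degsum gdeg u) (degsum gdeg (concat ws')))"]
    show ?thesis unfolding m trace_monomial_mult by (simp add: ftconst_of_int)
  qed
  have mt: "m * abs_ft t \<in> cspan monomials" if m: "m \<in> monomials" for m
    using FMul.IH(2)
    by (rule cspan_linear[where F = "\<lambda>a. m * a"]) (simp_all add: distrib_left mm m ftconst_left_commute)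
  show ?case unfolding abs_ft_simps
    by (rule cspan_linear[where F = "\<lambda>a. a * abs_ft t", OF FMul.IH(1)]) (simp_all add: distrib_right mult.assoc mt)
next
  case (FTr t)
  have tm: "ftr m \<in> cspan monomials" if "m \<in> monomials" for m
  proof -
    obtain ws u where "m = trace_monomial gen ws u" using \<open>m \<in> monomials\<close> unfolding monomials_def by blast
    then have "ftr m = trace_monomial gen (ws @ [u]) []" by (simp only: ftr_trace_monomial)
    then show ?thesis unfolding monomials_def by (intro cspan_base) blast
  qed
  show ?case unfolding abs_ft_simps
    by (rule cspan_linear[where F = ftr, OF FTr.IH]) (simp_all add: ftr_add ft.tr_scale tm)
qed

lemma monomials_span_UNIV: "f \<in> cspan monomials"
  using monomials_span[of "rep_ft f"] by (simp add: abs_rep_ft)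

text \<open>
  The letters of a list of words, replaced by their positions when counted from \<open>k\<close> onwards.  A
  monomial with repeated variables thus becomes a multilinear one with the letters substituted.
\<close>

fun positions :: "nat \<Rightarrow> nat list list \<Rightarrow> nat list list" where
  "positions k [] = []"
| "positions k (w # ws) = [k..<k + length w] # positions (k + length w) ws"

lemma positions_concat: "concat (positions k ws) = [k..<k + length (concat ws)]"
proof (induction ws arbitrary: k)
  case (Cons w ws)
  then show ?case using upt_add_eq_append[of k "k + length w" "length (concat ws)"] by (simp add: add.assoc)
qed simp

lemma positions_map:
  "(\<And>i. i < length (concat ws) \<Longrightarrow> \<gamma> (k + i) = concat ws ! i) \<Longrightarrow> map (map \<gamma>) (positions k ws) = ws"
proof (induction ws arbitrary: k)
  case (Cons w ws)
  have "map \<gamma> [k..<k + length w] = w"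
  proof (rule nth_equalityI)
    fix i assume "i < length (map \<gamma> [k..<k + length w])"
    then have "i < length w" by simp
    then show "map \<gamma> [k..<k + length w] ! i = w ! i" using Cons.prems[of i] by (simp add: nth_append)
  qed simp
  moreover have "map (map \<gamma>) (positions (k + length w) ws) = ws"
  proof (rule Cons.IH)
    fix i assume "i < length (concat ws)"
    then show "\<gamma> (k + length w + i) = concat ws ! i" using Cons.prems[of "length w + i"] by (simp add: nth_append add.assoc)
  qed
  ultimately show ?case by simp
qed simp

lemma positions_nonempty: "[] \<notin> set ws \<Longrightarrow> [] \<notin> set (positions k ws)"
  by (induction ws arbitrary: k) (auto simp: eq_commute[of "[]"])

definition arrangement :: "nat \<Rightarrow> nat list list \<Rightarrow> nat list \<Rightarrow> bool" where
  "arrangement N ws u \<longleftrightarrow> distinct (concat ws @ u) \<and> set (concat ws @ u) = {..<N} \<and> [] \<notin> set ws"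

lemma monomial_arrangement:
  assumes "[] \<notin> set ws"
  shows "\<exists>N \<gamma> ws' u'. arrangement N ws' u' \<and> trace_monomial gen ws u = trace_monomial (gen \<circ> \<gamma>) ws' u'"
proof -
  let ?L = "concat ws @ u" and ?k = "length (concat ws)"
  let ?ws = "positions 0 ws" and ?u = "[?k..<?k + length u]"
  have c: "concat ?ws @ ?u = [0..<length ?L]"
    using upt_add_eq_append[of 0 ?k "length u"] by (simp add: positions_concat)
  have "map (map (nth ?L)) ?ws = ws"
    by (rule positions_map) (simp add: nth_append)
  moreover have "map (nth ?L) ?u = u"
    by (rule nth_equalityI) (auto simp: nth_append)
  moreover have "trace_monomial (gen \<circ> nth ?L) ?ws ?u = trace_monomial gen (map (map (nth ?L)) ?ws) (map (nth ?L) ?u)"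
    by (simp add: trace_monomial_def o_def)
  moreover have "arrangement (length ?L) ?ws ?u"
    unfolding arrangement_def c using positions_nonempty[OF assms] by auto
  ultimately show ?thesis by metis
qed

section \<open>Multi-additive expansion\<close>

definition multi_additive :: "nat set \<Rightarrow> ((nat \<Rightarrow> ft) \<Rightarrow> ft) \<Rightarrow> bool" where
  "multi_additive S F \<longleftrightarrow> (\<forall>i\<in>S. \<forall>a x y. F (a(i := x + y)) = F (a(i := x)) + F (a(i := y))) \<and>
     (\<forall>a b. (\<forall>i\<in>S. a i = b i) \<longrightarrow> F a = F b)"

lemma multi_additive_slot_sum:
  assumes "multi_additive S F" "i \<in> S" "finite A"
  shows "F (a(i := \<Sum>j\<in>A. x j)) = (\<Sum>j\<in>A. F (a(i := x j)))"
proof -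
  have ad: "F (a(i := x + y)) = F (a(i := x)) + F (a(i := y))" for x y using assms(1,2) by (auto simp: multi_additive_def)
  have z: "F (a(i := 0)) = 0" using ad[of 0 0] by simp
  show ?thesis using assms(3)
    by (induction A rule: finite_induct) (simp_all only: sum.empty sum.insert ad z not_False_eq_True)
qed

lemma multi_additive_expand:
  fixes b :: "nat \<Rightarrow> 'j \<Rightarrow> ft"
  assumes "finite S" "multi_additive S F" "\<And>i. i \<in> S \<Longrightarrow> finite (A i)"
  shows "F (\<lambda>i. \<Sum>j\<in>A i. b i j) = (\<Sum>\<kappa>\<in>PiE S A. F (\<lambda>i. b i (\<kappa> i)))"
  using assms
proof (induction S arbitrary: F rule: finite_induct)
  case empty
  have "F (\<lambda>i. \<Sum>j\<in>A i. b i j) = F (\<lambda>i. b i undefined)"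
    using empty unfolding multi_additive_def by blast
  then show ?case by simp
next
  case (insert i S)
  let ?a = "\<lambda>i. \<Sum>j\<in>A i. b i j"
  have ma: "multi_additive S (\<lambda>a. F (a(i := b i j)))" for j
    unfolding multi_additive_def
  proof (intro conjI ballI allI impI)
    fix k a x y assume "k \<in> S"
    then have t: "a(k := z, i := b i j) = (a(i := b i j))(k := z)" for z
      using insert.hyps(2) by (intro fun_upd_twist) auto
    show "F (a(k := x + y, i := b i j)) = F (a(k := x, i := b i j)) + F (a(k := y, i := b i j))"
      unfolding t using insert.prems(1) \<open>k \<in> S\<close> unfolding multi_additive_def by blast
  next
    fix a a' :: "nat \<Rightarrow> ft" assume "\<forall>i\<in>S. a i = a' i"
    then have "\<forall>k\<in>insert i S. (a(i := b i j)) k = (a'(i := b i j)) k" by simp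
    then show "F (a(i := b i j)) = F (a'(i := b i j))" using insert.prems(1) unfolding multi_additive_def by blast
  qed
  have "F ?a = F (?a(i := \<Sum>j\<in>A i. b i j))" by (rule arg_cong[of _ _ F]) (auto simp: fun_eq_iff)
  also have "\<dots> = (\<Sum>j\<in>A i. F (?a(i := b i j)))"
    by (rule multi_additive_slot_sum[OF insert.prems(1)]) (use insert.prems(2) in auto)
  also have "\<dots> = (\<Sum>j\<in>A i. \<Sum>\<kappa>\<in>PiE S A. F ((\<lambda>k. b k (\<kappa> k))(i := b i j)))"
    by (intro sum.cong refl insert.IH[OF ma] insert.prems(2)) auto
  also have "\<dots> = (\<Sum>(j, \<kappa>)\<in>A i \<times> PiE S A. F ((\<lambda>k. b k (\<kappa> k))(i := b i j)))"
    by (rule sum.cartesian_product)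
  also have "\<dots> = (\<Sum>\<kappa>\<in>PiE (insert i S) A. F (\<lambda>k. b k (\<kappa> k)))"
  proof (rule sum.reindex_bij_witness[of _ "\<lambda>\<kappa>. (\<kappa> i, \<kappa>(i := undefined))" "\<lambda>(j, \<kappa>). \<kappa>(i := j)"])
    fix p assume p: "p \<in> A i \<times> PiE S A"
    obtain j \<kappa> where [simp]: "p = (j, \<kappa>)" by (cases p)
    have k: "\<kappa> \<in> PiE S A" "j \<in> A i" using p by auto
    have u: "\<kappa> i = undefined" using k insert.hyps(2) by (simp add: PiE_def extensional_def)
    show "(\<lambda>\<kappa>. (\<kappa> i, \<kappa>(i := undefined))) ((\<lambda>(j, \<kappa>). \<kappa>(i := j)) p) = p" using u by (auto simp: fun_eq_iff)
    show "(\<lambda>(j, \<kappa>). \<kappa>(i := j)) p \<in> PiE (insert i S) A" using k by (auto simp: PiE_def extensional_def Pi_def)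
    show "F (\<lambda>k. b k (((\<lambda>(j, \<kappa>). \<kappa>(i := j)) p) k)) = (\<lambda>(j, \<kappa>). F ((\<lambda>k. b k (\<kappa> k))(i := b i j))) p"
      by (simp add: fun_upd_def if_distrib cong: if_cong)
  next
    fix \<kappa> assume k: "\<kappa> \<in> PiE (insert i S) A"
    show "(\<lambda>(j, \<kappa>). \<kappa>(i := j)) (\<kappa> i, \<kappa>(i := undefined)) = \<kappa>" by simp
    show "(\<kappa> i, \<kappa>(i := undefined)) \<in> A i \<times> PiE S A"
      using k insert.hyps(2) by (auto simp: PiE_def extensional_def Pi_def)
  qed
  finally show ?case .
qed

lemma prod_slot_additive:
  "distinct w \<Longrightarrow> i \<in> set w \<Longrightarrow>
    word (a(i := (x :: ft) + y)) w = word (a(i := x)) w + word (a(i := y)) w"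
proof (induction w)
  case (Cons j w)
  have out: "word (a(i := z)) w = word a w" if "i \<notin> set w" for z
    using that by (intro arg_cong[of _ _ prod_list] map_cong) auto
  show ?case
  proof (cases "j = i")
    case True
    then have ni: "i \<notin> set w" using Cons.prems by simp
    show ?thesis unfolding True list.map prod_list.Cons out[OF ni] fun_upd_same by (rule distrib_right)
  next
    case False
    then show ?thesis using Cons by (simp add: distrib_left)
  qed
qed simp

lemma traces_slot_additive:
  "distinct (concat ws) \<Longrightarrow> i \<in> set (concat ws) \<Longrightarrow>
    traces (a(i := x + y)) ws =
    traces (a(i := x)) ws +
    traces (a(i := y)) ws"
proof (induction ws)
  case (Cons w ws)
  have out: "traces (a(i := z)) ws = traces a ws"
    if "i \<notin> set (concat ws)" for z
    using that by (intro arg_cong[of _ _ prod_list] map_cong refl arg_cong[of _ _ ftr]) auto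
  have out': "word (a(i := z)) w = word a w" if "i \<notin> set w" for z
    using that by (intro arg_cong[of _ _ prod_list] map_cong) auto
  show ?case
  proof (cases "i \<in> set w")
    case True
    then have ni: "i \<notin> set (concat ws)" and dw: "distinct w" using Cons.prems(1) by auto
    show ?thesis
      unfolding list.map prod_list.Cons out[OF ni] prod_slot_additive[OF dw True] ftr_add distrib_right ..
  next
    case False
    then have "traces (a(i := x + y)) ws =
      traces (a(i := x)) ws +
      traces (a(i := y)) ws"
      using Cons by (intro Cons.IH) auto
    then show ?thesis unfolding list.map prod_list.Cons out'[OF False] by (simp add: distrib_left)
  qed
qed simp

lemma trace_monomial_multi_additive:
  assumes "distinct (concat ws @ u)" "set (concat ws @ u) = S"
  shows "multi_additive S (\<lambda>a. trace_monomial a ws u)"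
  unfolding multi_additive_def
proof (intro conjI ballI allI impI)
  fix i a x y assume "i \<in> S"
  then consider "i \<in> set (concat ws)" "i \<notin> set u" | "i \<notin> set (concat ws)" "i \<in> set u"
    using assms by auto
  then show "trace_monomial (a(i := x + y)) ws u = trace_monomial (a(i := x)) ws u + trace_monomial (a(i := y)) ws u"
  proof cases
    case 1
    then have out: "word (a(i := z)) u = word a u" for z
      by (intro arg_cong[of _ _ prod_list] map_cong) auto
    have "distinct (concat ws)" using assms(1) by simp
    then show ?thesis
      unfolding trace_monomial_def out by (simp only: traces_slot_additive[OF _ 1(1)]) (rule distrib_right)
  next
    case 2
    then have out: "traces (a(i := z)) ws = traces a ws" for z
      by (intro arg_cong[of _ _ prod_list] map_cong refl arg_cong[of _ _ ftr]) auto
    have "distinct u" using assms(1) by simp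
    then show ?thesis
      unfolding trace_monomial_def out by (simp only: prod_slot_additive[OF _ 2(2)]) (rule distrib_left)
  qed
next
  fix a b :: "nat \<Rightarrow> ft" assume "\<forall>i\<in>S. a i = b i"
  then show "trace_monomial a ws u = trace_monomial b ws u" using assms(2) by (intro trace_monomial_cong) auto
qed

section \<open>Polarization\<close>

text \<open>
  For \<open>x\<close> in \<open>U - A\<close>, adding or removing \<open>x\<close> pairs the sets of the sum with opposite signs.
\<close>

lemma alternating_superset_sum:
  assumes "finite U" "A \<subseteq> U"
  shows "(\<Sum>B | A \<subseteq> B \<and> B \<subseteq> U. (-1 :: int) ^ card (U - B)) = (if A = U then 1 else 0)"
proof (cases "A = U")
  case True
  then have "{B. A \<subseteq> B \<and> B \<subseteq> U} = {U}" by auto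
  then show ?thesis using True by simp
next
  case False
  then obtain x where x: "x \<in> U" "x \<notin> A" using assms(2) by auto
  let ?X = "{B. A \<subseteq> B \<and> B \<subseteq> U}" and ?t = "\<lambda>B. if x \<in> B then B - {x} else insert x B"
  have "(\<Sum>B\<in>?X. (-1 :: int) ^ card (U - B)) = (\<Sum>B\<in>?X. - ((-1) ^ card (U - B)))"
  proof (rule sum.reindex_bij_witness[of _ ?t ?t])
    fix B assume B: "B \<in> ?X"
    show "?t (?t B) = B" by auto
    show "?t B \<in> ?X" using B x by auto
    have fin: "finite (U - B)" using assms(1) by simp
    show "- ((-1 :: int) ^ card (U - ?t B)) = (-1) ^ card (U - B)"
    proof (cases "x \<in> B")
      case True
      then have "U - ?t B = insert x (U - B)" using x by auto
      then show ?thesis using True fin by simp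
    next
      case False
      then have "U - B = insert x (U - ?t B)" "x \<notin> U - ?t B" using x by auto
      then have "card (U - B) = Suc (card (U - ?t B))" using fin by (metis card_insert_disjoint finite_insert)
      then show ?thesis by simp
    qed
  qed (use x in auto)
  then have "(\<Sum>B\<in>?X. (-1 :: int) ^ card (U - B)) = 0" by (simp add: sum_negf)
  then show ?thesis using False by simp
qed

text \<open>
  The product of the cycles, one of which is the open word followed by the hole.
\<close>

lemma arrangement_permutation:
  assumes "arrangement N ws u"
  shows "\<exists>\<sigma>. \<sigma> permutes {..<Suc N} \<and> display {..<N} N \<sigma> ws u"
proof -
  let ?vs = "ws @ [u @ [N]]"
  have "distinct (concat vs) \<Longrightarrow> \<exists>\<sigma>. \<sigma> permutes set (concat vs) \<and> (\<forall>w\<in>set vs. map \<sigma> w = rotate1 w)" for vs :: "nat list list"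
  proof (induction vs)
    case Nil
    show ?case using permutes_id by (intro exI[of _ id]) auto
  next
    case (Cons w vs)
    then obtain \<sigma> where \<sigma>: "\<sigma> permutes set (concat vs)" "\<And>v. v \<in> set vs \<Longrightarrow> map \<sigma> v = rotate1 v" by auto
    have dw: "distinct w" and dj: "set w \<inter> set (concat vs) = {}" using Cons.prems by auto
    let ?\<tau> = "cycle_of_list w \<circ> \<sigma>"
    have w: "map ?\<tau> w = rotate1 w"
    proof -
      have "map ?\<tau> w = map (cycle_of_list w) w"
        using dj permutes_not_in[OF \<sigma>(1)] by (intro map_cong) (auto simp: disjoint_iff)
      then show ?thesis using cyclic_rotation[OF dw, of 1] by (simp del: map_map map_eq_conv)
    qed
    have v: "map ?\<tau> v = rotate1 v" if "v \<in> set vs" for v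
    proof -
      have "set (map \<sigma> v) \<subseteq> set (concat vs)" using \<sigma>(2)[OF that] that by auto
      then have "map (cycle_of_list w) (map \<sigma> v) = map \<sigma> v"
        using dj by (intro map_idI id_outside_supp) auto
      then show ?thesis using \<sigma>(2)[OF that] by (metis map_map)
    qed
    have "?\<tau> permutes set (concat (w # vs))"
      using cycle_permutes[of w] \<sigma>(1) by (intro permutes_compose) (auto intro: permutes_subset)
    moreover have "\<forall>v\<in>set (w # vs). map ?\<tau> v = rotate1 v" using w v by (metis set_ConsD)
    ultimately show ?case by blast
  qed
  moreover have "distinct (concat ?vs)" using assms by (auto simp: arrangement_def)
  ultimately obtain \<sigma> where \<sigma>: "\<sigma> permutes set (concat ?vs)" "\<And>w. w \<in> set ?vs \<Longrightarrow> map \<sigma> w = rotate1 w" by metis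
  have "set (concat ?vs) = insert N (set (concat ws @ u))" by auto
  also have "\<dots> = {..<Suc N}" using assms by (auto simp: arrangement_def)
  finally have "\<sigma> permutes {..<Suc N}" using \<sigma>(1) by simp
  moreover have "display {..<N} N \<sigma> ws u"
  proof -
    have "map \<sigma> (u @ [N]) = rotate1 (u @ [N])" by (rule \<sigma>(2)) simp
    moreover have "\<forall>w\<in>set ws. map \<sigma> w = rotate1 w" using \<sigma>(2) by simp
    ultimately show ?thesis using assms unfolding arrangement_def display_def by blast
  qed
  ultimately show ?thesis by blast
qed

lemma arrangement_mcomb:
  assumes "arrangement N ws u"
  shows "\<exists>c. trace_monomial (gvar \<delta>) ws u = mcomb N \<delta> c"
proof -
  obtain \<sigma> where \<sigma>: "\<sigma> permutes {..<Suc N}" "display {..<N} N \<sigma> ws u" using arrangement_permutation[OF assms] by blast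
  let ?k = "koszul_sign \<delta> (concat ws @ u)"
  have "mpsi N \<delta> \<sigma> = of_int ?k * trace_monomial (gvar \<delta>) ws u"
    unfolding mpsi_def psi_eq[OF \<sigma>(2) gvar_homog] val_def ..
  then have "trace_monomial (gvar \<delta>) ws u = of_int ?k * mpsi N \<delta> \<sigma>"
    by (simp add: koszul_sign_sq flip: mult.assoc of_int_mult)
  also have "\<dots> = mcomb N \<delta> (\<lambda>\<tau>. of_int ?k * (if \<tau> = \<sigma> then 1 else 0))"
    unfolding mcomb_scale mcomb_single[OF \<sigma>(1)] ftconst_of_int ..
  finally show ?thesis by blast
qed

lemma ftgrade_sum: "(\<And>i. i \<in> A \<Longrightarrow> f i \<in> ftgrade p) \<Longrightarrow> (\<Sum>i\<in>A. f i) \<in> ftgrade p"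
  by (induction A rule: infinite_finite_induct) (auto simp: ftgrade_zero ftgrade_add)

lemma gvar_grade: "gvar \<delta> j \<in> ftgrade (\<delta> j)"
  using gvar_homog[of \<delta> "{j}"] by (simp add: homog_def)

text \<open>
  The slots below some bound are assigned to the variables by \<open>\<gamma>\<close>; the slot \<open>j\<close> carries a variable with index \<open>j\<close> and
  with the degree of \<open>gen (\<gamma> j)\<close>.  Each variable is replaced by the sum of its slots in \<open>B\<close>.
\<close>

definition polar :: "(nat \<Rightarrow> nat) \<Rightarrow> nat set \<Rightarrow> ft \<Rightarrow> ft" where
  "polar \<gamma> B = subst (\<lambda>i. \<Sum>j | j \<in> B \<and> \<gamma> j = 2 * i + 1. gvar (gdeg \<circ> \<gamma>) j)
     (\<lambda>i. \<Sum>j | j \<in> B \<and> \<gamma> j = 2 * i. gvar (gdeg \<circ> \<gamma>) j)"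

lemma polar:
  shows "substitution (polar \<gamma> B)" "polar \<gamma> B (gen l) = (\<Sum>j | j \<in> B \<and> \<gamma> j = l. gvar (gdeg \<circ> \<gamma>) j)"
proof -
  have g: "gvar (gdeg \<circ> \<gamma>) j \<in> ftgrade (gdeg (\<gamma> j))" for j using gvar_grade[of "gdeg \<circ> \<gamma>" j] by simp
  have x: "(\<Sum>j | j \<in> B \<and> \<gamma> j = 2 * i + 1. gvar (gdeg \<circ> \<gamma>) j) \<in> ftgrade 1" for i
  proof (rule ftgrade_sum)
    fix j assume "j \<in> {j. j \<in> B \<and> \<gamma> j = 2 * i + 1}"
    then show "gvar (gdeg \<circ> \<gamma>) j \<in> ftgrade 1" using g[of j] by (simp add: gdeg_def)
  qed
  have y: "(\<Sum>j | j \<in> B \<and> \<gamma> j = 2 * i. gvar (gdeg \<circ> \<gamma>) j) \<in> ftgrade 0" for i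
  proof (rule ftgrade_sum)
    fix j assume "j \<in> {j. j \<in> B \<and> \<gamma> j = 2 * i}"
    then show "gvar (gdeg \<circ> \<gamma>) j \<in> ftgrade 0" using g[of j] by (simp add: gdeg_def)
  qed
  show "substitution (polar \<gamma> B)" unfolding polar_def by (rule subst(1)[OF x y])
  show "polar \<gamma> B (gen l) = (\<Sum>j | j \<in> B \<and> \<gamma> j = l. gvar (gdeg \<circ> \<gamma>) j)"
  proof (cases "even l")
    case True
    then have "gen l = fty (l div 2)" "2 * (l div 2) = l" by (auto simp: gen_def)
    then show ?thesis unfolding polar_def by (simp only: subst(3)[OF x y])
  next
    case False
    then have "gen l = ftx (l div 2)" "2 * (l div 2) + 1 = l" by (auto simp: gen_def)
    then show ?thesis unfolding polar_def by (simp only: subst(2)[OF x y])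
  qed
qed

text \<open>
  The alternating sum over the sets of slots keeps those terms in which all slots occur.  Hence monomials
  of degree less than \<open>N\<close> vanish, and a monomial of degree \<open>N\<close> becomes the sum of its multilinear
  versions, or vanishes if it does not contain each variable as often as \<open>\<gamma>\<close> does.
\<close>

definition polarization :: "(nat \<Rightarrow> nat) \<Rightarrow> nat \<Rightarrow> ft \<Rightarrow> ft" where
  "polarization \<gamma> N f = (\<Sum>B\<in>Pow {..<N}. of_int ((-1) ^ card ({..<N} - B)) * polar \<gamma> B f)"

text \<open>
  The ways of assigning to each letter of a monomial a slot of the same variable such that all slots
  are used.
\<close>

definition labellings :: "(nat \<Rightarrow> nat) \<Rightarrow> nat \<Rightarrow> (nat \<Rightarrow> nat) \<Rightarrow> nat \<Rightarrow> (nat \<Rightarrow> nat) set" where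
  "labellings \<gamma> N \<gamma>' N' = {\<kappa> \<in> PiE {..<N'} (\<lambda>i. {j \<in> {..<N}. \<gamma> j = \<gamma>' i}). \<kappa> ` {..<N'} = {..<N}}"

lemma finite_labellings: "finite (labellings \<gamma> N \<gamma>' N')"
  unfolding labellings_def by (rule finite_subset[OF _ finite_PiE[of "{..<N'}" "\<lambda>i. {j \<in> {..<N}. \<gamma> j = \<gamma>' i}"]]) auto

lemma polarization_linear:
  "polarization \<gamma> N (\<Sum>k\<in>K. ftconst (c k) * f k) = (\<Sum>k\<in>K. ftconst (c k) * polarization \<gamma> N (f k))"
proof -
  have "polarization \<gamma> N (\<Sum>k\<in>K. ftconst (c k) * f k) =
    (\<Sum>B\<in>Pow {..<N}. \<Sum>k\<in>K. ftconst (c k) * (of_int ((-1) ^ card ({..<N} - B)) * polar \<gamma> B (f k)))"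
    unfolding polarization_def substitution_sum[OF polar(1)] sum_distrib_left
      substitution_simps(2,3)[OF polar(1)] ftconst_left_commute[of "of_int _"] ..
  also have "\<dots> = (\<Sum>k\<in>K. ftconst (c k) * polarization \<gamma> N (f k))"
    unfolding polarization_def sum_distrib_left by (rule sum.swap)
  finally show ?thesis .
qed

lemma polarization_monomial:
  assumes "arrangement N' ws u"
  shows "polarization \<gamma> N (trace_monomial (gen \<circ> \<gamma>') ws u) =
    (\<Sum>\<kappa>\<in>labellings \<gamma> N \<gamma>' N'. trace_monomial (gvar (gdeg \<circ> \<gamma>) \<circ> \<kappa>) ws u)"
proof -
  let ?U = "{..<N}" and ?K = "PiE {..<N'} (\<lambda>i. {j \<in> {..<N}. \<gamma> j = \<gamma>' i})"
  let ?T = "\<lambda>\<kappa>. trace_monomial (gvar (gdeg \<circ> \<gamma>) \<circ> \<kappa>) ws u"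
  have fK: "finite ?K" by (rule finite_PiE) auto
  have p: "polar \<gamma> B (trace_monomial (gen \<circ> \<gamma>') ws u) = (\<Sum>\<kappa>\<in>?K. if \<kappa> ` {..<N'} \<subseteq> B then ?T \<kappa> else 0)" if B: "B \<subseteq> ?U" for B
  proof -
    have fB: "finite B" using B by (rule finite_subset) simp
    have "polar \<gamma> B (trace_monomial (gen \<circ> \<gamma>') ws u) = trace_monomial (\<lambda>i. \<Sum>j | j \<in> B \<and> \<gamma> j = \<gamma>' i. gvar (gdeg \<circ> \<gamma>) j) ws u"
      by (simp only: substitution_trace_monomial[OF polar(1)] o_def polar(2))
    also have "\<dots> = (\<Sum>\<kappa>\<in>PiE {..<N'} (\<lambda>i. {j. j \<in> B \<and> \<gamma> j = \<gamma>' i}). trace_monomial (\<lambda>i. gvar (gdeg \<circ> \<gamma>) (\<kappa> i)) ws u)"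
      using assms fB by (intro multi_additive_expand trace_monomial_multi_additive) (auto simp: arrangement_def)
    also have "PiE {..<N'} (\<lambda>i. {j. j \<in> B \<and> \<gamma> j = \<gamma>' i}) = {\<kappa> \<in> ?K. \<kappa> ` {..<N'} \<subseteq> B}"
      using B by (auto simp: PiE_def Pi_def)
    also have "(\<Sum>\<kappa>\<in>{\<kappa> \<in> ?K. \<kappa> ` {..<N'} \<subseteq> B}. trace_monomial (\<lambda>i. gvar (gdeg \<circ> \<gamma>) (\<kappa> i)) ws u) =
        (\<Sum>\<kappa>\<in>?K. if \<kappa> ` {..<N'} \<subseteq> B then ?T \<kappa> else 0)"
      unfolding o_def by (rule sum.inter_filter[OF fK])
    finally show ?thesis .
  qed
  have "polarization \<gamma> N (trace_monomial (gen \<circ> \<gamma>') ws u) =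
      (\<Sum>B\<in>Pow ?U. \<Sum>\<kappa>\<in>?K. if \<kappa> ` {..<N'} \<subseteq> B then of_int ((-1) ^ card (?U - B)) * ?T \<kappa> else 0)"
    unfolding polarization_def by (intro sum.cong refl) (auto simp: p sum_distrib_left intro!: sum.cong)
  also have "\<dots> = (\<Sum>\<kappa>\<in>?K. \<Sum>B\<in>Pow ?U. if \<kappa> ` {..<N'} \<subseteq> B then of_int ((-1) ^ card (?U - B)) * ?T \<kappa> else 0)"
    by (rule sum.swap)
  also have "\<dots> = (\<Sum>\<kappa>\<in>?K. if \<kappa> ` {..<N'} = ?U then ?T \<kappa> else 0)"
  proof (intro sum.cong refl)
    fix \<kappa> assume \<kappa>: "\<kappa> \<in> ?K"
    let ?A = "\<kappa> ` {..<N'}"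
    have A: "?A \<subseteq> ?U" using \<kappa> by (auto simp: PiE_def Pi_def)
    have "(\<Sum>B\<in>Pow ?U. if ?A \<subseteq> B then of_int ((-1) ^ card (?U - B)) * ?T \<kappa> else 0) =
        (\<Sum>B\<in>{B \<in> Pow ?U. ?A \<subseteq> B}. of_int ((-1) ^ card (?U - B)) * ?T \<kappa>)"
      by (rule sum.inter_filter[symmetric]) simp
    also have "{B \<in> Pow ?U. ?A \<subseteq> B} = {B. ?A \<subseteq> B \<and> B \<subseteq> ?U}" by auto
    also have "(\<Sum>B | ?A \<subseteq> B \<and> B \<subseteq> ?U. of_int ((-1) ^ card (?U - B)) * ?T \<kappa>) =
        of_int (\<Sum>B | ?A \<subseteq> B \<and> B \<subseteq> ?U. (-1) ^ card (?U - B)) * ?T \<kappa>"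
      by (simp only: of_int_sum sum_distrib_right)
    also have "\<dots> = (if ?A = ?U then ?T \<kappa> else 0)"
      unfolding alternating_superset_sum[OF finite_lessThan A] by simp
    finally show "(\<Sum>B\<in>Pow ?U. if ?A \<subseteq> B then of_int ((-1) ^ card (?U - B)) * ?T \<kappa> else 0) =
        (if ?A = ?U then ?T \<kappa> else 0)" .
  qed
  also have "\<dots> = (\<Sum>\<kappa>\<in>labellings \<gamma> N \<gamma>' N'. ?T \<kappa>)"
    unfolding labellings_def by (rule sum.inter_filter[OF fK, symmetric])
  finally show ?thesis .
qed

lemma mcomb_sum:
  assumes "finite A" "\<And>i. i \<in> A \<Longrightarrow> \<exists>c. f i = mcomb N \<delta> c"
  shows "\<exists>c. (\<Sum>i\<in>A. f i) = mcomb N \<delta> c"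
  using assms
proof (induction A rule: finite_induct)
  case empty
  have "mcomb N \<delta> (\<lambda>_. 0) = 0" by (simp add: mcomb_def)
  then show ?case by (metis sum.empty)
next
  case (insert i A)
  then obtain c c' where "f i = mcomb N \<delta> c" "(\<Sum>i\<in>A. f i) = mcomb N \<delta> c'" by blast
  then have "(\<Sum>i\<in>insert i A. f i) = mcomb N \<delta> (\<lambda>\<sigma>. c \<sigma> + c' \<sigma>)" using insert by (simp add: mcomb_add)
  then show ?case by blast
qed

lemma polarization_monomial_mcomb:
  assumes "arrangement N' ws u" "N' \<le> N"
  shows "\<exists>c. polarization \<gamma> N (trace_monomial (gen \<circ> \<gamma>') ws u) = mcomb N (gdeg \<circ> \<gamma>) c"
  unfolding polarization_monomial[OF assms(1)]
proof (rule mcomb_sum[OF finite_labellings])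
  fix \<kappa> assume "\<kappa> \<in> labellings \<gamma> N \<gamma>' N'"
  then have im: "\<kappa> ` {..<N'} = {..<N}" by (simp add: labellings_def)
  have "N \<le> N'" using card_image_le[of "{..<N'}" \<kappa>] im by simp
  then have N: "N' = N" using assms(2) by simp
  have inj: "inj_on \<kappa> {..<N}" using im N by (intro eq_card_imp_inj_on) simp_all
  have s: "set (concat ws @ u) = {..<N}" using assms(1) N by (simp add: arrangement_def)
  have c: "concat (map (map \<kappa>) ws) @ map \<kappa> u = map \<kappa> (concat ws @ u)" by (simp add: map_concat)
  have "distinct (map \<kappa> (concat ws @ u))"
    unfolding distinct_map s using inj assms(1) by (simp add: arrangement_def)
  moreover have "set (map \<kappa> (concat ws @ u)) = {..<N}" unfolding set_map s using im N by simp
  ultimately have "arrangement N (map (map \<kappa>) ws) (map \<kappa> u)"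
    using assms(1) unfolding arrangement_def c by auto
  moreover have "trace_monomial (gvar (gdeg \<circ> \<gamma>) \<circ> \<kappa>) ws u = trace_monomial (gvar (gdeg \<circ> \<gamma>)) (map (map \<kappa>) ws) (map \<kappa> u)"
    by (simp add: trace_monomial_def o_def)
  ultimately show "\<exists>c. trace_monomial (gvar (gdeg \<circ> \<gamma>) \<circ> \<kappa>) ws u = mcomb N (gdeg \<circ> \<gamma>) c"
    using arrangement_mcomb by simp
qed

definition restitution :: "(nat \<Rightarrow> nat) \<Rightarrow> ft \<Rightarrow> ft" where
  "restitution \<gamma> = subst (\<lambda>i. if odd (\<gamma> i) then gen (\<gamma> i) else 0) (\<lambda>i. if even (\<gamma> i) then gen (\<gamma> i) else 0)"

lemma restitution:
  shows "substitution (restitution \<gamma>)" "restitution \<gamma> (gvar (gdeg \<circ> \<gamma>) j) = gen (\<gamma> j)"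
proof -
  have x: "(if odd (\<gamma> i) then gen (\<gamma> i) else 0) \<in> ftgrade 1" for i
    using gen_grade[of "\<gamma> i"] by (cases "even (\<gamma> i)") (simp_all add: gdeg_def ftgrade_zero)
  have y: "(if even (\<gamma> i) then gen (\<gamma> i) else 0) \<in> ftgrade 0" for i
    using gen_grade[of "\<gamma> i"] by (cases "even (\<gamma> i)") (simp_all add: gdeg_def ftgrade_zero)
  show "substitution (restitution \<gamma>)" unfolding restitution_def by (rule subst(1)[OF x y])
  show "restitution \<gamma> (gvar (gdeg \<circ> \<gamma>) j) = gen (\<gamma> j)"
    unfolding restitution_def gvar_def by (simp add: subst(2,3)[OF x y] gdeg_def)
qed

lemma restitution_polarization:
  assumes "arrangement N' ws u"
  shows "restitution \<gamma> (polarization \<gamma> N (trace_monomial (gen \<circ> \<gamma>') ws u)) =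
    ftconst (of_nat (card (labellings \<gamma> N \<gamma>' N'))) * trace_monomial (gen \<circ> \<gamma>') ws u"
proof -
  have "restitution \<gamma> (trace_monomial (gvar (gdeg \<circ> \<gamma>) \<circ> \<kappa>) ws u) = trace_monomial (gen \<circ> \<gamma>') ws u"
    if "\<kappa> \<in> labellings \<gamma> N \<gamma>' N'" for \<kappa>
  proof -
    have "\<gamma> (\<kappa> i) = \<gamma>' i" if "i < N'" for i
      using \<open>\<kappa> \<in> _\<close> that by (auto simp: labellings_def PiE_def Pi_def)
    then show ?thesis
      unfolding substitution_trace_monomial[OF restitution(1)]
      using assms by (intro trace_monomial_cong) (auto simp: restitution(2) arrangement_def)
  qed
  then have "restitution \<gamma> (polarization \<gamma> N (trace_monomial (gen \<circ> \<gamma>') ws u)) =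
      of_nat (card (labellings \<gamma> N \<gamma>' N')) * trace_monomial (gen \<circ> \<gamma>') ws u"
    unfolding polarization_monomial[OF assms] substitution_sum[OF restitution(1)] by simp
  moreover have "ftconst (of_nat m) = of_nat m" for m
    using ftconst_of_int[of "int m"] by simp
  ultimately show ?thesis by simp
qed

lemma labellings_self: "card (labellings \<gamma> N \<gamma> N) \<noteq> 0"
proof -
  have "restrict id {..<N} \<in> labellings \<gamma> N \<gamma> N" by (auto simp: labellings_def)
  then show ?thesis using finite_labellings by (metis card_eq_0_iff empty_iff)
qed

lemma ev_zero_substitution:
  assumes "substitution \<phi>" "ev a = (0 :: ('n::finite) gmat)"
  shows "ev (\<phi> a) = (0 :: 'n gmat)"
proof -
  have "matrix_hom (\<lambda>a. ev (\<phi> a) :: 'n gmat)"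
    unfolding trace_hom_def
    using matrix_hom_grade[OF ev_trace_hom] substitution_simps(5)[OF assms(1)]
    by (auto simp: substitution_simps(1-4)[OF assms(1)] ev_simps mconst_def mtr_def)
  from ev_zero_matrix_hom[OF this assms(2)] show ?thesis .
qed

text \<open>
  By induction on the number of terms.  Let the slots be given by a term \<open>k0\<close> of maximal degree.  The
  polarization of the identity is multilinear, since shorter terms disappear, and it is an identity;
  so it lies in \<open>I\<close>, and so does its restitution.  The restitution multiplies each term by the number
  of its labellings, which for \<open>k0\<close> is not zero.  Subtracting a suitable multiple of it from the identity
  removes the term \<open>k0\<close> and introduces no new term.
\<close>

theorem identities_in_T_ideal:
  assumes I: "T_ideal I" and CH: "\<And>e f. e + f = CARD('n::finite) + 1 \<Longrightarrow> 1 \<le> f \<Longrightarrow> CH e f \<in> I"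
    and Ik: "\<And>a. a \<in> I \<Longrightarrow> ev a = (0 :: 'n gmat)"
    and K: "finite K" "\<And>k. k \<in> K \<Longrightarrow> arrangement (N k) (ws k) (u k)"
    and ev: "ev (\<Sum>k\<in>K. ftconst (c k) * trace_monomial (gen \<circ> \<gamma> k) (ws k) (u k)) = (0 :: 'n gmat)"
  shows "(\<Sum>k\<in>K. ftconst (c k) * trace_monomial (gen \<circ> \<gamma> k) (ws k) (u k)) \<in> I"
  using K ev
proof (induction "card K" arbitrary: K c)
  case 0
  then show ?case using T_ideal_closed(1)[OF I] by simp
next
  case (Suc n K c)
  let ?m = "\<lambda>k. trace_monomial (gen \<circ> \<gamma> k) (ws k) (u k)"
  let ?f = "\<Sum>k\<in>K. ftconst (c k) * ?m k"
  have "K \<noteq> {}" using Suc.hyps(2) by auto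
  then have "Max (N ` K) \<in> N ` K" using Suc.prems(1) by (intro Max_in) auto
  then obtain k0 where k0: "k0 \<in> K" "N k0 = Max (N ` K)" by auto
  then have le: "N k \<le> N k0" if "k \<in> K" for k using that Suc.prems(1) by simp
  let ?N = "N k0" and ?\<gamma> = "\<gamma> k0"
  define \<nu> :: "_ \<Rightarrow> complex" where "\<nu> k = of_nat (card (labellings ?\<gamma> ?N (\<gamma> k) (N k)))" for k
  have \<nu>0: "\<nu> k0 \<noteq> 0" using labellings_self by (simp add: \<nu>_def)
  define g where "g = polarization ?\<gamma> ?N ?f"
  have "\<exists>c'. g = mcomb ?N (gdeg \<circ> ?\<gamma>) c'"
    unfolding g_def polarization_linear
  proof (rule mcomb_sum[OF Suc.prems(1)])
    fix k assume k: "k \<in> K"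
    obtain c' where "polarization ?\<gamma> ?N (?m k) = mcomb ?N (gdeg \<circ> ?\<gamma>) c'"
      using polarization_monomial_mcomb[OF Suc.prems(2)[OF k] le[OF k]] by blast
    then have "ftconst (c k) * polarization ?\<gamma> ?N (?m k) = mcomb ?N (gdeg \<circ> ?\<gamma>) (\<lambda>\<sigma>. c k * c' \<sigma>)"
      by (simp add: mcomb_scale)
    then show "\<exists>c'. ftconst (c k) * polarization ?\<gamma> ?N (?m k) = mcomb ?N (gdeg \<circ> ?\<gamma>) c'" by blast
  qed
  moreover have "ev g = (0 :: 'n gmat)"
  proof -
    have "ev (polar ?\<gamma> B ?f) = (0 :: 'n gmat)" for B
      by (rule ev_zero_substitution[OF polar(1) Suc.prems(3)])
    then show ?thesis
      unfolding g_def polarization_def matrix_hom_sum[OF ev_trace_hom] matrix_hom_simps(2)[OF ev_trace_hom] by simp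
  qed
  ultimately have "g \<in> I" using multilinear_identity_in_T_ideal[OF I CH Ik] by auto
  then have "restitution ?\<gamma> g \<in> I" by (rule T_ideal_substitution[OF I _ restitution(1)])
  then have rI: "ftconst (1 / \<nu> k0) * restitution ?\<gamma> g \<in> I" by (rule T_ideal_closed[OF I])
  have r: "ftconst (1 / \<nu> k0) * restitution ?\<gamma> g = (\<Sum>k\<in>K. ftconst (c k * \<nu> k / \<nu> k0) * ?m k)"
    unfolding g_def polarization_linear substitution_sum[OF restitution(1)] sum_distrib_left
      substitution_simps(2,3)[OF restitution(1)]
  proof (intro sum.cong refl)
    fix k assume "k \<in> K"
    then have "restitution ?\<gamma> (polarization ?\<gamma> ?N (?m k)) = ftconst (\<nu> k) * ?m k"
      unfolding \<nu>_def by (intro restitution_polarization Suc.prems(2))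
    then show "ftconst (1 / \<nu> k0) * (ftconst (c k) * restitution ?\<gamma> (polarization ?\<gamma> ?N (?m k))) = ftconst (c k * \<nu> k / \<nu> k0) * ?m k"
      by (simp flip: mult.assoc ftconst_mult)
  qed
  let ?c = "\<lambda>k. c k - c k * \<nu> k / \<nu> k0"
  have "?f - ftconst (1 / \<nu> k0) * restitution ?\<gamma> g = (\<Sum>k\<in>K. ftconst (?c k) * ?m k)"
    unfolding r sum_subtractf[symmetric] left_diff_distrib[symmetric]
    by (intro sum.cong refl arg_cong2[of _ _ _ _ "(*)"]) (metis add_diff_cancel_right' diff_add_cancel ftconst_add)
  also have "\<dots> = (\<Sum>k\<in>K - {k0}. ftconst (?c k) * ?m k)"
    using Suc.prems(1) k0(1) \<nu>0 by (intro sum.mono_neutral_right) auto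
  finally have d: "?f = (\<Sum>k\<in>K - {k0}. ftconst (?c k) * ?m k) + ftconst (1 / \<nu> k0) * restitution ?\<gamma> g"
    by (simp add: algebra_simps)
  have "(\<Sum>k\<in>K - {k0}. ftconst (?c k) * ?m k) \<in> I"
  proof (rule Suc.hyps(1))
    show "n = card (K - {k0})" using Suc.hyps(2) k0(1) Suc.prems(1) by simp
    show "ev (\<Sum>k\<in>K - {k0}. ftconst (?c k) * ?m k) = (0 :: 'n gmat)"
      using Suc.prems(3) Ik[OF rI] unfolding d by (simp add: ev_simps(1))
  qed (use Suc.prems in auto)
  then show ?case unfolding d using rI by (rule T_ideal_closed[OF I])
qed

lemma remove_trace_one:
  assumes I: "T_ideal I" "ftr 1 - of_nat n \<in> I"
  shows "\<exists>c. trace_monomial gen ws u - ftconst c * trace_monomial gen (filter (\<lambda>w. w \<noteq> []) ws) u \<in> I"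
proof (induction ws)
  case Nil
  show ?case using T_ideal_closed(1)[OF I(1)] by (intro exI[of _ 1]) simp
next
  case (Cons w ws)
  let ?M = "trace_monomial gen ws u" and ?M' = "trace_monomial gen (filter (\<lambda>w. w \<noteq> []) ws) u"
  obtain c where c: "?M - ftconst c * ?M' \<in> I" using Cons by blast
  show ?case
  proof (cases "w = []")
    case True
    have n: "ftconst (of_nat n * c) * ?M' = of_nat n * (ftconst c * ?M')"
      using ftconst_of_int[of "int n"] by (simp add: ftconst_mult mult.assoc)
    have "(ftr 1 - of_nat n) * ?M + of_nat n * (?M - ftconst c * ?M') \<in> I"
      using c I by (intro T_ideal_closed[OF I(1)])
    moreover have "(ftr 1 - of_nat n) * ?M + of_nat n * (?M - ftconst c * ?M') = ftr 1 * ?M - of_nat n * (ftconst c * ?M')"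
      by (simp add: left_diff_distrib right_diff_distrib)
    ultimately show ?thesis
      unfolding True by (intro exI[of _ "of_nat n * c"]) (simp add: trace_monomial_simps n)
  next
    case False
    have "ftr (word gen w) * (?M - ftconst c * ?M') \<in> I"
      using c by (intro T_ideal_closed[OF I(1)])
    then show ?thesis
      using False by (intro exI[of _ c]) (simp add: trace_monomial_simps right_diff_distrib ftconst_left_commute)
  qed
qed

text \<open>
  Modulo the relation for the trace of 1, factors that are traces of the empty word become scalars.
\<close>

lemma normal_form:
  assumes I: "T_ideal I" "ftr 1 - of_nat n \<in> I"
  shows "\<exists>(K :: nat set) c N \<gamma> ws u. finite K \<and> (\<forall>k\<in>K. arrangement (N k) (ws k) (u k)) \<and>
    f - (\<Sum>k\<in>K. ftconst (c k) * trace_monomial (gen \<circ> \<gamma> k) (ws k) (u k)) \<in> I"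
  using monomials_span_UNIV[of f]
proof induction
  case cspan_0
  show ?case using T_ideal_closed(1)[OF I(1)] by (intro exI[of _ "{}"]) auto
next
  case (cspan_step m f b)
  then obtain K :: "nat set" and c N \<gamma> ws u where K: "finite K" "\<forall>k\<in>K. arrangement (N k) (ws k) (u k)"
    "f - (\<Sum>k\<in>K. ftconst (c k) * trace_monomial (gen \<circ> \<gamma> k) (ws k) (u k)) \<in> I" by blast
  obtain vs v where m: "m = trace_monomial gen vs v" using cspan_step(1) unfolding monomials_def by blast
  obtain b' where b': "m - ftconst b' * trace_monomial gen (filter (\<lambda>w. w \<noteq> []) vs) v \<in> I"
    using remove_trace_one[OF I, of vs v] m by blast
  have "[] \<notin> set (filter (\<lambda>w. w \<noteq> []) vs)" by simp
  then obtain N0 \<gamma>0 ws0 u0 where 0: "arrangement N0 ws0 u0"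
    "trace_monomial gen (filter (\<lambda>w. w \<noteq> []) vs) v = trace_monomial (gen \<circ> \<gamma>0) ws0 u0"
    using monomial_arrangement by metis
  obtain k0 where k0: "k0 \<notin> K" using ex_new_if_finite[OF _ K(1)] by auto
  let ?s = "\<Sum>k\<in>K. ftconst (c k) * trace_monomial (gen \<circ> \<gamma> k) (ws k) (u k)"
  have S: "(\<Sum>k\<in>insert k0 K. ftconst ((c(k0 := b * b')) k) * trace_monomial (gen \<circ> (\<gamma>(k0 := \<gamma>0)) k) ((ws(k0 := ws0)) k) ((u(k0 := u0)) k)) =
      ftconst (b * b') * trace_monomial (gen \<circ> \<gamma>0) ws0 u0 + ?s"
    using K(1) k0 by (subst sum.insert) (auto intro!: sum.cong)
  have mem: "ftconst b * m + f - (ftconst (b * b') * trace_monomial (gen \<circ> \<gamma>0) ws0 u0 + ?s) \<in> I"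
  proof -
    have "ftconst b * (m - ftconst b' * trace_monomial (gen \<circ> \<gamma>0) ws0 u0) + (f - ?s) \<in> I"
      using b' K(3) unfolding 0(2) by (intro T_ideal_closed[OF I(1)])
    then show ?thesis by (simp only: right_diff_distrib ftconst_mult mult.assoc) (simp add: algebra_simps)
  qed
  have arr: "\<forall>k\<in>insert k0 K. arrangement ((N(k0 := N0)) k) ((ws(k0 := ws0)) k) ((u(k0 := u0)) k)"
    using K(2) 0(1) k0 by auto
  show ?case
  proof (intro exI conjI)
    show "finite (insert k0 K)" using K(1) by simp
    show "ftconst b * m + f - (\<Sum>k\<in>insert k0 K. ftconst ((c(k0 := b * b')) k) *
        trace_monomial (gen \<circ> (\<gamma>(k0 := \<gamma>0)) k) ((ws(k0 := ws0)) k) ((u(k0 := u0)) k)) \<in> I"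
      unfolding S by (rule mem)
  qed (rule arr)
qed

theorem kernel_in_T_ideal:
  assumes I: "T_ideal I" and CH: "\<And>e f. e + f = CARD('n::finite) + 1 \<Longrightarrow> 1 \<le> f \<Longrightarrow> CH e f \<in> I"
    and one: "ftr 1 - of_nat CARD('n) \<in> I"
    and Ik: "\<And>a. a \<in> I \<Longrightarrow> ev a = (0 :: 'n gmat)"
    and ev: "ev a = (0 :: 'n gmat)"
  shows "a \<in> I"
proof -
  obtain K :: "nat set" and c N \<gamma> ws u where K: "finite K" "\<forall>k\<in>K. arrangement (N k) (ws k) (u k)"
    "a - (\<Sum>k\<in>K. ftconst (c k) * trace_monomial (gen \<circ> \<gamma> k) (ws k) (u k)) \<in> I"
    using normal_form[OF I one, of a] by blast
  let ?s = "\<Sum>k\<in>K. ftconst (c k) * trace_monomial (gen \<circ> \<gamma> k) (ws k) (u k)"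
  have "ev a = ev (a - ?s) + (ev ?s :: 'n gmat)"
    using ev_simps(1)[of "a - ?s" ?s] by simp
  then have "ev ?s = (0 :: 'n gmat)" using ev Ik[OF K(3)] by simp
  then have "?s \<in> I" using identities_in_T_ideal[OF I CH Ik K(1)] K(2) by blast
  then have "(a - ?s) + ?s \<in> I" using K(3) by (intro T_ideal_closed[OF I])
  then show ?thesis by simp
qed

section \<open>The kernel of evaluation\<close>

lemma kernel_T_ideal: "T_ideal {a. ev a = (0 :: ('n::finite) gmat)}"
  unfolding T_ideal_def graded_ideal_def
proof (intro conjI ballI allI impI subsetI)
  note H = matrix_hom_simps[OF ev_trace_hom]
  fix a b :: ft
  assume ab: "a \<in> ftgrade 0" "b \<in> ftgrade 1" "a + b \<in> {a. ev a = (0 :: 'n gmat)}"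
  then have "ev a = - (ev b :: 'n gmat)" by (simp add: H eq_neg_iff_add_eq_0)
  moreover have "ev a \<in> (mgrade 0 :: 'n gmat set)" "ev b \<in> (mgrade 1 :: 'n gmat set)"
    by (rule matrix_hom_grade[OF ev_trace_hom ab(1)], rule matrix_hom_grade[OF ev_trace_hom ab(2)])
  moreover from this have "- ev b \<in> (mgrade 1 :: 'n gmat set)"
    by (simp add: mgrade_def scgrade_minus)
  ultimately have "ev a = (0 :: 'n gmat)" by (intro matr.hom_disjoint) simp_all
  with \<open>ev a = - _\<close> show "a \<in> {a. ev a = (0 :: 'n gmat)}" "b \<in> {a. ev a = (0 :: 'n gmat)}"
    by simp_all
next
  fix \<phi> a assume "substitution \<phi>" "a \<in> \<phi> ` {a. ev a = (0 :: 'n gmat)}"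
  then show "a \<in> {a. ev a = (0 :: 'n gmat)}" using ev_zero_substitution by auto
qed (auto simp: matrix_hom_simps[OF ev_trace_hom] trace_def)

lemma T_ideal_graded:
  assumes "T_ideal I" "a \<in> ftgrade 0" "b \<in> ftgrade 1" "a + b \<in> I"
  shows "a \<in> I" "b \<in> I"
  using assms unfolding T_ideal_def graded_ideal_def by blast+

lemma T_ideal_Int:
  assumes I: "T_ideal I" and I': "T_ideal I'"
  shows "T_ideal (I \<inter> I')"
  unfolding T_ideal_def graded_ideal_def
proof (intro conjI ballI allI impI)
  show "0 \<in> I \<inter> I'" using T_ideal_closed(1)[OF I] T_ideal_closed(1)[OF I'] by simp
  show "ftr ` (I \<inter> I') \<subseteq> I \<inter> I'" using T_ideal_closed(5)[OF I] T_ideal_closed(5)[OF I'] by auto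
  show "\<phi> ` (I \<inter> I') \<subseteq> I \<inter> I'" if "substitution \<phi>" for \<phi>
    using T_ideal_substitution[OF I _ that] T_ideal_substitution[OF I' _ that] by auto
  fix a b
  show "a + b \<in> I \<inter> I'" if "a \<in> I \<inter> I'" "b \<in> I \<inter> I'"
    using that T_ideal_closed(2)[OF I] T_ideal_closed(2)[OF I'] by auto
  show "a * b \<in> I \<inter> I'" if "b \<in> I \<inter> I'"
    using that T_ideal_closed(3)[OF I] T_ideal_closed(3)[OF I'] by auto
  show "b * a \<in> I \<inter> I'" if "b \<in> I \<inter> I'"
    using that T_ideal_closed(4)[OF I] T_ideal_closed(4)[OF I'] by auto
  assume "a \<in> ftgrade 0" "b \<in> ftgrade 1" "a + b \<in> I \<inter> I'"
  then show "a \<in> I \<inter> I'" "b \<in> I \<inter> I'"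
    using T_ideal_graded[OF I, of a b] T_ideal_graded[OF I', of a b] by auto
qed simp

text \<open>
  A bound for the indices of the variables in a term; variables from there on are new.
\<close>

primrec ftbound :: "ftterm \<Rightarrow> nat" where
  "ftbound (FX i) = Suc i"
| "ftbound (FY i) = Suc i"
| "ftbound (FConst u) = 0"
| "ftbound (FAdd a b) = max (ftbound a) (ftbound b)"
| "ftbound (FMul a b) = max (ftbound a) (ftbound b)"
| "ftbound (FTr a) = ftbound a"

lemma trace_hom_agree:
  assumes "trace_hom mul const hom tr \<phi>" "trace_hom mul const hom tr \<psi>"
    "\<And>i. i < ftbound (rep_ft a) \<Longrightarrow> \<phi> (ftx i) = \<psi> (ftx i) \<and> \<phi> (fty i) = \<psi> (fty i)"
  shows "\<phi> a = \<psi> a"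
proof -
  have "(\<And>i. i < ftbound t \<Longrightarrow> \<phi> (ftx i) = \<psi> (ftx i) \<and> \<phi> (fty i) = \<psi> (fty i)) \<Longrightarrow> \<phi> (abs_ft t) = \<psi> (abs_ft t)" for t
    using assms(1,2) unfolding trace_hom_def by (induction t) (simp_all add: abs_ft_simps)
  from this[of "rep_ft a", OF assms(3)] show ?thesis by (simp add: abs_rep_ft)
qed

lemma trace_mult_elem_mat: "trace (A ** elem_mat 1 h k) = A $ k $ h"
proof -
  have "(A ** elem_mat 1 h k) $ i $ j = (if j = k then A $ i $ h else 0)" for i j
  proof -
    have "(A ** elem_mat 1 h k) $ i $ j = (\<Sum>l\<in>UNIV. if l = h then (if j = k then A $ i $ h else 0) else 0)"
      by (simp only: matrix_matrix_mult_def elem_mat_def vec_lambda_beta) (rule sum.cong, auto)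
    then show ?thesis by simp
  qed
  then show ?thesis by (simp add: trace_def)
qed

lemma matrix_double_zero:
  fixes A :: "('n::finite) gmat"
  assumes "A = - A" shows "A = 0"
proof -
  have "A $ h $ k = - A $ h $ k" for h k using arg_cong[OF assms, of "\<lambda>A. A $ h $ k"] by simp
  then have "A $ h $ k = 0" for h k by (rule sc_double_zero)
  then show ?thesis by (simp add: vec_eq_iff)
qed

text \<open>
  Two of the more than \<open>n\<close> elementary matrices have the same row.  Interchanging their
  indices in a permutation changes its sign but, by \<open>eval_psi\<close>, not the value of its monomial.
\<close>

lemma alternating_elementary_vanish:
  fixes \<psi> :: "ft \<Rightarrow> ('n::finite) gmat"
  assumes \<psi>: "matrix_hom \<psi>" and S: "finite S" "s \<notin> S" "CARD('n) < card S" and h: "homog a d S"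
    and a: "\<And>i. i \<in> S \<Longrightarrow> \<psi> (a i) = elem_mat (\<zeta> i) (\<alpha> i) (\<beta> i)" "\<And>i. i \<in> S \<Longrightarrow> \<zeta> i \<in> scgrade (d i)"
  shows "\<psi> (alt_sum S S s a d) = 0"
proof -
  have "card (\<alpha> ` S) \<le> CARD('n)" by (rule card_mono) auto
  then have "\<not> inj_on \<alpha> S" using S(3) by (metis card_image not_less)
  then obtain i j where ij: "i \<in> S" "j \<in> S" "i \<noteq> j" "\<alpha> i = \<alpha> j" by (auto simp: inj_on_def)
  let ?t = "Transposition.transpose i j"
  have t: "?t permutes S" using ij by (intro permutes_swap_id)
  have \<alpha>t: "\<alpha> (?t x) = \<alpha> x" for x using ij(4) by (auto simp: Transposition.transpose_def)
  define F where "F \<sigma> = \<psi> (psi S s \<sigma> a d)" for \<sigma>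
  have F: "F \<sigma> = mat (if \<forall>i\<in>S. \<beta> i = \<alpha> (\<sigma> i) then prod_list (map \<zeta> (sorted_list_of_set S)) else 0)"
    if \<sigma>: "\<sigma> permutes S" for \<sigma>
    unfolding F_def
    using perm_holeI[OF S(1,2) _ \<sigma>] permutes_not_in[OF \<sigma> S(2)] a h
    by (intro eval_psi[OF \<psi>]) auto
  let ?T = "\<Sum>\<sigma> | \<sigma> permutes S. mat (of_int (sign \<sigma>)) ** F \<sigma>"
  have T: "\<psi> (alt_sum S S s a d) = ?T"
    unfolding alt_sum_def matrix_hom_sum[OF \<psi>] F_def by (simp add: matrix_hom_simps[OF \<psi>])
  have "?T = (\<Sum>\<sigma> | \<sigma> permutes S. mat (of_int (sign (?t \<circ> \<sigma>))) ** F (?t \<circ> \<sigma>))"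
    by (rule setum_permutations_compose_left[OF t])
  also have "\<dots> = (\<Sum>\<sigma> | \<sigma> permutes S. - (mat (of_int (sign \<sigma>)) ** F \<sigma>))"
  proof (rule sum.cong)
    fix \<sigma> assume "\<sigma> \<in> {\<sigma>. \<sigma> permutes S}"
    then have \<sigma>: "\<sigma> permutes S" by simp
    have "permutation \<sigma>" using \<sigma> S(1) permutation_permutes by blast
    then have "sign (?t \<circ> \<sigma>) = - sign \<sigma>"
      using sign_compose[OF permutation_swap_id, of \<sigma> i j] ij(3) by (simp add: sign_swap_id)
    moreover have "F (?t \<circ> \<sigma>) = F \<sigma>"
      unfolding F[OF \<sigma>] F[OF permutes_compose[OF \<sigma> t]] by (simp add: \<alpha>t)
    ultimately show "mat (of_int (sign (?t \<circ> \<sigma>))) ** F (?t \<circ> \<sigma>) = - (mat (of_int (sign \<sigma>)) ** F \<sigma>)"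
      by (simp add: vec_eq_iff mat_mult_left)
  qed simp
  also have "\<dots> = - ?T" by (rule sum_negf)
  finally show ?thesis unfolding T by (rule matrix_double_zero)
qed

lemma psi_expand:
  fixes g :: "nat \<Rightarrow> 'j::finite \<Rightarrow> ft"
  assumes "perm_hole S s \<sigma>" "\<And>i j. i \<in> S \<Longrightarrow> g i j \<in> ftgrade (d i)"
  shows "psi S s \<sigma> (\<lambda>i. \<Sum>j\<in>UNIV. g i j) d = (\<Sum>\<kappa>\<in>PiE S (\<lambda>_. UNIV). psi S s \<sigma> (\<lambda>i. g i (\<kappa> i)) d)"
proof -
  obtain ws u where D: "display S s \<sigma> ws u" using assms(1) by (rule perm_holeE)
  have h: "homog (\<lambda>i. \<Sum>j\<in>UNIV. g i j) d S" "homog (\<lambda>i. g i (\<kappa> i)) d S" for \<kappa>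
    using assms(2) by (auto simp: homog_def intro: ftgrade_sum)
  have "finite S" using assms(1) by (simp add: perm_hole_def)
  then have "trace_monomial (\<lambda>i. \<Sum>j\<in>UNIV. g i j) ws u = (\<Sum>\<kappa>\<in>PiE S (\<lambda>_. UNIV). trace_monomial (\<lambda>i. g i (\<kappa> i)) ws u)"
    using D by (intro multi_additive_expand trace_monomial_multi_additive) (auto simp: display_def)
  then show ?thesis
    unfolding psi_eq[OF D h(1)] psi_eq[OF D h(2)] val_def by (simp add: sum_distrib_left)
qed

text \<open>
  Each matrix is the sum of its elementary components, and the alternating sum is additive in each
  variable.  To stay within the free algebra, every variable is replaced by a sum of variables, one
  for each entry, which are coded by natural numbers; these are evaluated at the components.
\<close>

lemma alternating_vanish:
  fixes \<psi> :: "ft \<Rightarrow> ('n::finite) gmat"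
  assumes \<psi>: "matrix_hom \<psi>" and S: "finite S" "s \<notin> S" "CARD('n) < card S"
  shows "\<psi> (alt_sum S S s (gen \<circ> l) (gdeg \<circ> l)) = 0"
proof -
  define enc :: "nat \<times> 'n \<times> 'n \<Rightarrow> nat" where "enc = to_nat"
  define dec :: "nat \<Rightarrow> nat \<times> 'n \<times> 'n" where "dec = from_nat"
  have dec: "dec (enc p) = p" for p by (simp add: enc_def dec_def)
  define E where "E v t = (case dec t of (i, h, k) \<Rightarrow> elem_mat (\<psi> (v i) $ h $ k) h k)" for v :: "nat \<Rightarrow> ft" and t
  define \<Theta> where "\<Theta> = matsubst (E ftx) (E fty)"
  define \<phi> where "\<phi> = subst (\<lambda>i. \<Sum>p\<in>UNIV. ftx (enc (i, p))) (\<lambda>i. \<Sum>p\<in>UNIV. fty (enc (i, p)))"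
  have Ex: "E ftx t \<in> mgrade 1" and Ey: "E fty t \<in> mgrade 0" for t
    using matrix_hom_grade[OF \<psi> ftgrade_x] matrix_hom_grade[OF \<psi> ftgrade_y]
    by (auto simp: E_def mgrade_def split: prod.splits intro!: elem_mat_grade[unfolded mgrade_def, THEN CollectD, rule_format])
  note \<Theta> = matsubst[of "E ftx" "E fty", OF Ex Ey, folded \<Theta>_def]
  have px: "(\<Sum>p\<in>UNIV. ftx (enc (i, p))) \<in> ftgrade 1" and py: "(\<Sum>p\<in>UNIV. fty (enc (i, p))) \<in> ftgrade 0" for i
    by (intro ftgrade_sum ftgrade_x ftgrade_y)+
  note \<phi> = subst[of "\<lambda>i. \<Sum>p\<in>UNIV. ftx (enc (i, p))" "\<lambda>i. \<Sum>p\<in>UNIV. fty (enc (i, p))", OF px py, folded \<phi>_def]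
  have decompose: "(\<Sum>p\<in>UNIV. elem_mat (A $ fst p $ snd p) (fst p) (snd p)) = A" for A :: "'n gmat"
  proof -
    have "(\<Sum>p\<in>UNIV. if i = fst p \<and> j = snd p then A $ fst p $ snd p else 0) = A $ i $ j" for i j
    proof -
      have "(\<Sum>p\<in>UNIV. if i = fst p \<and> j = snd p then A $ fst p $ snd p else 0) =
          (\<Sum>p\<in>UNIV. if p = (i, j) then A $ i $ j else 0)" by (intro sum.cong) auto
      then show ?thesis by simp
    qed
    then show ?thesis by (simp add: vec_eq_iff elem_mat_def)
  qed
  have \<Theta>E: "\<Theta> (ftx (enc (i, p))) = elem_mat (\<psi> (ftx i) $ fst p $ snd p) (fst p) (snd p)"
    "\<Theta> (fty (enc (i, p))) = elem_mat (\<psi> (fty i) $ fst p $ snd p) (fst p) (snd p)" for i p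
    unfolding \<Theta>(2,3) E_def dec by (simp_all add: case_prod_beta)
  have "matrix_hom (\<lambda>a. \<Theta> (\<phi> a))"
    unfolding trace_hom_def
    using matrix_hom_grade[OF \<Theta>(1)] substitution_simps(5)[OF \<phi>(1)]
    by (auto simp: substitution_simps(1-4)[OF \<phi>(1)] matrix_hom_simps[OF \<Theta>(1)] mconst_def mtr_def)
  then have \<psi>\<Theta>: "\<psi> b = \<Theta> (\<phi> b)" for b
    by (rule trace_hom_agree[OF \<psi>])
      (simp add: \<phi>(2,3) matrix_hom_sum[OF \<Theta>(1)] \<Theta>E decompose)
  let ?d = "gdeg \<circ> l"
  define g where "g i p = (if even (l i) then fty (enc (l i div 2, p)) else ftx (enc (l i div 2, p)))" for i p
  have gg: "g i p \<in> ftgrade (?d i)" for i p by (simp add: g_def gdeg_def ftgrade_x ftgrade_y)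
  have "\<phi> \<circ> (gen \<circ> l) = (\<lambda>i. \<Sum>p\<in>UNIV. g i p)"
    by (rule ext) (simp add: gen_def g_def \<phi>(2,3))
  then have "\<phi> (alt_sum S S s (gen \<circ> l) ?d) = alt_sum S S s (\<lambda>i. \<Sum>p\<in>UNIV. g i p) ?d"
    using substitution_alt_sum[OF \<phi>(1) S(1,2), of S "gen \<circ> l" ?d] gen_grade by (auto simp: homog_def)
  also have "\<dots> = (\<Sum>\<pi> | \<pi> permutes S. \<Sum>\<kappa>\<in>PiE S (\<lambda>_. UNIV). of_int (sign \<pi>) * psi S s \<pi> (\<lambda>i. g i (\<kappa> i)) ?d)"
    unfolding alt_sum_def
  proof (rule sum.cong)
    fix \<pi> assume "\<pi> \<in> {\<pi>. \<pi> permutes S}"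
    then have "perm_hole S s \<pi>" using S(1,2) by (auto intro: perm_holeI)
    then show "of_int (sign \<pi>) * psi S s \<pi> (\<lambda>i. \<Sum>p\<in>UNIV. g i p) ?d =
        (\<Sum>\<kappa>\<in>PiE S (\<lambda>_. UNIV). of_int (sign \<pi>) * psi S s \<pi> (\<lambda>i. g i (\<kappa> i)) ?d)"
      using psi_expand[of S s \<pi> g ?d] gg by (simp only: sum_distrib_left)
  qed simp
  also have "\<dots> = (\<Sum>\<kappa>\<in>PiE S (\<lambda>_. UNIV). alt_sum S S s (\<lambda>i. g i (\<kappa> i)) ?d)"
    unfolding alt_sum_def by (rule sum.swap)
  finally have e: "\<psi> (alt_sum S S s (gen \<circ> l) ?d) = (\<Sum>\<kappa>\<in>PiE S (\<lambda>_. UNIV). \<Theta> (alt_sum S S s (\<lambda>i. g i (\<kappa> i)) ?d))"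
    by (simp add: \<psi>\<Theta> matrix_hom_sum[OF \<Theta>(1)])
  have "\<Theta> (alt_sum S S s (\<lambda>i. g i (\<kappa> i)) ?d) = 0" for \<kappa>
  proof (rule alternating_elementary_vanish[OF \<Theta>(1) S])
    show "homog (\<lambda>i. g i (\<kappa> i)) ?d S" using gg by (simp add: homog_def)
    fix i
    show "\<Theta> (g i (\<kappa> i)) = elem_mat (\<psi> (gen (l i)) $ fst (\<kappa> i) $ snd (\<kappa> i)) (fst (\<kappa> i)) (snd (\<kappa> i))"
      by (simp add: g_def gen_def \<Theta>E)
    show "\<psi> (gen (l i)) $ fst (\<kappa> i) $ snd (\<kappa> i) \<in> scgrade (?d i)"
      using matrix_hom_grade[OF \<psi> gen_grade[of "l i"]] by (simp add: mgrade_def)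
  qed
  then show ?thesis unfolding e by simp
qed

lemma alt_sum_close:
  assumes "finite S" "s \<notin> S" "s' \<notin> insert s S" "A \<subseteq> insert s S" "homog a d (insert s S)"
  shows "ftr (alt_sum A S s a d * a s) = of_int (koszul_sign d (sorted_list_of_set S @ [s])) * alt_sum A (insert s S) s' a d"
proof -
  let ?k = "koszul_sign d (sorted_list_of_set S @ [s])"
  have "ftr (alt_sum A S s a d * a s) = (\<Sum>\<pi> | \<pi> permutes A. of_int (sign \<pi>) * ftr (psi S s \<pi> a d * a s))"
    unfolding alt_sum_def sum_distrib_right ftr_sum by (simp add: mult.assoc ftr_of_int)
  also have "\<dots> = of_int ?k * (1 * (\<Sum>\<pi> | \<pi> permutes A. of_int (sign \<pi>) * psi (insert s S) s' \<pi> a d) * 1)"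
    using psi_close[OF perm_holeI[OF assms(1,2,4)] assms(3,5)] by (intro sum_pull_out) simp
  finally show ?thesis by (simp add: alt_sum_def)
qed

definition zcode :: "nat \<Rightarrow> nat \<Rightarrow> nat" where
  "zcode e i = (if i < e then 2 * i else 2 * (i - e) + 1)"

lemma zcode: "gen (zcode e i) = zvar e i" "gdeg (zcode e i) = dpar e i"
  by (simp_all add: zcode_def gen_def zvar_def gdeg_def dpar_def)

lemma ev_T_rel:
  assumes "e + f = CARD('n::finite) + 1"
  shows "ev (T_rel e f) = (0 :: 'n gmat)"
proof -
  have "gen \<circ> zcode e = zvar e" "gdeg \<circ> zcode e = dpar e" by (auto simp: zcode)
  then have "T_rel e f = alt_sum {..<e + f} {..<e + f} (e + f) (gen \<circ> zcode e) (gdeg \<circ> zcode e)"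
    using T_rel_eq_alt_sum[of e f "e + f"] by simp
  moreover have "matrix_hom (ev :: ft \<Rightarrow> 'n gmat)" by (rule ev_trace_hom)
  ultimately show ?thesis using alternating_vanish[of "ev :: ft \<Rightarrow> 'n gmat" "{..<e + f}" "e + f" "zcode e"] assms by simp
qed

text \<open>
  The alternating sum vanishes also if its last variable \<open>fty M\<close> is evaluated at an elementary matrix.  It is then the
  trace of \<open>ev (CH e f)\<close> times this matrix, that is, an arbitrary entry of \<open>ev (CH e f)\<close>.
\<close>

lemma ev_CH:
  assumes "e + f = CARD('n::finite) + 1"
  shows "ev (CH e f) = (0 :: 'n gmat)"
proof -
  let ?n = "CARD('n)"
  \<comment> \<open>The variable \<open>fty M\<close> does not occur in \<open>CH e f\<close>, so its value does not affect that of \<open>CH e f\<close>.\<close>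
  define M where "M = ftbound (rep_ft (CH e f))"
  define l where "l = (zcode e)(?n := 2 * M)"
  let ?a = "gen \<circ> l" and ?d = "gdeg \<circ> l"
  have h: "homog ?a ?d T" for T by (simp add: homog_def gen_grade)
  have ins: "insert ?n {..<?n} = {..<Suc ?n}" by auto
  have CH: "CH e f = alt_sum {..<Suc ?n} {..<?n} ?n ?a ?d"
    unfolding CH_eq_alt_sum[of e f ?n, OF assms[unfolded Suc_eq_plus1[symmetric]]]
    by (rule alt_sum_cong) (auto simp: zvar_homog l_def zcode)
  have "?a ?n = fty M" by (simp add: l_def gen_def)
  with alt_sum_close[of "{..<?n}" ?n "Suc ?n" "{..<Suc ?n}" ?a ?d] h
  have t: "ftr (CH e f * fty M) = of_int (koszul_sign ?d (sorted_list_of_set {..<?n} @ [?n])) *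
      alt_sum {..<Suc ?n} {..<Suc ?n} (Suc ?n) ?a ?d"
    by (simp add: CH ins)
  have "ev (CH e f) $ k $ h = (0 :: 'n gen)" for h k :: 'n
  proof -
    define \<psi> where "\<psi> = matsubst xi (eta(M := elem_mat 1 h k) :: nat \<Rightarrow> 'n gmat)"
    have "elem_mat 1 h k \<in> (mgrade 0 :: 'n gmat set)"
      using scgrade_const[of 1] by (intro elem_mat_grade) simp
    then have "(eta(M := elem_mat 1 h k)) i \<in> (mgrade 0 :: 'n gmat set)" for i
      by (auto intro: eta_grade)
    note \<psi> = matsubst[of xi "eta(M := elem_mat 1 h k)", OF xi_grade this, folded \<psi>_def]
    have "\<psi> (CH e f) = ev (CH e f)"
      using \<psi>(1) ev_trace_hom by (rule trace_hom_agree) (simp add: \<psi>(2,3) ev_x ev_y M_def)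
    moreover have "\<psi> (ftr (CH e f * fty M)) = 0"
      unfolding t matrix_hom_simps(2)[OF \<psi>(1)]
      using alternating_vanish[OF \<psi>(1), of "{..<Suc ?n}" "Suc ?n" l] by simp
    ultimately have "mat (trace (ev (CH e f) ** elem_mat 1 h k)) = (0 :: 'n gmat)"
      by (simp add: matrix_hom_simps[OF \<psi>(1)] \<psi>(3))
    then have "mat (ev (CH e f) $ k $ h) $ h $ h = (0 :: 'n gmat) $ h $ h"
      unfolding trace_mult_elem_mat by (rule arg_cong)
    then show ?thesis by (simp add: mat_def)
  qed
  then show ?thesis by (simp add: vec_eq_iff)
qed

lemma ev_trace_one: "ev (ftr 1 - of_nat CARD('n)) = (0 :: ('n::finite) gmat)"
proof -
  have "ftr 1 - of_nat CARD('n) = ftr 1 + of_int (- int CARD('n))" by simp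
  then show ?thesis
    by (simp only: matrix_hom_simps[OF ev_trace_hom]) (simp add: trace_def mat_def vec_eq_iff)
qed

section \<open>From matrix identities to trace relations\<close>

text \<open>
  A variable that does not occur in \<open>a\<close> can be sent to any homogeneous element.
\<close>

lemma substitution_fresh:
  assumes "substitution \<phi>" "b \<in> ftgrade p"
  shows "\<exists>\<phi>' v. substitution \<phi>' \<and> \<phi>' a = \<phi> a \<and> \<phi>' v = b"
proof -
  define M where "M = ftbound (rep_ft a)"
  define x where "x i = (if i = M then (if p = 1 then b else 0) else \<phi> (ftx i))" for i
  define y where "y i = (if i = M then (if p = 0 then b else 0) else \<phi> (fty i))" for i
  have x: "x i \<in> ftgrade 1" for i
    using assms(2) substitution_simps(5)[OF assms(1) ftgrade_x] by (auto simp: x_def ftgrade_zero)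
  have y: "y i \<in> ftgrade 0" for i
    using assms(2) substitution_simps(5)[OF assms(1) ftgrade_y] by (auto simp: y_def ftgrade_zero)
  note \<phi>' = subst[of x y, OF x y]
  have "subst x y a = \<phi> a"
    using \<phi>'(1) assms(1) unfolding substitution_def
    by (rule trace_hom_agree) (simp add: \<phi>'(2,3) x_def y_def M_def)
  moreover have "subst x y (if p = 0 then fty M else ftx M) = b"
    by (cases p) (simp_all add: \<phi>'(2,3) x_def y_def)
  ultimately show ?thesis using \<phi>'(1) by blast
qed

text \<open>
  The elements that are orthogonal to the whole algebra with respect to the trace form modulo \<open>J\<close>.  For
  a T-ideal \<open>J\<close> of the trace algebra they form a T-ideal of the free algebra, and this carries
  statements on matrix identities over to trace relations.
\<close>

definition trace_annihilator :: "ft set \<Rightarrow> ft set" where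
  "trace_annihilator J = {a. \<forall>b. ftr (a * b) \<in> J}"

context
  fixes J assumes J: "T_ideal_trace_algebra J"
begin

lemma trace_ideal_closed:
  "0 \<in> J" "a \<in> J \<Longrightarrow> b \<in> J \<Longrightarrow> a + b \<in> J" "a \<in> J \<Longrightarrow> r \<in> trace_algebra \<Longrightarrow> r * a \<in> J"
  "a \<in> J \<Longrightarrow> r \<in> trace_algebra \<Longrightarrow> a * r \<in> J"
  "a \<in> ftgrade 0 \<Longrightarrow> b \<in> ftgrade 1 \<Longrightarrow> a + b \<in> J \<Longrightarrow> a \<in> J"
  "a \<in> ftgrade 0 \<Longrightarrow> b \<in> ftgrade 1 \<Longrightarrow> a + b \<in> J \<Longrightarrow> b \<in> J"
  using J unfolding T_ideal_trace_algebra_def graded_ideal_def by blast+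

lemma trace_ideal_substitution: "a \<in> J \<Longrightarrow> substitution \<phi> \<Longrightarrow> \<phi> a \<in> J"
  using J unfolding T_ideal_trace_algebra_def by blast

lemma trace_ideal_of_int: "a \<in> J \<Longrightarrow> of_int k * a \<in> J"
  using trace_ideal_closed(3)[OF _ trace_algebra_const[of "of_int k"]] by (simp add: ftconst_of_int)

lemma trace_annihilatorI:
  assumes "\<And>b p. b \<in> ftgrade p \<Longrightarrow> ftr (a * b) \<in> J"
  shows "a \<in> trace_annihilator J"
  unfolding trace_annihilator_def
proof (intro CollectI allI)
  fix b
  obtain b0 b1 where "b0 \<in> ftgrade 0" "b1 \<in> ftgrade 1" "b = b0 + b1" using ft.hom_sum by blast
  then show "ftr (a * b) \<in> J" using assms by (simp add: distrib_left ftr_add trace_ideal_closed(2))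
qed

lemma trace_annihilator_graded:
  assumes "a \<in> ftgrade 0" "c \<in> ftgrade 1" "a + c \<in> trace_annihilator J"
  shows "a \<in> trace_annihilator J \<and> c \<in> trace_annihilator J"
proof -
  have "ftr (a * b) \<in> J \<and> ftr (c * b) \<in> J" if b: "b \<in> ftgrade p" for b p
  proof -
    have s: "ftr (a * b) + ftr (c * b) \<in> J"
      using assms(3) by (auto simp: trace_annihilator_def distrib_right ftr_add)
    have g: "ftr (a * b) \<in> ftgrade (0 + p)" "ftr (c * b) \<in> ftgrade (1 + p)"
      by (rule ftgrade_tr[OF ftgrade_mult[OF assms(1) b]], rule ftgrade_tr[OF ftgrade_mult[OF assms(2) b]])
    show ?thesis
    proof (cases p)
      assume "p = 0"
      then have "ftr (a * b) \<in> ftgrade 0" "ftr (c * b) \<in> ftgrade 1" using g by simp_all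
      then show ?thesis using trace_ideal_closed(5,6) s by blast
    next
      assume "p = 1"
      then have "ftr (a * b) \<in> ftgrade 1" "ftr (c * b) \<in> ftgrade 0" using g by simp_all
      then show ?thesis using trace_ideal_closed(5,6)[of "ftr (c * b)" "ftr (a * b)"] s by (simp add: add.commute)
    qed
  qed
  then show ?thesis by (auto intro: trace_annihilatorI)
qed

lemma trace_annihilator_add: "a \<in> trace_annihilator J \<Longrightarrow> b \<in> trace_annihilator J \<Longrightarrow> a + b \<in> trace_annihilator J"
  by (simp add: trace_annihilator_def distrib_right ftr_add trace_ideal_closed(2))

lemma trace_annihilator_left_mult:
  assumes "a \<in> trace_annihilator J" shows "r * a \<in> trace_annihilator J"
proof -
  have homogeneous: "r * a \<in> trace_annihilator J" if a: "a \<in> trace_annihilator J" "a \<in> ftgrade p" for a p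
  proof (rule trace_annihilatorI)
    fix b q assume b: "b \<in> ftgrade q"
    obtain r0 r1 where r: "r0 \<in> ftgrade 0" "r1 \<in> ftgrade 1" "r = r0 + r1" using ft.hom_sum by blast
    have ab: "a * b \<in> ftgrade (p + q)" using a(2) b by (rule ftgrade_mult)
    have "ftr (r' * (a * b)) \<in> J" if r': "r' \<in> ftgrade t" for r' t
      unfolding ftr_cyclic[OF r' ab] using a(1) by (intro trace_ideal_of_int) (simp add: trace_annihilator_def mult.assoc)
    then show "ftr (r * a * b) \<in> J"
      using r by (simp add: distrib_right ftr_add mult.assoc trace_ideal_closed(2))
  qed
  obtain a0 a1 where a: "a0 \<in> ftgrade 0" "a1 \<in> ftgrade 1" "a = a0 + a1" using ft.hom_sum by blast
  then have "a0 \<in> trace_annihilator J" "a1 \<in> trace_annihilator J" using trace_annihilator_graded assms by auto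
  then show ?thesis
    unfolding a(3) distrib_left using a homogeneous by (intro trace_annihilator_add) auto
qed

text \<open>
  Closure under a substitution is the point where new variables are needed: the element \<open>b\<close> that is to be
  multiplied with \<open>\<phi> a\<close> need not be in the image of \<open>\<phi>\<close>, but it is the image of a new variable under a
  modification of \<open>\<phi>\<close>.
\<close>

lemma T_ideal_trace_annihilator: "T_ideal (trace_annihilator J)"
  unfolding T_ideal_def graded_ideal_def
proof (intro conjI ballI allI impI subsetI)
  show "0 \<in> trace_annihilator J" by (simp add: trace_annihilator_def trace_ideal_closed(1))
  show "a * r \<in> trace_annihilator J" if "a \<in> trace_annihilator J" for a r
    using that by (simp add: trace_annihilator_def mult.assoc)
  show "b \<in> trace_annihilator J" if b: "b \<in> ftr ` (trace_annihilator J)" for b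
  proof -
    obtain a where a: "b = ftr a" "a \<in> trace_annihilator J" using b by blast
    have "ftr (a * 1) \<in> J" using a(2) unfolding trace_annihilator_def by blast
    then show ?thesis
      unfolding a(1) trace_annihilator_def by (simp add: ftr_ftr trace_ideal_closed(4) trace_algebra_tr)
  qed
  show "c \<in> trace_annihilator J" if \<phi>: "substitution \<phi>" "c \<in> \<phi> ` (trace_annihilator J)" for \<phi> c
  proof (rule trace_annihilatorI)
    fix b p assume b: "b \<in> ftgrade p"
    obtain a where a: "c = \<phi> a" "a \<in> trace_annihilator J" using \<phi>(2) by blast
    obtain \<phi>' v where \<phi>': "substitution \<phi>'" "\<phi>' a = \<phi> a" "\<phi>' v = b" using substitution_fresh[OF \<phi>(1) b] by blast
    have "ftr (a * v) \<in> J" using a(2) by (simp add: trace_annihilator_def)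
    then have "\<phi>' (ftr (a * v)) \<in> J" using \<phi>'(1) by (rule trace_ideal_substitution)
    then show "ftr (c * b) \<in> J" by (simp add: substitution_simps[OF \<phi>'(1)] \<phi>' a(1))
  qed
qed (use trace_annihilator_add trace_annihilator_left_mult trace_annihilator_graded in auto)

text \<open>
  Closing up \<open>CH e f\<close> with \<open>b\<close> gives the full alternating sum in \<open>n + 1\<close> elements, an instance of some
  \<open>T_rel\<close>; the degree of \<open>b\<close> decides which.
\<close>

lemma CH_trace_annihilator:
  assumes T: "\<And>e f. e + f = n + 1 \<Longrightarrow> T_rel e f \<in> J" and "e + f = n + 1"
  shows "CH e f \<in> trace_annihilator J"
proof (rule trace_annihilatorI)
  fix b p assume b: "b \<in> ftgrade p"
  let ?a = "(zvar e)(n := b)" and ?d = "(dpar e)(n := p)"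
  have h: "homog ?a ?d S" for S using zvar_homog[of e S] b by (auto simp: homog_def)
  have ins: "insert n {..<n} = {..<Suc n}" by auto
  have "CH e f = alt_sum {..<Suc n} {..<n} n (zvar e) (dpar e)"
    using assms(2) by (intro CH_eq_alt_sum) simp
  also have "\<dots> = alt_sum {..<Suc n} {..<n} n ?a ?d"
    by (rule alt_sum_cong) (auto simp: zvar_homog)
  finally have "ftr (CH e f * b) = of_int (koszul_sign ?d (sorted_list_of_set {..<n} @ [n])) *
      alt_sum {..<Suc n} {..<Suc n} (Suc n) ?a ?d"
    using alt_sum_close[of "{..<n}" n "Suc n" "{..<Suc n}" ?a ?d] h by (simp add: ins del: fun_upd_apply) simp
  moreover obtain \<phi> e' f' k where "substitution \<phi>" "e' + f' = Suc n"
    "alt_sum {..<Suc n} {..<Suc n} (Suc n) ?a ?d = of_int k * \<phi> (T_rel e' f')"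
    using alternating_T_rel[of "{..<Suc n}" "Suc n" "Suc n" ?a ?d] h by auto
  ultimately show "ftr (CH e f * b) \<in> J"
    using T[of e' f'] by (simp add: trace_ideal_of_int trace_ideal_substitution)
qed

lemma trace_one_trace_annihilator:
  assumes "ftr 1 - of_nat n \<in> J" shows "ftr 1 - of_nat n \<in> trace_annihilator J"
  unfolding trace_annihilator_def
proof (intro CollectI allI)
  fix b
  have "ftr (of_nat n * b) = of_nat n * ftr b" using ftr_of_int[of "int n" b] by simp
  then have "ftr ((ftr 1 - of_nat n) * b) = (ftr 1 - of_nat n) * ftr b"
    using ftr_add[of "ftr 1 * b - of_nat n * b" "of_nat n * b"] by (simp add: left_diff_distrib ftr_ftr)
  then show "ftr ((ftr 1 - of_nat n) * b) \<in> J"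
    using assms by (simp add: trace_ideal_closed(4) trace_algebra_tr)
qed

text \<open>
  For an element of the trace algebra, \<open>ftr a = a * ftr 1\<close>, which is \<open>n\<close> times \<open>a\<close> modulo \<open>J\<close>.
\<close>

lemma trace_element_in_trace_ideal:
  assumes "a \<in> trace_algebra" "a \<in> trace_annihilator J" "ftr 1 - of_nat n \<in> J" "n \<noteq> 0"
  shows "a \<in> J"
proof -
  have t: "ftr (c * b) = c * ftr b" if "c \<in> trace_algebra" for b c
    using that by (induction arbitrary: b) (simp_all add: ft.tr_scale ftr_ftr distrib_right ftr_add mult.assoc)
  have n: "ftconst (of_nat n) = of_nat n" using ftconst_of_int[of "int n"] by simp
  have "ftr (a * 1) \<in> J" using assms(2) unfolding trace_annihilator_def by blast
  then have "a * ftr 1 \<in> J" unfolding t[OF assms(1)] .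
  moreover have "ftconst (-1) * (a * (ftr 1 - of_nat n)) \<in> J"
    by (rule trace_ideal_closed(3)[OF trace_ideal_closed(3)[OF assms(3,1)] trace_algebra_const])
  ultimately have "a * ftr 1 + ftconst (-1) * (a * (ftr 1 - of_nat n)) \<in> J" by (rule trace_ideal_closed(2))
  moreover have "a * ftr 1 + ftconst (-1) * (a * (ftr 1 - of_nat n)) = ftconst (of_nat n) * a"
    using ftconst_central[of "of_nat n" a] by (simp add: n ftconst_minus right_diff_distrib)
  ultimately have "ftconst (of_nat n) * a \<in> J" by (simp only:)
  then have "ftconst (1 / of_nat n) * (ftconst (of_nat n) * a) \<in> J"
    by (rule trace_ideal_closed(3)[OF _ trace_algebra_const])
  moreover have "ftconst (1 / of_nat n) * (ftconst (of_nat n) * a) = a"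
    using assms(4) by (simp flip: mult.assoc ftconst_mult)
  ultimately show ?thesis by simp
qed

end

lemma trace_algebra_of_int: "of_int k \<in> trace_algebra"
  using trace_algebra_const[of "of_int k"] by (simp add: ftconst_of_int)

lemma trace_algebra_substitution:
  assumes "substitution \<phi>" "a \<in> trace_algebra" shows "\<phi> a \<in> trace_algebra"
  using assms(2) by induction (auto simp: substitution_simps[OF assms(1)] intro: trace_algebra.intros)

lemma trace_algebra_homogeneous_parts:
  assumes "a \<in> trace_algebra"
  shows "\<exists>a0\<in>trace_algebra \<inter> ftgrade 0. \<exists>a1\<in>trace_algebra \<inter> ftgrade 1. a = a0 + a1"
  using assms
proof induction
  case (trace_algebra_const u)
  show ?case
    using trace_algebra.trace_algebra_const[of u] trace_algebra.trace_algebra_const[of 0] ftgrade_const[of u] ftgrade_zero[of 1]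
    by (intro bexI[of _ "ftconst u"] bexI[of _ 0]) auto
next
  case (trace_algebra_tr a)
  obtain b0 b1 where "b0 \<in> ftgrade 0" "b1 \<in> ftgrade 1" "a = b0 + b1" using ft.hom_sum by blast
  then show ?case
    by (intro bexI[of _ "ftr b0"] bexI[of _ "ftr b1"]) (auto simp: ftr_add intro: trace_algebra.intros ftgrade_tr)
next
  case (trace_algebra_add a b)
  then obtain a0 a1 b0 b1 where "a0 \<in> trace_algebra \<inter> ftgrade 0" "a1 \<in> trace_algebra \<inter> ftgrade 1" "a = a0 + a1"
    "b0 \<in> trace_algebra \<inter> ftgrade 0" "b1 \<in> trace_algebra \<inter> ftgrade 1" "b = b0 + b1" by blast
  then show ?case
    by (intro bexI[of _ "a0 + b0"] bexI[of _ "a1 + b1"]) (auto intro: trace_algebra.intros ftgrade_add)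
next
  case (trace_algebra_mult a b)
  then obtain a0 a1 b0 b1 where *: "a0 \<in> trace_algebra \<inter> ftgrade 0" "a1 \<in> trace_algebra \<inter> ftgrade 1" "a = a0 + a1"
    "b0 \<in> trace_algebra \<inter> ftgrade 0" "b1 \<in> trace_algebra \<inter> ftgrade 1" "b = b0 + b1" by blast
  have "a0 * b0 + a1 * b1 \<in> ftgrade 0" "a0 * b1 + a1 * b0 \<in> ftgrade 1"
    using ftgrade_mult[of a0 0 b0 0] ftgrade_mult[of a1 1 b1 1] ftgrade_mult[of a0 0 b1 1] ftgrade_mult[of a1 1 b0 0] *
    by (auto intro: ftgrade_add)
  moreover have "a0 * b0 + a1 * b1 \<in> trace_algebra" "a0 * b1 + a1 * b0 \<in> trace_algebra"
    using * by (auto intro: trace_algebra.intros)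
  moreover have "a * b = (a0 * b0 + a1 * b1) + (a0 * b1 + a1 * b0)"
    using * by (simp add: algebra_simps)
  ultimately show ?case by blast
qed

lemma trace_algebra_graded:
  assumes "a \<in> ftgrade 0" "b \<in> ftgrade 1" "a + b \<in> trace_algebra"
  shows "a \<in> trace_algebra \<and> b \<in> trace_algebra"
proof -
  obtain a0 a1 where *: "a0 \<in> trace_algebra \<inter> ftgrade 0" "a1 \<in> trace_algebra \<inter> ftgrade 1" "a + b = a0 + a1"
    using trace_algebra_homogeneous_parts[OF assms(3)] by blast
  have neg: "- x \<in> ftgrade p" if "x \<in> ftgrade p" for x p using of_int_ftgrade[OF that, of "-1"] by simp
  have "a + - a0 \<in> ftgrade 0" using assms(1) * neg by (intro ftgrade_add) auto
  moreover have "a1 + - b \<in> ftgrade 1" using assms(2) * neg by (intro ftgrade_add) auto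
  moreover have "a + - a0 = a1 + - b" using *(3) by (simp add: algebra_simps)
  ultimately have "a + - a0 = 0" "a1 + - b = 0" using ft.hom_disjoint[of "a + - a0"] by simp_all
  then show ?thesis using * by simp
qed

lemma T_rel_trace_algebra: "T_rel e f \<in> trace_algebra"
proof -
  have s: "(\<Sum>i\<in>A. f i) \<in> trace_algebra" if "\<And>i. i \<in> A \<Longrightarrow> f i \<in> trace_algebra" for A and f :: "(nat \<Rightarrow> nat) \<Rightarrow> ft"
    using that trace_algebra_of_int[of 0] by (induction A rule: infinite_finite_induct) (auto intro: trace_algebra_add)
  have p: "prod_list (map (\<lambda>w. ftr (zword e w)) ws) \<in> trace_algebra" for ws
    using trace_algebra_of_int[of 1] by (induction ws) (auto intro: trace_algebra.intros)
  show ?thesis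
    unfolding T_rel_def Phi_def Let_def by (intro s trace_algebra_mult trace_algebra_of_int p)
qed

lemma trace_kernel_eq:
  "{a \<in> trace_algebra. ev_trace a = (0 :: 'n::finite gen)} = trace_algebra \<inter> {a. ev a = (0 :: 'n gmat)}"
proof -
  have "ev_trace a = (0 :: 'n gen) \<longleftrightarrow> ev a = (0 :: 'n gmat)" if "a \<in> trace_algebra" for a
  proof -
    have "s = 0" if "mat s = (0 :: 'n gmat)" for s :: "'n gen"
    proof -
      have "(mat s :: 'n gmat) $ undefined $ undefined = 0" unfolding that by simp
      then show ?thesis by (simp add: mat_def)
    qed
    then show ?thesis using ev_trace(2)[OF that, where 'n = 'n] by auto
  qed
  then show ?thesis by auto
qed

theorem theorem5p2p1:
  shows "{a \<in> trace_algebra. ev_trace a = (0 :: 'n::finite gen)} =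
           T_ideal_trace_algebra hull
             ({T_rel e f | e f. e + f = CARD('n) + 1} \<union> {ftr 1 - of_nat CARD('n)})
       \<and> {a. ev a = (0 :: 'n gen ^ 'n ^ 'n)} =
           T_ideal hull
             ({CH e f | e f. e + f = CARD('n) + 1 \<and> 1 \<le> f} \<union> {ftr 1 - of_nat CARD('n)})"
proof
  let ?ker = "{a. ev a = (0 :: 'n gmat)}"
  let ?G = "{CH e f | e f. e + f = CARD('n) + 1 \<and> 1 \<le> f} \<union> {ftr 1 - of_nat CARD('n)}"
  have Gker: "?G \<subseteq> ?ker" using ev_CH ev_trace_one by auto
  have ker_sub: "?ker \<subseteq> I" if I: "T_ideal I" "?G \<subseteq> I" for I
  proof -
    let ?I = "I \<inter> ?ker"
    have TI: "T_ideal ?I" by (rule T_ideal_Int[OF I(1) kernel_T_ideal])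
    have "a \<in> ?I" if "ev a = (0 :: 'n gmat)" for a
    proof (rule kernel_in_T_ideal[OF TI _ _ _ that])
      show "CH e f \<in> ?I" if "e + f = CARD('n) + 1" "1 \<le> f" for e f using that I(2) Gker by blast
      show "ftr 1 - of_nat CARD('n) \<in> ?I" using I(2) Gker by blast
    qed simp
    then show ?thesis by blast
  qed
  show "?ker = T_ideal hull ?G"
  proof
    show "?ker \<subseteq> T_ideal hull ?G" unfolding hull_def using ker_sub by blast
    show "T_ideal hull ?G \<subseteq> ?ker" by (rule hull_minimal[where S = T_ideal, OF Gker kernel_T_ideal])
  qed
  let ?H = "{T_rel e f | e f. e + f = CARD('n) + 1} \<union> {ftr 1 - of_nat CARD('n)}"
  have one: "ftr 1 - of_nat CARD('n) \<in> trace_algebra"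
    using trace_algebra_add[OF trace_algebra_tr[of 1] trace_algebra_of_int[of "- int CARD('n)"]] by simp
  show "{a \<in> trace_algebra. ev_trace a = (0 :: 'n gen)} = T_ideal_trace_algebra hull ?H"
    unfolding trace_kernel_eq
  proof
    show "trace_algebra \<inter> ?ker \<subseteq> T_ideal_trace_algebra hull ?H"
      unfolding hull_def
    proof (intro subsetI InterI)
      fix a J assume a: "a \<in> trace_algebra \<inter> ?ker" and "J \<in> {t. T_ideal_trace_algebra t \<and> ?H \<subseteq> t}"
      then have J: "T_ideal_trace_algebra J" "?H \<subseteq> J" by auto
      have "?G \<subseteq> trace_annihilator J"
        using CH_trace_annihilator[OF J(1), of "CARD('n)"] trace_one_trace_annihilator[OF J(1)] J(2) by blast
      then have "a \<in> trace_annihilator J" using ker_sub[OF T_ideal_trace_annihilator[OF J(1)]] a by blast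
      then show "a \<in> J" using trace_element_in_trace_ideal[OF J(1), of a "CARD('n)"] a J(2) by auto
    qed
    have "T_ideal_trace_algebra (trace_algebra \<inter> ?ker)"
      unfolding T_ideal_trace_algebra_def graded_ideal_def
    proof (intro conjI ballI allI impI)
      note K = T_ideal_closed[OF kernel_T_ideal[where 'n = 'n]] T_ideal_substitution[OF kernel_T_ideal[where 'n = 'n]]
      show "0 \<in> trace_algebra \<inter> ?ker" using trace_algebra_of_int[of 0] K(1) by simp
      show "a + b \<in> trace_algebra \<inter> ?ker" if "a \<in> trace_algebra \<inter> ?ker" "b \<in> trace_algebra \<inter> ?ker" for a b
        using that K(2)[of a b] trace_algebra_add by blast
      show "r * a \<in> trace_algebra \<inter> ?ker" "a * r \<in> trace_algebra \<inter> ?ker"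
        if "r \<in> trace_algebra" "a \<in> trace_algebra \<inter> ?ker" for a r
        using that K(3,4)[of a r] trace_algebra_mult by blast+
      show "\<phi> ` (trace_algebra \<inter> ?ker) \<subseteq> trace_algebra \<inter> ?ker" if "substitution \<phi>" for \<phi>
        using that K(6) trace_algebra_substitution by blast
      fix a b assume "a \<in> ftgrade 0" "b \<in> ftgrade 1" "a + b \<in> trace_algebra \<inter> ?ker"
      then show "a \<in> trace_algebra \<inter> ?ker" "b \<in> trace_algebra \<inter> ?ker"
        using trace_algebra_graded[of a b] T_ideal_graded[OF kernel_T_ideal[where 'n = 'n], of a b] by auto
    qed simp
    moreover have "?H \<subseteq> trace_algebra \<inter> ?ker"
      using T_rel_trace_algebra one ev_T_rel ev_trace_one by auto
    ultimately show "T_ideal_trace_algebra hull ?H \<subseteq> trace_algebra \<inter> ?ker" by (intro hull_minimal[where S = T_ideal_trace_algebra])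
  qed
qed

end
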